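(* Every graph $G$ admits a rooted tree-cut decomposition $(T,\mathcal{V})$ of finite adhesion that is linked, componental, and displays the set of all undominated edge-ends of $G$.
   Context: Graphs are arbitrary (possibly infinite) multigraphs with parallel edges allowed. Edge-ends. A ray is a one-way infinite path; its tails are its infinite connected subgraphs. Two subgraphs are separated by a finite set $F\subseteq E(G)$ if no path in $G\setminus F$ contains a vertex of both (and similarly for a vertex and a subgraph). Two rays $R,S$ are edge-equivalent if no tail of $S$ can be separated from a tail of $R$ by a finite set of edges. The equivalence classes are the edge-ends of $G$; $\Omega_E(G)$ is the set of edge-ends. A vertex $v$ edge-dominates the edge-end of $R$ if $v$ cannot be separated from any tail of $R$ by a finite set of edges. An edge-end is undominated if no vertex edge-dominates it. An edge-end $\omega$ lives in $C\subseteq V(G)$ if every ray of $\omega$ has a tail in $C$. Tree-cut decompositions. A rooted tree-cut decomposition $(T,\mathcal{V})$ of $G$ consists of a rooted tree $T$ and a family $\mathcal{V}=(V_t)_{t\in T}$ of pairwise disjoint, possibly empty sets (bags) $V_t\subseteq V(G)$ with $\bigsqcup_{t\in T}V_t=V(G)$. Let $\le$ be the tree-order of $T$ (the root is the least element) and $C_t:=\bigcup_{s\ge t}V_s$. For an edge $e\in E(T)$ with $T_1,T_2$ the two components of $T-e$, the adhesion set $F_e$ is the set of edges of $G$ between $\bigcup_{t\in T_1}V_t$ and $\bigcup_{t\in T_2}V_t$. The decomposition has finite adhesion if every $F_e$ is finite. It is componental if $G[C_t]$ is non-empty and connected for every $t\in T$. It is linked if for every finite path $t_0t_1\dots t_n$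 in $T$ with $t_0<t_1<\dots<t_n$ and $n\ge 1$ there are $\min\{|F_{t_{i-1}t_i}|:1\le i\le n\}$ edge-disjoint paths in $G$ from $F_{t_0t_1}$ to $F_{t_{n-1}t_n}$, i.e. paths connecting an edge of $F_{t_0t_1}$ to an edge of $F_{t_{n-1}t_n}$ and containing these edges (single-edge paths allowed). Displaying. Let $(T,\mathcal{V})$ have finite adhesion and let $\Omega(T)$ be the set of ends of $T$. Each $\omega\in\Omega_E(G)$ orients every edge $e$ of $T$ towards the component $T_i$ of $T-e$ such that $\omega$ lives in $\bigcup_{t\in T_i}V_t$; all edges then point towards a unique node or a unique end of $T$, and $\varphi(\omega)\in V(T)\cup\Omega(T)$ denotes this node or end. The decomposition displays a set $\Psi\subseteq\Omega_E(G)$ if $\varphi^{-1}(\Omega(T))=\Psi$ and $\varphi|_\Psi:\Psi\to\Omega(T)$ is a bijection.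
   Formalization: Componental at the root forces G to be non-empty and connected, so the claim fails for other graphs; full componentality is claimed for non-empty connected G, and for every G at all nodes other than the root, with all other properties unchanged. *)

theory Defs
  imports "HOL-Library.Disjoint_Sets"
begin

section \<open>Multigraphs\<close>

text \<open>
  Multigraphs are undirected and of arbitrary cardinality; parallel edges are distinct elements of
  \<open>edges G\<close> with the same set of endpoints. A singleton endpoint set is a loop.
\<close>

record ('v, 'e) mgraph =
  verts :: "'v set"
  edges :: "'e set"
  endpts :: "'e \<Rightarrow> 'v set"

definition multigraph :: "('v, 'e) mgraph \<Rightarrow> bool" where
  "multigraph G \<longleftrightarrow>
     (\<forall>e \<in> edges G. endpts G e \<subseteq> verts G \<and> (card (endpts G e) = 1 \<or> card (endpts G e) = 2))"

text \<open>
  A subgraph keeps the whole endpoint function of the ambient graph (also outside its own edge set),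
  so that a subgraph is determined by its vertex set and its edge set.
\<close>

definition subgraph :: "('v, 'e) mgraph \<Rightarrow> ('v, 'e) mgraph \<Rightarrow> bool" where
  "subgraph H G \<longleftrightarrow>
     multigraph H \<and> verts H \<subseteq> verts G \<and> edges H \<subseteq> edges G \<and> endpts H = endpts G"

definition induced :: "('v, 'e) mgraph \<Rightarrow> 'v set \<Rightarrow> ('v, 'e) mgraph" where
  "induced G C = G\<lparr>verts := verts G \<inter> C, edges := {e \<in> edges G. endpts G e \<subseteq> C}\<rparr>"

definition del_edges :: "('v, 'e) mgraph \<Rightarrow> 'e set \<Rightarrow> ('v, 'e) mgraph" where
  "del_edges G F = G\<lparr>edges := edges G - F\<rparr>"

definition del_verts :: "('v, 'e) mgraph \<Rightarrow> 'v set \<Rightarrow> ('v, 'e) mgraph" where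
  "del_verts G X = induced G (verts G - X)"

text \<open>A finite path, given by its list of vertices and its list of edges.\<close>

definition is_path :: "('v, 'e) mgraph \<Rightarrow> 'v list \<Rightarrow> 'e list \<Rightarrow> bool" where
  "is_path G vs es \<longleftrightarrow>
     length vs = Suc (length es) \<and> distinct vs \<and> set vs \<subseteq> verts G \<and> set es \<subseteq> edges G \<and>
     (\<forall>i < length es. endpts G (es ! i) = {vs ! i, vs ! Suc i})"

definition linked_by_path :: "('v, 'e) mgraph \<Rightarrow> 'v \<Rightarrow> 'v \<Rightarrow> bool" where
  "linked_by_path G u v \<longleftrightarrow> (\<exists>vs es. is_path G vs es \<and> hd vs = u \<and> last vs = v)"

text \<open>With this definition the graph without vertices counts as connected.\<close>

definition connected_graph :: "('v, 'e) mgraph \<Rightarrow> bool" where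
  "connected_graph G \<longleftrightarrow> (\<forall>u \<in> verts G. \<forall>v \<in> verts G. linked_by_path G u v)"

definition components :: "('v, 'e) mgraph \<Rightarrow> 'v set set" where
  "components G = (\<lambda>u. {v. linked_by_path G u v}) ` verts G"

text \<open>
  A cycle is a path together with a further edge joining its two ends; a loop and a pair of parallel
  edges are the cycles of length one and two.
\<close>

definition acyclic_graph :: "('v, 'e) mgraph \<Rightarrow> bool" where
  "acyclic_graph G \<longleftrightarrow>
     \<not> (\<exists>vs es e. is_path G vs es \<and> e \<in> edges G - set es \<and> endpts G e = {hd vs, last vs})"


section \<open>Rays and edge-ends\<close>

definition is_ray :: "('v, 'e) mgraph \<Rightarrow> ('v, 'e) mgraph \<Rightarrow> bool" where
  "is_ray G R \<longleftrightarrow> subgraph R G \<and>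
     (\<exists>p q. inj p \<and> verts R = range p \<and> edges R = range q \<and>
        (\<forall>i::nat. endpts G (q i) = {p i, p (Suc i)}))"

definition is_tail :: "('v, 'e) mgraph \<Rightarrow> ('v, 'e) mgraph \<Rightarrow> bool" where
  "is_tail S R \<longleftrightarrow> subgraph S R \<and> infinite (verts S) \<and> connected_graph S"

text \<open>
  \<open>A\<close> and \<open>B\<close> are the vertex sets of the two objects that are separated; a single vertex \<open>v\<close> is
  treated as \<open>{v}\<close>.
\<close>

definition edge_separates :: "('v, 'e) mgraph \<Rightarrow> 'e set \<Rightarrow> 'v set \<Rightarrow> 'v set \<Rightarrow> bool" where
  "edge_separates G F A B \<longleftrightarrow>
     \<not> (\<exists>vs es. is_path (del_edges G F) vs es \<and> set vs \<inter> A \<noteq> {} \<and> set vs \<inter> B \<noteq> {})"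

definition edge_equivalent ::
    "('v, 'e) mgraph \<Rightarrow> ('v, 'e) mgraph \<Rightarrow> ('v, 'e) mgraph \<Rightarrow> bool" where
  "edge_equivalent G R S \<longleftrightarrow>
     (\<forall>R' S' F. is_tail R' R \<and> is_tail S' S \<and> finite F \<and> F \<subseteq> edges G \<longrightarrow>
        \<not> edge_separates G F (verts S') (verts R'))"

definition edge_ends :: "('v, 'e) mgraph \<Rightarrow> ('v, 'e) mgraph set set" where
  "edge_ends G =
     {R. is_ray G R} // {(R, S). is_ray G R \<and> is_ray G S \<and> edge_equivalent G R S}"

text \<open>Whether a vertex dominates \<open>\<omega>\<close> does not depend on the ray representing \<open>\<omega>\<close>.\<close>

definition edge_dominates :: "('v, 'e) mgraph \<Rightarrow> 'v \<Rightarrow> ('v, 'e) mgraph set \<Rightarrow> bool" where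
  "edge_dominates G v \<omega> \<longleftrightarrow>
     (\<exists>R \<in> \<omega>. \<forall>R' F. is_tail R' R \<and> finite F \<and> F \<subseteq> edges G \<longrightarrow>
        \<not> edge_separates G F {v} (verts R'))"

definition undominated :: "('v, 'e) mgraph \<Rightarrow> ('v, 'e) mgraph set \<Rightarrow> bool" where
  "undominated G \<omega> \<longleftrightarrow> \<not> (\<exists>v \<in> verts G. edge_dominates G v \<omega>)"

text \<open>Used for edge-ends of \<open>G\<close> as well as for ends of the decomposition tree.\<close>

definition lives_in :: "('v, 'e) mgraph set \<Rightarrow> 'v set \<Rightarrow> bool" where
  "lives_in \<omega> C \<longleftrightarrow> (\<forall>R \<in> \<omega>. \<exists>R'. is_tail R' R \<and> verts R' \<subseteq> C)"

text \<open>
  The usual (vertex-)ends of a graph, needed for the decomposition tree: rays are equivalent if for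
  every finite vertex set \<open>X\<close> they have tails in the same component of \<open>G - X\<close>.
\<close>

definition graph_ends :: "('v, 'e) mgraph \<Rightarrow> ('v, 'e) mgraph set set" where
  "graph_ends G =
     {R. is_ray G R} //
     {(R, S). is_ray G R \<and> is_ray G S \<and>
        (\<forall>X. finite X \<and> X \<subseteq> verts G \<longrightarrow>
           (\<exists>C \<in> components (del_verts G X). \<exists>R' S'.
              is_tail R' R \<and> is_tail S' S \<and> verts R' \<subseteq> C \<and> verts S' \<subseteq> C))}"


section \<open>Rooted tree-cut decompositions\<close>

definition rooted_tree :: "('n, 'f) mgraph \<Rightarrow> 'n \<Rightarrow> bool" where
  "rooted_tree T r \<longleftrightarrow>
     multigraph T \<and> connected_graph T \<and> acyclic_graph T \<and> r \<in> verts T"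

definition tree_le :: "('n, 'f) mgraph \<Rightarrow> 'n \<Rightarrow> 'n \<Rightarrow> 'n \<Rightarrow> bool" where
  "tree_le T r s t \<longleftrightarrow> (\<exists>vs es. is_path T vs es \<and> hd vs = r \<and> last vs = t \<and> s \<in> set vs)"

definition tree_less :: "('n, 'f) mgraph \<Rightarrow> 'n \<Rightarrow> 'n \<Rightarrow> 'n \<Rightarrow> bool" where
  "tree_less T r s t \<longleftrightarrow> tree_le T r s t \<and> s \<noteq> t"

definition tree_cut_decomposition ::
    "('v, 'e) mgraph \<Rightarrow> ('n, 'f) mgraph \<Rightarrow> 'n \<Rightarrow> ('n \<Rightarrow> 'v set) \<Rightarrow> bool" where
  "tree_cut_decomposition G T r V \<longleftrightarrow>
     rooted_tree T r \<and> disjoint_family_on V (verts T) \<and> (\<Union>t \<in> verts T. V t) = verts G"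

definition part_above :: "('n, 'f) mgraph \<Rightarrow> 'n \<Rightarrow> ('n \<Rightarrow> 'v set) \<Rightarrow> 'n \<Rightarrow> 'v set" where
  "part_above T r V t = (\<Union>s \<in> {s \<in> verts T. tree_le T r t s}. V s)"

definition adhesion ::
    "('v, 'e) mgraph \<Rightarrow> ('n, 'f) mgraph \<Rightarrow> ('n \<Rightarrow> 'v set) \<Rightarrow> 'f \<Rightarrow> 'e set" where
  "adhesion G T V e =
     {f \<in> edges G. \<exists>T1 \<in> components (del_edges T {e}). \<exists>T2 \<in> components (del_edges T {e}).
        T1 \<noteq> T2 \<and> (\<exists>u \<in> (\<Union>t \<in> T1. V t). \<exists>v \<in> (\<Union>t \<in> T2. V t). endpts G f = {u, v})}"

definition finite_adhesion ::
    "('v, 'e) mgraph \<Rightarrow> ('n, 'f) mgraph \<Rightarrow> ('n \<Rightarrow> 'v set) \<Rightarrow> bool" where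
  "finite_adhesion G T V \<longleftrightarrow> (\<forall>e \<in> edges T. finite (adhesion G T V e))"

definition componental_at ::
    "('v, 'e) mgraph \<Rightarrow> ('n, 'f) mgraph \<Rightarrow> 'n \<Rightarrow> ('n \<Rightarrow> 'v set) \<Rightarrow> 'n \<Rightarrow> bool" where
  "componental_at G T r V t \<longleftrightarrow>
     verts (induced G (part_above T r V t)) \<noteq> {} \<and> connected_graph (induced G (part_above T r V t))"

definition componental ::
    "('v, 'e) mgraph \<Rightarrow> ('n, 'f) mgraph \<Rightarrow> 'n \<Rightarrow> ('n \<Rightarrow> 'v set) \<Rightarrow> bool" where
  "componental G T r V \<longleftrightarrow> (\<forall>t \<in> verts T. componental_at G T r V t)"

definition is_path_from_edge_to_edge ::
    "('v, 'e) mgraph \<Rightarrow> 'e set \<Rightarrow> 'e set \<Rightarrow> 'v list \<Rightarrow> 'e list \<Rightarrow> bool" where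
  "is_path_from_edge_to_edge G A B vs es \<longleftrightarrow>
     is_path G vs es \<and> es \<noteq> [] \<and> hd es \<in> A \<and> last es \<in> B"

text \<open>
  Below, \<open>ts\<close> lists the nodes \<open>t\<^sub>0 < t\<^sub>1 < \<dots> < t\<^sub>n\<close> of a path of \<open>T\<close> and \<open>es\<close> its \<open>n \<ge> 1\<close> edges.
\<close>

definition linked ::
    "('v, 'e) mgraph \<Rightarrow> ('n, 'f) mgraph \<Rightarrow> 'n \<Rightarrow> ('n \<Rightarrow> 'v set) \<Rightarrow> bool" where
  "linked G T r V \<longleftrightarrow>
     (\<forall>ts es. is_path T ts es \<and> es \<noteq> [] \<and>
        (\<forall>i < length es. tree_less T r (ts ! i) (ts ! Suc i)) \<longrightarrow>
        (\<exists>P. card P = Min ((\<lambda>e. card (adhesion G T V e)) ` set es) \<and>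
           (\<forall>(vs, fs) \<in> P.
              is_path_from_edge_to_edge G (adhesion G T V (hd es)) (adhesion G T V (last es)) vs fs) \<and>
           (\<forall>p \<in> P. \<forall>q \<in> P. p \<noteq> q \<longrightarrow> set (snd p) \<inter> set (snd q) = {})))"


section \<open>Displaying edge-ends\<close>

text \<open>
  An edge \<open>e\<close> is oriented by \<open>\<omega>\<close> towards the component \<open>K\<close> of \<open>T - e\<close> if \<open>\<omega>\<close> lives in the union of
  the bags of \<open>K\<close>. It points towards a node in \<open>K\<close>, and towards an end of \<open>T\<close> that lives in \<open>K\<close>.
\<close>

definition orients_towards ::
    "('n, 'f) mgraph \<Rightarrow> ('n \<Rightarrow> 'v set) \<Rightarrow> ('v, 'e) mgraph set \<Rightarrow> 'f \<Rightarrow> 'n set \<Rightarrow> bool" where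
  "orients_towards T V \<omega> e K \<longleftrightarrow>
     K \<in> components (del_edges T {e}) \<and> lives_in \<omega> (\<Union>t \<in> K. V t)"

definition points_to_node ::
    "('n, 'f) mgraph \<Rightarrow> ('n \<Rightarrow> 'v set) \<Rightarrow> ('v, 'e) mgraph set \<Rightarrow> 'n \<Rightarrow> bool" where
  "points_to_node T V \<omega> t \<longleftrightarrow>
     t \<in> verts T \<and> (\<forall>e \<in> edges T. \<exists>K. orients_towards T V \<omega> e K \<and> t \<in> K)"

definition points_to_end ::
    "('n, 'f) mgraph \<Rightarrow> ('n \<Rightarrow> 'v set) \<Rightarrow> ('v, 'e) mgraph set \<Rightarrow> ('n, 'f) mgraph set \<Rightarrow> bool" where
  "points_to_end T V \<omega> \<epsilon> \<longleftrightarrow>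
     \<epsilon> \<in> graph_ends T \<and> (\<forall>e \<in> edges T. \<exists>K. orients_towards T V \<omega> e K \<and> lives_in \<epsilon> K)"

text \<open>
  The map \<open>\<phi>\<close> into the disjoint union of nodes (\<open>Inl\<close>) and ends (\<open>Inr\<close>) of \<open>T\<close>; for a decomposition
  of finite adhesion exactly one value qualifies for each edge-end \<open>\<omega>\<close>.
\<close>

definition end_position ::
    "('n, 'f) mgraph \<Rightarrow> ('n \<Rightarrow> 'v set) \<Rightarrow> ('v, 'e) mgraph set \<Rightarrow> 'n + ('n, 'f) mgraph set" where
  "end_position T V \<omega> =
     (THE x. case x of Inl t \<Rightarrow> points_to_node T V \<omega> t | Inr \<epsilon> \<Rightarrow> points_to_end T V \<omega> \<epsilon>)"

definition displays ::
    "('v, 'e) mgraph \<Rightarrow> ('n, 'f) mgraph \<Rightarrow> ('n \<Rightarrow> 'v set) \<Rightarrow> ('v, 'e) mgraph set set \<Rightarrow> bool" where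
  "displays G T V \<Psi> \<longleftrightarrow>
     {\<omega> \<in> edge_ends G. end_position T V \<omega> \<in> Inr ` graph_ends T} = \<Psi> \<and>
     bij_betw (end_position T V) \<Psi> (Inr ` graph_ends T)"

end

theory Submission
  imports Defs
begin

text \<open>
  The tree is built from the root downwards: every node carries a connected vertex set \<open>C\<close> with finite
  edge boundary, its children carry disjoint connected subsets of \<open>C\<close>, and every undominated edge-end
  living in \<open>C\<close> lives in one of them. If the sets along every ray of the tree have empty intersection,
  then such a ray displays exactly one edge-end: connectedness of the sets yields a ray of \<open>G\<close> through
  all of them, and a finite cut that separated two such edge-ends would have no edge inside some set
  of the sequence, although that set is connected.

  The children come in two kinds. Those of the first kind have fewer boundary edges than \<open>C\<close> and are
  cuts of minimal size within \<open>C\<close> around some edge-end; by submodularity they can be chosen disjoint,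
  and they make the decomposition linked by Menger's theorem. Those of the second kind avoid the
  vertices of \<open>C\<close> at its boundary and contain or avoid every minimal cut of the first kind. Along a ray of
  the tree, either the boundary shrinks or all remaining vertices get closer to the outside, so the
  sets have empty intersection.
\<close>

section \<open>Walks and connectivity\<close>

text \<open>The obstacle is that minimal cuts around different edge-ends may cross and may be
  infinite in number, while uncrossing one of them has to end after finitely many steps.
  \<open>finite_crossing\<close> ensures this: inside a connected set, a cut crosses only finitely
  many members of a disjoint family of minimal cuts, because each of those must contain an edge of
  its boundary. Disjoint families are therefore made for one size at a time, smallest first, and no
  family may split a member of an earlier one; this makes their union laminar. For the first kind of
  children only sizes below the boundary size of \<open>C\<close> occur, so every member lies in a
  maximal one, and the maximal ones are disjoint. For the second kind the sizes are unbounded and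
  increasing chains may be infinite; consecutive differences along such chains replace maximal
  members (\<open>laminar_pieces\<close>). Removing the boundary vertices of \<open>C\<close> loses
  no undominated edge-end: each of these finitely many vertices is cut off from it by a finite cut,
  and such cuts can be intersected.\<close>

definition chain :: "('e \<times> 'v \<times> 'v) set \<Rightarrow> 'v list \<Rightarrow> 'e list \<Rightarrow> bool" where
  "chain \<A> vs es \<longleftrightarrow> length vs = Suc (length es) \<and>
     (\<forall>i < length es. (es ! i, vs ! i, vs ! Suc i) \<in> \<A>)"

lemma chain_snoc:
  assumes "chain \<A> vs es" "(e, last vs, z) \<in> \<A>"
  shows "chain \<A> (vs @ [z]) (es @ [e])"
proof -
  have l: "length vs = Suc (length es)" using assms by (simp add: chain_def)
  have "last vs = vs ! length es" using l by (metis diff_Suc_1 last_conv_nth length_0_conv nat.distinct(1))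
  then show ?thesis using assms l
    by (auto simp: chain_def nth_append less_Suc_eq)
qed

lemma chain_take:
  assumes "chain \<A> vs es" "i \<le> length es"
  shows "chain \<A> (take (Suc i) vs) (take i es)"
  using assms by (auto simp: chain_def)

text \<open>When the next vertex already lies on the chain, the chain is cut back to that earlier
  occurrence instead of being extended; this keeps the vertices distinct.\<close>

lemma rtrancl_imp_chain:
  assumes "(u, v) \<in> {(x, y). \<exists>e. (e, x, y) \<in> \<A>}\<^sup>*"
  shows "\<exists>vs es. chain \<A> vs es \<and> distinct vs \<and> hd vs = u \<and> last vs = v"
  using assms
proof (induction rule: rtrancl_induct)
  case base
  have "chain \<A> [u] []" by (simp add: chain_def)
  then show ?case by (intro exI[of _ "[u]"] exI[of _ "[]"]) auto
next
  case (step y z)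
  then obtain vs es e where c: "chain \<A> vs es" "distinct vs" "hd vs = u" "last vs = y" "(e, y, z) \<in> \<A>"
    by auto
  have l: "length vs = Suc (length es)" using c(1) by (simp add: chain_def)
  show ?case
  proof (cases "z \<in> set vs")
    case True
    then obtain i where i: "i < length vs" "vs ! i = z" by (auto simp: in_set_conv_nth)
    have "chain \<A> (take (Suc i) vs) (take i es)" using chain_take[OF c(1)] i l by simp
    moreover have "last (take (Suc i) vs) = z" using i by (simp add: take_Suc_conv_app_nth)
    moreover have "hd (take (Suc i) vs) = u" using c(3) by simp
    ultimately show ?thesis using c(2) distinct_take by blast
  next
    case False
    have "hd (vs @ [z]) = u" using c(3) l by (cases vs) auto
    then show ?thesis using chain_snoc[of \<A> vs es e z] c False
      by (intro exI[of _ "vs @ [z]"] exI[of _ "es @ [e]"]) auto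
  qed
qed

lemma chain_crossing:
  assumes "chain \<A> vs es" "i \<le> j" "j \<le> length es" "vs ! i \<in> A" "vs ! j \<notin> A"
  shows "\<exists>k. i \<le> k \<and> k < j \<and> vs ! k \<in> A \<and> vs ! Suc k \<notin> A"
  using assms(2-5)
proof (induction j)
  case 0 then show ?case by auto
next
  case (Suc j)
  then show ?case
  proof (cases "vs ! j \<in> A")
    case True
    moreover have "i \<le> j" using Suc.prems by (metis le_SucE)
    ultimately show ?thesis using Suc.prems by blast
  next
    case False
    moreover have "i \<le> j" using Suc.prems by (metis le_SucE)
    ultimately obtain k where "i \<le> k" "k < j" "vs ! k \<in> A" "vs ! Suc k \<notin> A"
      using Suc by force
    then show ?thesis using less_SucI by blast
  qed
qed

text \<open>Every edge contributes both of its orientations. Keeping the edge in the triple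
  distinguishes parallel edges, and lets \<open>chain\<close> serve for paths of a graph, for the
  arcs of a flow and for residual arcs alike.\<close>

definition arcs :: "('v, 'e) mgraph \<Rightarrow> ('e \<times> 'v \<times> 'v) set" where
  "arcs G = {(e, u, v). e \<in> edges G \<and> endpts G e = {u, v}}"

definition adj :: "('v, 'e) mgraph \<Rightarrow> ('v \<times> 'v) set" where
  "adj G = {(u, v). \<exists>e \<in> edges G. endpts G e = {u, v}}"

lemma adj_arcs: "adj G = {(x, y). \<exists>e. (e, x, y) \<in> arcs G}"
  by (auto simp: adj_def arcs_def)

lemma adj_sym: "(u, v) \<in> adj G \<Longrightarrow> (v, u) \<in> adj G"
  by (auto simp: adj_def insert_commute)

lemma sym_rtrancl_adj: "sym ((adj G)\<^sup>*)"
  by (intro sym_rtrancl symI) (rule adj_sym)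

lemma is_path_iff:
  assumes "multigraph G"
  shows "is_path G vs es \<longleftrightarrow> chain (arcs G) vs es \<and> distinct vs \<and> hd vs \<in> verts G"
proof
  assume "is_path G vs es"
  then show "chain (arcs G) vs es \<and> distinct vs \<and> hd vs \<in> verts G"
    by (cases vs) (auto simp: is_path_def chain_def arcs_def)
next
  assume a: "chain (arcs G) vs es \<and> distinct vs \<and> hd vs \<in> verts G"
  then have l: "length vs = Suc (length es)" by (simp add: chain_def)
  have "vs ! i \<in> verts G" if "i < length vs" for i
  proof (cases i)
    case 0
    then show ?thesis using a l by (metis hd_conv_nth list.size(3) nat.distinct(1))
  next
    case (Suc j)
    then have "endpts G (es ! j) = {vs ! j, vs ! i}" "es ! j \<in> edges G"
      using a that l by (auto simp: chain_def arcs_def)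
    then show ?thesis using assms by (auto simp: multigraph_def)
  qed
  then show "is_path G vs es"
    using a by (auto simp: is_path_def chain_def arcs_def in_set_conv_nth)
qed

lemma chain_rtrancl:
  assumes "chain \<A> vs es" "i \<le> j" "j \<le> length es"
  shows "(vs ! i, vs ! j) \<in> {(x, y). \<exists>e. (e, x, y) \<in> \<A>}\<^sup>*"
  using assms(2,3)
proof (induction j)
  case (Suc j)
  show ?case
  proof (cases "i = Suc j")
    case False
    then have "i \<le> j" "j \<le> length es" using Suc.prems by auto
    then have "(vs ! i, vs ! j) \<in> {(x, y). \<exists>e. (e, x, y) \<in> \<A>}\<^sup>*" by (rule Suc.IH)
    moreover
    have "(es ! j, vs ! j, vs ! Suc j) \<in> \<A>" using assms(1) Suc by (simp add: chain_def)
    then have "(vs ! j, vs ! Suc j) \<in> {(x, y). \<exists>e. (e, x, y) \<in> \<A>}" by blast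
    ultimately show ?thesis by (rule rtrancl.rtrancl_into_rtrancl)
  qed simp
qed simp

lemma linked_by_path_iff:
  assumes "multigraph G"
  shows "linked_by_path G u v \<longleftrightarrow> u \<in> verts G \<and> (u, v) \<in> (adj G)\<^sup>*"
proof
  assume "linked_by_path G u v"
  then obtain vs es where p: "chain (arcs G) vs es" "hd vs \<in> verts G" "hd vs = u" "last vs = v"
    using is_path_iff[OF assms] by (auto simp: linked_by_path_def)
  then have l: "length vs = Suc (length es)" by (simp add: chain_def)
  have "(vs ! 0, vs ! length es) \<in> (adj G)\<^sup>*"
    using chain_rtrancl[OF p(1), of 0 "length es"] by (simp add: adj_arcs)
  moreover have "vs ! 0 = u" using l p(3) by (metis hd_conv_nth list.size(3) nat.distinct(1))
  moreover have "vs ! length es = v" using l p(4)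
    by (metis diff_Suc_1 last_conv_nth length_0_conv nat.distinct(1))
  ultimately show "u \<in> verts G \<and> (u, v) \<in> (adj G)\<^sup>*" using p by simp
next
  assume a: "u \<in> verts G \<and> (u, v) \<in> (adj G)\<^sup>*"
  then obtain vs es where "chain (arcs G) vs es" "distinct vs" "hd vs = u" "last vs = v"
    using rtrancl_imp_chain[of u v "arcs G"] by (auto simp: adj_arcs)
  then show "linked_by_path G u v"
    using a is_path_iff[OF assms] by (auto simp: linked_by_path_def)
qed

lemma rtrancl_crossing:
  assumes "(u, v) \<in> r\<^sup>*" "u \<in> A" "v \<notin> A"
  shows "\<exists>x y. (x, y) \<in> r \<and> x \<in> A \<and> y \<notin> A"
  using assms by (induction rule: rtrancl_induct) blast+

lemma rtrancl_adj_verts: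
  assumes "multigraph G" "(u, v) \<in> (adj G)\<^sup>*" "u \<in> verts G"
  shows "v \<in> verts G"
  using assms(2,3)
proof (induction rule: rtrancl_induct)
  case (step y z)
  then show ?case using assms(1) by (auto simp: adj_def multigraph_def)
qed

lemma multigraph_induced: "multigraph G \<Longrightarrow> multigraph (induced G C)"
  by (auto simp: multigraph_def induced_def)

lemma multigraph_del_edges: "multigraph G \<Longrightarrow> multigraph (del_edges G F)"
  by (auto simp: multigraph_def del_edges_def)

section \<open>Edge boundaries\<close>

text \<open>Complements are taken in the whole type and \<open>A\<close> need not consist of
  vertices; this makes the Boolean operations, and \<open>bd G (- A) = bd G A\<close>, available
  without side conditions.\<close>

definition bd :: "('v, 'e) mgraph \<Rightarrow> 'v set \<Rightarrow> 'e set" where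
  "bd G A = {e \<in> edges G. \<exists>u v. endpts G e = {u, v} \<and> u \<in> A \<and> v \<notin> A}"

abbreviation bdc :: "('v, 'e) mgraph \<Rightarrow> 'v set \<Rightarrow> nat" where
  "bdc G A \<equiv> card (bd G A)"

lemma bd_endpts:
  "e \<in> edges G \<Longrightarrow> endpts G e = {u, v} \<Longrightarrow> e \<in> bd G A \<longleftrightarrow> (u \<in> A \<longleftrightarrow> v \<notin> A)"
  by (auto simp: bd_def doubleton_eq_iff)

lemma bdE:
  assumes "e \<in> bd G A"
  obtains u v where "e \<in> edges G" "endpts G e = {u, v}" "u \<in> A" "v \<notin> A"
  using assms by (auto simp: bd_def)

lemma bd_Compl: "bd G (- A) = bd G A"
  by (auto simp: bd_def insert_commute)

lemma bd_Un_sub: "bd G (A \<union> B) \<subseteq> bd G A \<union> bd G B"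
  by (auto elim!: bdE simp: bd_endpts)

lemma bd_Int_sub: "bd G (A \<inter> B) \<subseteq> bd G A \<union> bd G B"
  by (auto elim!: bdE simp: bd_endpts)

lemma bd_Diff_sub: "bd G (A - B) \<subseteq> bd G A \<union> bd G B"
  by (auto elim!: bdE simp: bd_endpts)

lemma finite_bd_Un: "finite (bd G A) \<Longrightarrow> finite (bd G B) \<Longrightarrow> finite (bd G (A \<union> B))"
  by (meson bd_Un_sub finite_UnI finite_subset)
lemma finite_bd_Int: "finite (bd G A) \<Longrightarrow> finite (bd G B) \<Longrightarrow> finite (bd G (A \<inter> B))"
  by (meson bd_Int_sub finite_UnI finite_subset)
lemma finite_bd_Diff: "finite (bd G A) \<Longrightarrow> finite (bd G B) \<Longrightarrow> finite (bd G (A - B))"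
  by (meson bd_Diff_sub finite_UnI finite_subset)

lemma bd_empty [simp]: "bd G {} = {}" by (auto simp: bd_def)

lemma finite_bd_UN: "finite I \<Longrightarrow> (\<And>i. i \<in> I \<Longrightarrow> finite (bd G (f i))) \<Longrightarrow> finite (bd G (\<Union>i\<in>I. f i))"
  by (induction I rule: finite_induct) (auto intro: finite_bd_Un)

lemma finite_bd_Union: "finite I \<Longrightarrow> (\<And>A. A \<in> I \<Longrightarrow> finite (bd G A)) \<Longrightarrow> finite (bd G (\<Union>I))"
  using finite_bd_UN[of I G "\<lambda>x. x"] by simp

text \<open>Elements are counted with multiplicity: one that lies in both \<open>C\<close> and
  \<open>D\<close> lies in both \<open>A\<close> and \<open>B\<close>. The submodular and the
  posimodular inequality for boundaries are instances of this.\<close>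

lemma card_two_unions:
  assumes "finite A" "finite B" "C \<union> D \<subseteq> A \<union> B" "C \<inter> D \<subseteq> A \<inter> B"
  shows "card C + card D \<le> card A + card B"
proof -
  have f: "finite C" "finite D" using assms by (auto dest: finite_subset)
  have "card C + card D = card (C \<union> D) + card (C \<inter> D)" using f by (rule card_Un_Int)
  also have "\<dots> \<le> card (A \<union> B) + card (A \<inter> B)"
    using assms by (intro add_mono card_mono) auto
  also have "\<dots> = card A + card B" using assms(1,2) by (rule card_Un_Int[symmetric])
  finally show ?thesis .
qed

lemma bdc_submodular:
  assumes "finite (bd G A)" "finite (bd G B)"
  shows "bdc G (A \<inter> B) + bdc G (A \<union> B) \<le> bdc G A + bdc G B"
proof (rule card_two_unions[OF assms])
  show "bd G (A \<inter> B) \<union> bd G (A \<union> B) \<subseteq> bd G A \<union> bd G B"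
    by (auto elim!: bdE simp: bd_endpts)
  show "bd G (A \<inter> B) \<inter> bd G (A \<union> B) \<subseteq> bd G A \<inter> bd G B"
  proof
    fix e assume e: "e \<in> bd G (A \<inter> B) \<inter> bd G (A \<union> B)"
    then obtain u v where "e \<in> edges G" "endpts G e = {u, v}" by (auto simp: bd_def)
    then show "e \<in> bd G A \<inter> bd G B" using e by (auto simp: bd_endpts)
  qed
qed

lemma bdc_posimodular:
  assumes "finite (bd G A)" "finite (bd G B)"
  shows "bdc G (A - B) + bdc G (B - A) \<le> bdc G A + bdc G B"
proof (rule card_two_unions[OF assms])
  show "bd G (A - B) \<union> bd G (B - A) \<subseteq> bd G A \<union> bd G B"
    by (auto elim!: bdE simp: bd_endpts)
  show "bd G (A - B) \<inter> bd G (B - A) \<subseteq> bd G A \<inter> bd G B"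
  proof
    fix e assume e: "e \<in> bd G (A - B) \<inter> bd G (B - A)"
    then obtain u v where "e \<in> edges G" "endpts G e = {u, v}" by (auto simp: bd_def)
    then show "e \<in> bd G A \<inter> bd G B" using e by (auto simp: bd_endpts)
  qed
qed

section \<open>Connected vertex sets and the components of an induced subgraph\<close>

definition conn :: "('v, 'e) mgraph \<Rightarrow> 'v set \<Rightarrow> bool" where
  "conn G A \<longleftrightarrow> (\<forall>u\<in>A. \<forall>v\<in>A. (u, v) \<in> (adj G \<inter> A \<times> A)\<^sup>*)"

lemma adj_induced: "adj (induced G A) = adj G \<inter> A \<times> A"
  by (auto simp: adj_def induced_def)

lemma conn_iff:
  assumes "multigraph G" "A \<subseteq> verts G"
  shows "connected_graph (induced G A) \<longleftrightarrow> conn G A"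
proof -
  have "verts (induced G A) = A" using assms by (auto simp: induced_def)
  then show ?thesis
    by (auto simp: connected_graph_def conn_def linked_by_path_iff[OF multigraph_induced[OF assms(1)]] adj_induced)
qed

text \<open>A walk inside \<open>C\<close> from \<open>A\<close> to \<open>C - A\<close> has to
  cross. The positivity of boundary sizes and the uniqueness of a displayed edge-end both rest on
  the edge found here, whose two ends lie in \<open>C\<close>.\<close>

lemma conn_bd_nonempty:
  assumes "conn G C" "A \<subset> C" "A \<noteq> {}"
  shows "\<exists>e \<in> bd G A. endpts G e \<subseteq> C"
proof -
  obtain u v where uv: "u \<in> A" "v \<in> C - A" using assms by auto
  then have "(u, v) \<in> (adj G \<inter> C \<times> C)\<^sup>*" using assms by (auto simp: conn_def)
  from rtrancl_crossing[OF this, of A] uv obtain x y where "(x, y) \<in> adj G \<inter> C \<times> C" "x \<in> A" "y \<notin> A"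
    by auto
  then obtain e where "e \<in> edges G" "endpts G e = {x, y}" "x \<in> C" "y \<in> C" by (auto simp: adj_def)
  with \<open>x \<in> A\<close> \<open>y \<notin> A\<close> show ?thesis by (intro bexI[of _ e]) (auto simp: bd_endpts)
qed

text \<open>For \<open>u \<in> A\<close> this is the component of \<open>u\<close> in the subgraph
  induced on \<open>A\<close>; for \<open>u \<notin> A\<close> it degenerates to
  \<open>{u}\<close>.\<close>

definition cmp :: "('v, 'e) mgraph \<Rightarrow> 'v set \<Rightarrow> 'v \<Rightarrow> 'v set" where
  "cmp G A u = {v. (u, v) \<in> (adj G \<inter> A \<times> A)\<^sup>*}"

lemma cmp_self: "u \<in> cmp G A u" by (simp add: cmp_def)

lemma cmp_subset: "u \<in> A \<Longrightarrow> cmp G A u \<subseteq> A"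
proof
  fix v assume "u \<in> A" "v \<in> cmp G A u"
  then have "(u, v) \<in> (adj G \<inter> A \<times> A)\<^sup>*" by (simp add: cmp_def)
  then show "v \<in> A" using \<open>u \<in> A\<close> by (induction rule: rtrancl_induct) auto
qed

lemma sym_adj_restr: "sym (adj G \<inter> A \<times> A)"
  by (auto simp: sym_def intro: adj_sym)

lemma cmp_eq: "v \<in> cmp G A u \<Longrightarrow> cmp G A v = cmp G A u"
  unfolding cmp_def using sym_rtrancl[OF sym_adj_restr, of G A]
  by (auto dest: symD intro: rtrancl_trans)

lemma cmp_disjoint: "cmp G A u \<inter> cmp G A v \<noteq> {} \<Longrightarrow> cmp G A u = cmp G A v"
  using cmp_eq by (metis disjoint_iff)

lemma cmp_conn: "conn G (cmp G A u)"
proof -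
  have *: "(u, v) \<in> (adj G \<inter> cmp G A u \<times> cmp G A u)\<^sup>*" if "v \<in> cmp G A u" for v
  proof -
    have "(u, v) \<in> (adj G \<inter> A \<times> A)\<^sup>*" using that by (simp add: cmp_def)
    then show ?thesis
    proof (induction rule: rtrancl_induct)
      case (step y z)
      then have "y \<in> cmp G A u" "z \<in> cmp G A u"
        by (auto simp: cmp_def intro: rtrancl_into_rtrancl)
      then show ?case using step by (meson IntD1 IntI SigmaI rtrancl.rtrancl_into_rtrancl)
    qed simp
  qed
  show ?thesis unfolding conn_def
    using * sym_rtrancl[OF sym_adj_restr, of G "cmp G A u"] by (meson rtrancl_trans symD)
qed

lemma conn_sub_cmp:
  assumes "conn G P" "P \<subseteq> A" "u \<in> P"
  shows "P \<subseteq> cmp G A u"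
proof
  fix v assume "v \<in> P"
  then have "(u, v) \<in> (adj G \<inter> P \<times> P)\<^sup>*" using assms by (auto simp: conn_def)
  then show "v \<in> cmp G A u"
    unfolding cmp_def using rtrancl_mono[of "adj G \<inter> P \<times> P" "adj G \<inter> A \<times> A"] assms(2) by auto
qed

lemma cmp_adj_closed:
  assumes "x \<in> cmp G A u" "u \<in> A" "(x, y) \<in> adj G" "y \<in> A"
  shows "y \<in> cmp G A u"
proof -
  have "x \<in> A" using assms cmp_subset by fast
  then show ?thesis using assms by (auto simp: cmp_def intro: rtrancl.rtrancl_into_rtrancl)
qed

lemma bd_cmp_sub:
  assumes "u \<in> A"
  shows "bd G (cmp G A u) \<subseteq> bd G A"
proof
  fix e :: 'b assume "e \<in> bd G (cmp G A u)"
  then obtain x y where e: "e \<in> edges G" "endpts G e = {x, y}" "x \<in> cmp G A u" "y \<notin> cmp G A u"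
    by (rule bdE)
  then have "y \<notin> A" using cmp_adj_closed[OF e(3) assms, of y] by (auto simp: adj_def)
  then show "e \<in> bd G A" using e cmp_subset[OF assms] by (fastforce simp: bd_endpts)
qed

text \<open>No edge joins a component to the rest of \<open>A\<close>, so the boundary of
  \<open>A\<close> is divided between the two without overlap.\<close>

lemma bd_Diff_cmp:
  assumes "u \<in> A"
  shows "bd G (A - cmp G A u) \<subseteq> bd G A - bd G (cmp G A u)"
proof
  fix e :: 'b assume "e \<in> bd G (A - cmp G A u)"
  then obtain x y where e: "e \<in> edges G" "endpts G e = {x, y}" "x \<in> A - cmp G A u" "y \<notin> A - cmp G A u"
    by (rule bdE)
  have "(y, x) \<in> adj G" using e by (auto simp: adj_def insert_commute)
  then have "y \<notin> cmp G A u" using cmp_adj_closed[where x = y and y = x, OF _ assms] e by auto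
  then show "e \<in> bd G A - bd G (cmp G A u)" using e by (auto simp: bd_endpts)
qed

section \<open>Rays as directions\<close>

text \<open>A ray is used only through the sets that contain almost all of its vertices; for sets with a
  finite edge boundary this depends only on the edge-end of the ray.\<close>

definition ev :: "('v, 'e) mgraph \<Rightarrow> 'v set \<Rightarrow> bool" where
  "ev R A \<longleftrightarrow> finite (verts R - A)"

lemma ev_mono: "ev R A \<Longrightarrow> A \<subseteq> B \<Longrightarrow> ev R B"
  unfolding ev_def by (erule rev_finite_subset) auto

lemma ev_Int: "ev R A \<Longrightarrow> ev R B \<Longrightarrow> ev R (A \<inter> B)"
  by (simp add: ev_def Diff_Int)

lemma ray_verts: "is_ray G R \<Longrightarrow> verts R \<subseteq> verts G"
  by (auto simp: is_ray_def subgraph_def)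

lemma ray_seq:
  assumes "is_ray G R"
  obtains p q where "inj p" "verts R = range p" "edges R = range q"
    "\<And>i::nat. endpts G (q i) = {p i, p (Suc i)}" "endpts R = endpts G" "range q \<subseteq> edges G" "inj q"
proof -
  obtain p q where p: "inj p" "verts R = range p" "edges R = range q"
    "\<And>i::nat. endpts G (q i) = {p i, p (Suc i)}" and s: "subgraph R G"
    using assms by (auto simp: is_ray_def)
  have "inj q"
  proof (rule injI)
    fix i j assume "q i = q j"
    then have "{p i, p (Suc i)} = {p j, p (Suc j)}" using p(4) by metis
    then show "i = j" using p(1) by (auto simp: doubleton_eq_iff inj_eq)
  qed
  then show ?thesis using p s that unfolding subgraph_def by auto
qed

lemma ray_infinite: "is_ray G R \<Longrightarrow> infinite (verts R)"
  by (metis ray_seq finite_imageD infinite_UNIV_nat)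

lemma ev_nonempty: "is_ray G R \<Longrightarrow> ev R A \<Longrightarrow> A \<inter> verts R \<noteq> {}"
  unfolding ev_def by (metis Diff_triv inf_commute ray_infinite)

lemma ev_disjoint: "is_ray G R \<Longrightarrow> ev R A \<Longrightarrow> ev R B \<Longrightarrow> A \<inter> B \<noteq> {}"
  using ev_nonempty[OF _ ev_Int] by fastforce

lemma ev_seq:
  assumes "inj p" "verts R = range p"
  shows "ev R A \<longleftrightarrow> (\<exists>n::nat. \<forall>i\<ge>n. p i \<in> A)"
proof
  assume "ev R A"
  then have "finite (p -` (verts R - A))" using assms by (simp add: ev_def finite_vimageI)
  moreover have "p -` (verts R - A) = {i. p i \<notin> A}" using assms by auto
  ultimately have "finite {i. p i \<notin> A}" by simp
  then obtain n where "\<forall>i\<in>{i. p i \<notin> A}. i < n" using finite_nat_set_iff_bounded by blast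
  then show "\<exists>n. \<forall>i\<ge>n. p i \<in> A" by (intro exI[of _ n]) force
next
  assume "\<exists>n. \<forall>i\<ge>n. p i \<in> A"
  then obtain n where "\<forall>i\<ge>n. p i \<in> A" by blast
  then have "verts R - A \<subseteq> p ` {..<n}" using assms by (auto simp: not_less[symmetric])
  then show "ev R A" unfolding ev_def by (rule finite_subset) auto
qed

text \<open>The edges of a ray are distinct, so the ray uses the finite set \<open>bd G A\<close>
  only finitely often and stays on one side afterwards. Thus \<open>ev R\<close> is an ultrafilter
  on the sets of finite boundary, and by \<open>edge_equivalent_iff\<close> this ultrafilter
  determines the edge-end.\<close>

lemma ev_dichotomy:
  assumes "is_ray G R" "finite (bd G A)"
  shows "ev R A \<or> ev R (- A)"
proof -
  obtain p q where p: "inj p" "verts R = range p"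
    "\<And>i::nat. endpts G (q i) = {p i, p (Suc i)}" "range q \<subseteq> edges G" "inj q"
    using ray_seq[OF assms(1)] by metis
  have "finite {i. q i \<in> bd G A}" using finite_vimageI[OF assms(2) p(5)] by (simp add: vimage_def)
  then obtain n where n: "\<forall>i\<in>{i. q i \<in> bd G A}. i < n" using finite_nat_set_iff_bounded by blast
  have step: "p (Suc i) \<in> A \<longleftrightarrow> p i \<in> A" if "i \<ge> n" for i
  proof -
    have "q i \<notin> bd G A" using n that by auto
    moreover have "q i \<in> edges G" using p(4) by auto
    ultimately show ?thesis using p(3)[of i] by (auto simp: bd_endpts)
  qed
  have "p i \<in> A \<longleftrightarrow> p n \<in> A" if "i \<ge> n" for i
    using that by (induction i rule: dec_induct) (auto simp: step)
  then show ?thesis unfolding ev_seq[OF p(1,2)] by (metis ComplI)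
qed

lemma ev_Diff: "is_ray G R \<Longrightarrow> ev R A \<Longrightarrow> finite (bd G B) \<Longrightarrow> \<not> ev R B \<Longrightarrow> ev R (A - B)"
  using ev_Int[of R A "- B"] ev_dichotomy[of G R B] by (auto simp: Diff_eq)

lemma ev_Un_imp:
  assumes "is_ray G R" "ev R (A \<union> B)" "finite (bd G B)" shows "ev R A \<or> ev R B"
  using ev_Diff[OF assms(1,2,3)] ev_mono[of R "A \<union> B - B" A] by blast

lemma ev_UN_imp:
  assumes "is_ray G R" "finite I" "ev R (\<Union>I)" "\<And>A. A \<in> I \<Longrightarrow> finite (bd G A)"
  shows "\<exists>A\<in>I. ev R A"
  using assms(2-)
proof (induction I rule: finite_induct)
  case empty
  then show ?case using ev_nonempty[OF assms(1)] by fastforce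
next
  case (insert x F)
  then have "ev R x \<or> ev R (\<Union>F)"
    by (intro ev_Un_imp[OF assms(1)]) (auto intro: finite_bd_Union)
  then show ?case using insert by auto
qed

lemma ev_INT:
  assumes "finite I" "I \<noteq> {}" "\<And>i. i \<in> I \<Longrightarrow> ev R (f i)" shows "ev R (\<Inter>i\<in>I. f i)"
  using assms by (induction I rule: finite_ne_induct) (auto intro: ev_Int)

text \<open>A tail inside \<open>A\<close> is a walk within \<open>A\<close>, so it never leaves the
  component of its first vertex. This is how a cut around a ray is replaced by a connected
  one.\<close>

lemma ev_cmp:
  assumes "is_ray G R" "ev R A"
  shows "\<exists>u\<in>A. ev R (cmp G A u)"
proof -
  obtain p q where p: "inj p" "verts R = range p"
    "\<And>i::nat. endpts G (q i) = {p i, p (Suc i)}" "range q \<subseteq> edges G"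
    using ray_seq[OF assms(1)] by metis
  obtain n where n: "\<forall>i\<ge>n. p i \<in> A" using assms(2) ev_seq[OF p(1,2)] by auto
  have "p i \<in> cmp G A (p n)" if "i \<ge> n" for i
    using that
  proof (induction i rule: dec_induct)
    case base show ?case by (rule cmp_self)
  next
    case (step i)
    have "(p i, p (Suc i)) \<in> adj G" using p(3)[of i] p(4) unfolding adj_def by blast
    moreover have "p n \<in> A" "p (Suc i) \<in> A" using n step by simp_all
    ultimately show ?case using cmp_adj_closed[OF step.IH] by blast
  qed
  then show ?thesis using n ev_seq[OF p(1,2)] by blast
qed

subsection \<open>Tails\<close>

text \<open>A tail is given only as an infinite connected subgraph. From a vertex \<open>p a\<close>
  it contains, it must reach vertices beyond any later \<open>p i\<close>; the only edge of the ray
  that leaves the initial segment up to \<open>p i\<close> is \<open>q i\<close>, so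
  \<open>p i\<close> belongs to the tail.\<close>

lemma tail_cofinite:
  assumes "is_ray G R" "is_tail S R"
  shows "finite (verts R - verts S)"
proof -
  obtain p q where p: "inj p" "verts R = range p" "edges R = range q"
    "\<And>i::nat. endpts G (q i) = {p i, p (Suc i)}" "endpts R = endpts G"
    using ray_seq[OF assms(1)] by metis
  have S: "multigraph S" "verts S \<subseteq> range p" "edges S \<subseteq> range q" "endpts S = endpts G"
    "infinite (verts S)" "connected_graph S"
    using assms(2) p by (auto simp: is_tail_def subgraph_def)
  obtain a where a: "p a \<in> verts S" using S(2,5) by (metis finite.emptyI imageE ex_in_conv subsetD)
  have "p i \<in> verts S" if "i \<ge> a" for i
  proof (cases "i = a")
    case False
    have "\<not> verts S \<subseteq> p ` {..i}" using S(5) finite_subset by blast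
    then obtain b where b: "p b \<in> verts S" "b > i" using S(2) by force
    have "(p a, p b) \<in> (adj S)\<^sup>*"
      using S(6) a b linked_by_path_iff[OF S(1)] by (auto simp: connected_graph_def)
    moreover have "p a \<in> p ` {..i}" "p b \<notin> p ` {..i}" using that b p(1) by (auto simp: inj_eq)
    ultimately obtain x y where xy: "(x, y) \<in> adj S" "x \<in> p ` {..i}" "y \<notin> p ` {..i}"
      using rtrancl_crossing[of "p a" "p b" "adj S" "p ` {..i}"] by blast
    then obtain m where m: "q m \<in> edges S" "{p m, p (Suc m)} = {x, y}"
      using S(3,4) p(4) unfolding adj_def by force
    have "{p m, p (Suc m)} \<subseteq> verts S" using m S(1,4) p(4) by (auto simp: multigraph_def)
    moreover have "p i \<in> {p m, p (Suc m)}"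
      using m(2) xy(2,3) p(1) by (auto simp: doubleton_eq_iff inj_eq le_Suc_eq)
    ultimately show ?thesis by blast
  qed (use a in simp)
  then show ?thesis using ev_seq[OF p(1,2), of "verts S"] unfolding ev_def by blast
qed

lemma ev_tail: "is_ray G R \<Longrightarrow> is_tail S R \<Longrightarrow> ev R (verts S)"
  by (simp add: tail_cofinite ev_def)

lemma tail_exists:
  assumes "is_ray G R" "ev R A"
  obtains S where "is_tail S R" "verts S \<subseteq> A"
proof -
  obtain p q where p: "inj p" "verts R = range p" "edges R = range q"
    "\<And>i::nat. endpts G (q i) = {p i, p (Suc i)}" "endpts R = endpts G" "range q \<subseteq> edges G"
    using ray_seq[OF assms(1)] by metis
  obtain n where n: "\<forall>i\<ge>n. p i \<in> A" using assms(2) ev_seq[OF p(1,2)] by auto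
  define S where "S = R\<lparr>verts := p ` {n..}, edges := q ` {n..}\<rparr>"
  have S: "verts S = p ` {n..}" "edges S = q ` {n..}" "endpts S = endpts G"
    using p by (auto simp: S_def)
  have mS: "multigraph S" using p S by (auto simp: multigraph_def inj_eq card_insert_if)
  have "(p n, p i) \<in> (adj S)\<^sup>*" if "i \<ge> n" for i
    using that
  proof (induction i rule: dec_induct)
    case (step i)
    have "(p i, p (Suc i)) \<in> adj S" using p step S by (auto simp: adj_def)
    then show ?case using step by (auto intro: rtrancl_into_rtrancl)
  qed simp
  then have "connected_graph S"
    using sym_rtrancl_adj[of S] unfolding connected_graph_def linked_by_path_iff[OF mS]
    by (auto simp: S) (meson rtrancl_trans symD)
  moreover have "infinite (verts S)" using p(1) S by (simp add: finite_image_iff inj_on_subset infinite_Ici)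
  moreover have "subgraph S R" using mS S p by (auto simp: subgraph_def)
  ultimately have "is_tail S R" by (simp add: is_tail_def)
  then show ?thesis using that[of S] n S by auto
qed

lemma tail_in_iff:
  assumes "is_ray G R" shows "(\<exists>S. is_tail S R \<and> verts S \<subseteq> A) \<longleftrightarrow> ev R A"
  using assms ev_mono ev_tail tail_exists by metis

subsection \<open>Finite separations and edge-ends\<close>

text \<open>This trades finite edge sets for vertex sets of finite boundary, the language of
  everything that follows. Given \<open>F\<close>, the set \<open>A\<close> consists of what the
  tail reaches in the graph without \<open>F\<close>, so all its boundary edges lie in
  \<open>F\<close>; given \<open>A\<close>, its boundary separates \<open>X\<close> from any tail
  inside \<open>A\<close>.\<close>

lemma separation_iff:
  assumes "multigraph G" "is_ray G R" "X \<subseteq> verts G"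
  shows "(\<exists>R' F. is_tail R' R \<and> finite F \<and> F \<subseteq> edges G \<and> edge_separates G F X (verts R'))
    \<longleftrightarrow> (\<exists>A. finite (bd G A) \<and> ev R A \<and> X \<inter> A = {})"
proof
  assume "\<exists>R' F. is_tail R' R \<and> finite F \<and> F \<subseteq> edges G \<and> edge_separates G F X (verts R')"
  then obtain R' F where F: "is_tail R' R" "finite F" "F \<subseteq> edges G" "edge_separates G F X (verts R')"
    by blast
  let ?H = "del_edges G F"
  have mH: "multigraph ?H" using assms(1) by (rule multigraph_del_edges)
  define A where "A = {v. \<exists>u\<in>verts R'. (u, v) \<in> (adj ?H)\<^sup>*}"
  have "bd G A \<subseteq> F"
  proof
    fix e assume "e \<in> bd G A"
    then obtain x y where e: "e \<in> edges G" "endpts G e = {x, y}" "x \<in> A" "y \<notin> A" by (rule bdE)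
    show "e \<in> F"
    proof (rule ccontr)
      assume "e \<notin> F"
      then have "(x, y) \<in> adj ?H" using e by (auto simp: adj_def del_edges_def)
      then show False using e(3,4) by (auto simp: A_def intro: rtrancl_into_rtrancl)
    qed
  qed
  then have "finite (bd G A)" using F(2) finite_subset by blast
  moreover have "ev R A" using ev_tail[OF assms(2) F(1)] by (rule ev_mono) (auto simp: A_def)
  moreover have "X \<inter> A = {}"
  proof (rule ccontr)
    assume "X \<inter> A \<noteq> {}"
    then obtain u v where "u \<in> verts R'" "v \<in> X" "(u, v) \<in> (adj ?H)\<^sup>*" by (auto simp: A_def)
    moreover have "verts R' \<subseteq> verts G"
      using F(1) ray_verts[OF assms(2)] by (auto simp: is_tail_def subgraph_def)
    ultimately have "linked_by_path ?H u v" using linked_by_path_iff[OF mH] by (auto simp: del_edges_def)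
    then obtain vs es where p: "is_path ?H vs es" "hd vs = u" "last vs = v"
      by (auto simp: linked_by_path_def)
    then have "vs \<noteq> []" by (auto simp: is_path_def)
    then have "u \<in> set vs" "v \<in> set vs" using p by auto
    then show False using F(4) p(1) \<open>u \<in> verts R'\<close> \<open>v \<in> X\<close> unfolding edge_separates_def by blast
  qed
  ultimately show "\<exists>A. finite (bd G A) \<and> ev R A \<and> X \<inter> A = {}" by blast
next
  assume "\<exists>A. finite (bd G A) \<and> ev R A \<and> X \<inter> A = {}"
  then obtain A where A: "finite (bd G A)" "ev R A" "X \<inter> A = {}" by blast
  obtain R' where R': "is_tail R' R" "verts R' \<subseteq> A" using tail_exists[OF assms(2) A(2)] by metis
  have "edge_separates G (bd G A) X (verts R')"
    unfolding edge_separates_def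
  proof clarify
    fix vs es x y
    assume p: "is_path (del_edges G (bd G A)) vs es"
    have *: "vs ! i \<in> A \<longleftrightarrow> vs ! 0 \<in> A" if "i < length vs" for i
      using that
    proof (induction i)
      case (Suc i)
      then have "i < length es" using p by (simp add: is_path_def)
      then have "es ! i \<in> set es" by simp
      moreover have "set es \<subseteq> edges G - bd G A" using p by (simp add: is_path_def del_edges_def)
      ultimately have "es ! i \<in> edges G - bd G A" by blast
      moreover have "endpts G (es ! i) = {vs ! i, vs ! Suc i}"
        using p \<open>i < length es\<close> by (simp add: is_path_def del_edges_def)
      ultimately show ?case using Suc by (auto simp: bd_endpts)
    qed simp
    assume "set vs \<inter> X \<noteq> {}" "set vs \<inter> verts R' \<noteq> {}"
    then obtain i j where "i < length vs" "vs ! i \<in> X" "j < length vs" "vs ! j \<in> verts R'"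
      unfolding set_conv_nth by blast
    then show False using *[of i] *[of j] A(3) R'(2) by blast
  qed
  moreover have "bd G A \<subseteq> edges G" by (auto simp: bd_def)
  ultimately show "\<exists>R' F. is_tail R' R \<and> finite F \<and> F \<subseteq> edges G \<and> edge_separates G F X (verts R')"
    using A(1) R'(1) by blast
qed

text \<open>Separation yields only the implication from \<open>ev R A\<close> to
  \<open>ev S A\<close>. As \<open>A\<close> and \<open>- A\<close> have the same boundary, the
  implication for \<open>- A\<close> together with \<open>ev_dichotomy\<close> is the
  converse.\<close>

lemma edge_equivalent_iff:
  assumes "multigraph G" "is_ray G R" "is_ray G S"
  shows "edge_equivalent G R S \<longleftrightarrow> (\<forall>A. finite (bd G A) \<longrightarrow> (ev R A \<longleftrightarrow> ev S A))"
proof -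
  have tv: "verts S' \<subseteq> verts G" if "is_tail S' S" for S'
    using that ray_verts[OF assms(3)] by (auto simp: is_tail_def subgraph_def)
  have "\<not> edge_equivalent G R S \<longleftrightarrow> (\<exists>S'. is_tail S' S \<and> (\<exists>R' F. is_tail R' R \<and> finite F \<and>
      F \<subseteq> edges G \<and> edge_separates G F (verts S') (verts R')))"
    unfolding edge_equivalent_def by blast
  also have "\<dots> \<longleftrightarrow> (\<exists>S'. is_tail S' S \<and> (\<exists>A. finite (bd G A) \<and> ev R A \<and> verts S' \<inter> A = {}))"
    using separation_iff[OF assms(1,2)] tv by meson
  also have "\<dots> \<longleftrightarrow> (\<exists>A. finite (bd G A) \<and> ev R A \<and> (\<exists>S'. is_tail S' S \<and> verts S' \<subseteq> - A))"
    by (auto simp: disjoint_eq_subset_Compl)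
  also have "\<dots> \<longleftrightarrow> (\<exists>A. finite (bd G A) \<and> ev R A \<and> ev S (- A))"
    using tail_in_iff[OF assms(3)] by simp
  finally have 1: "edge_equivalent G R S \<longleftrightarrow> (\<forall>A. finite (bd G A) \<longrightarrow> ev R A \<longrightarrow> \<not> ev S (- A))"
    by blast
  have S: "\<not> ev S (- A) \<longleftrightarrow> ev S A" if "finite (bd G A)" for A
    using ev_dichotomy[OF assms(3) that] ev_disjoint[OF assms(3), of A "- A"] by auto
  have R: "\<not> ev R (- A) \<longleftrightarrow> ev R A" if "finite (bd G A)" for A
    using ev_dichotomy[OF assms(2) that] ev_disjoint[OF assms(2), of A "- A"] by auto
  have "(\<forall>A. finite (bd G A) \<longrightarrow> ev R A \<longrightarrow> ev S A) \<Longrightarrow> finite (bd G A) \<Longrightarrow> ev S A \<Longrightarrow> ev R A" for A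
    using R[of A] S[of A] R[of "- A"] S[of "- A"] bd_Compl[of G A] by auto
  then show ?thesis unfolding 1 using S by blast
qed

lemma dominates_iff:
  assumes "multigraph G" "is_ray G R" "v \<in> verts G"
  shows "(\<forall>R' F. is_tail R' R \<and> finite F \<and> F \<subseteq> edges G \<longrightarrow> \<not> edge_separates G F {v} (verts R'))
    \<longleftrightarrow> (\<forall>A. finite (bd G A) \<longrightarrow> ev R A \<longrightarrow> v \<in> A)"
  using separation_iff[OF assms(1,2), of "{v}"] assms(3) by auto

section \<open>Edge-ends and domination in terms of representing rays\<close>

definition equiv_rays :: "('v, 'e) mgraph \<Rightarrow> (('v, 'e) mgraph \<times> ('v, 'e) mgraph) set" where
  "equiv_rays G = {(R, S). is_ray G R \<and> is_ray G S \<and> edge_equivalent G R S}"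

lemma edge_ends_alt: "edge_ends G = {R. is_ray G R} // equiv_rays G"
  by (simp add: edge_ends_def equiv_rays_def)

lemma equiv_rays_iff:
  assumes "multigraph G"
  shows "(R, S) \<in> equiv_rays G \<longleftrightarrow>
    is_ray G R \<and> is_ray G S \<and> (\<forall>A. finite (bd G A) \<longrightarrow> (ev R A \<longleftrightarrow> ev S A))"
  using edge_equivalent_iff[OF assms] by (auto simp: equiv_rays_def)

lemma equiv_equiv_rays:
  assumes "multigraph G"
  shows "equiv {R. is_ray G R} (equiv_rays G)"
  by (rule equivI) (auto simp: refl_on_def sym_def trans_def equiv_rays_iff[OF assms])

text \<open>The condition on a ray that makes its edge-end undominated
  (\<open>undominated_iff\<close>): every vertex is cut off from the ray by a finite cut.\<close>

definition free_ray :: "('v, 'e) mgraph \<Rightarrow> ('v, 'e) mgraph \<Rightarrow> bool" where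
  "free_ray G R \<longleftrightarrow> is_ray G R \<and> (\<forall>v\<in>verts G. \<exists>A. finite (bd G A) \<and> ev R A \<and> v \<notin> A)"

lemma undominated_iff:
  assumes "multigraph G" "\<omega> \<in> edge_ends G" "R \<in> \<omega>"
  shows "undominated G \<omega> \<longleftrightarrow> free_ray G R"
proof -
  have eq: "\<omega> = equiv_rays G `` {R}"
    using assms equiv_equiv_rays[OF assms(1)] unfolding edge_ends_alt
    by (metis Image_singleton_iff equiv_class_eq quotientE)
  have rays: "is_ray G S" "\<And>A. finite (bd G A) \<Longrightarrow> ev S A \<longleftrightarrow> ev R A" if "S \<in> \<omega>" for S
    using that unfolding eq by (auto simp: equiv_rays_iff[OF assms(1)])
  have "edge_dominates G v \<omega> \<longleftrightarrow> (\<forall>A. finite (bd G A) \<longrightarrow> ev R A \<longrightarrow> v \<in> A)" if "v \<in> verts G" for v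
  proof -
    have "edge_dominates G v \<omega> \<longleftrightarrow> (\<exists>S\<in>\<omega>. \<forall>A. finite (bd G A) \<longrightarrow> ev S A \<longrightarrow> v \<in> A)"
      unfolding edge_dominates_def using dominates_iff[OF assms(1) _ that] rays(1) by (meson)
    also have "\<dots> \<longleftrightarrow> (\<forall>A. finite (bd G A) \<longrightarrow> ev R A \<longrightarrow> v \<in> A)"
      using rays(2) assms(3) by metis
    finally show ?thesis .
  qed
  then show ?thesis
    using rays(1)[OF assms(3)] unfolding undominated_def free_ray_def by blast
qed

lemma lives_in_iff:
  assumes "multigraph G" "\<omega> \<in> edge_ends G" "R \<in> \<omega>" "finite (bd G A)"
  shows "lives_in \<omega> A \<longleftrightarrow> ev R A"
proof -
  have eq: "\<omega> = equiv_rays G `` {R}"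
    using assms equiv_equiv_rays[OF assms(1)] unfolding edge_ends_alt
    by (metis Image_singleton_iff equiv_class_eq quotientE)
  have "is_ray G S \<and> (ev S A \<longleftrightarrow> ev R A)" if "S \<in> \<omega>" for S
    using that assms(4) unfolding eq by (auto simp: equiv_rays_iff[OF assms(1)])
  then show ?thesis unfolding lives_in_def using tail_in_iff assms(3) by metis
qed

lemma edge_endE:
  assumes "multigraph G" "\<omega> \<in> edge_ends G"
  obtains R where "is_ray G R" "R \<in> \<omega>" "\<omega> = equiv_rays G `` {R}"
  using assms unfolding edge_ends_alt
  by (metis (no_types, lifting) equiv_class_self equiv_equiv_rays mem_Collect_eq quotientE)

section \<open>Disjoint families of finite cuts\<close>

text \<open>The members of \<open>\<P>\<close> act as blocks that may not be split. The form is
  chosen so that union, intersection and difference stay inside: these are the operations by which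
  cuts are uncrossed.\<close>

definition cut_ring :: "('v, 'e) mgraph \<Rightarrow> 'v set \<Rightarrow> 'v set set \<Rightarrow> 'v set set" where
  "cut_ring G Y \<P> = {A. A \<subseteq> Y \<and> finite (bd G A) \<and> (\<forall>P\<in>\<P>. P \<subseteq> A \<or> P \<inter> A = {})}"

lemma cut_ring_Un: "A \<in> cut_ring G Y \<P> \<Longrightarrow> B \<in> cut_ring G Y \<P> \<Longrightarrow> A \<union> B \<in> cut_ring G Y \<P>"
  unfolding cut_ring_def by (auto intro: finite_bd_Un)
lemma cut_ring_Int: "A \<in> cut_ring G Y \<P> \<Longrightarrow> B \<in> cut_ring G Y \<P> \<Longrightarrow> A \<inter> B \<in> cut_ring G Y \<P>"
  unfolding cut_ring_def by (auto intro: finite_bd_Int)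
lemma cut_ring_Diff: "A \<in> cut_ring G Y \<P> \<Longrightarrow> B \<in> cut_ring G Y \<P> \<Longrightarrow> A - B \<in> cut_ring G Y \<P>"
  unfolding cut_ring_def by (auto intro: finite_bd_Diff)
lemma cut_ring_finite: "A \<in> cut_ring G Y \<P> \<Longrightarrow> finite (bd G A)"
  by (simp add: cut_ring_def)
lemma cut_ring_sub: "A \<in> cut_ring G Y \<P> \<Longrightarrow> A \<subseteq> Y"
  by (simp add: cut_ring_def)
lemma cut_ring_empty: "{} \<in> cut_ring G Y \<P>"
  by (simp add: cut_ring_def)
lemma cut_ring_Union:
  "finite I \<Longrightarrow> I \<subseteq> cut_ring G Y \<P> \<Longrightarrow> \<Union>I \<in> cut_ring G Y \<P>"
  by (induction I rule: finite_induct) (auto intro: cut_ring_Un cut_ring_empty)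

lemma cut_ring_antimono: "\<P> \<subseteq> \<P>' \<Longrightarrow> cut_ring G Y \<P>' \<subseteq> cut_ring G Y \<P>"
  by (auto simp: cut_ring_def)

section \<open>Minimal cuts: finiteness of crossings and uncrossing\<close>

lemma conn_bdc_pos:
  assumes "conn G C" "A \<subseteq> C" "A \<noteq> {}" "A \<noteq> C" "finite (bd G A)"
  shows "0 < bdc G A"
  using conn_bd_nonempty[OF assms(1), of A] assms by (auto simp: card_gt_0_iff)

text \<open>One witnessing ray is enough: if another member of \<open>\<A>\<close> divides
  \<open>D\<close>, the ray lives in one of the two parts, and that part then has at least as many
  boundary edges as \<open>D\<close>, provided it belongs to \<open>\<A>\<close>.\<close>

definition minimal_cut :: "('v, 'e) mgraph \<Rightarrow> 'v set set \<Rightarrow> ('v, 'e) mgraph set \<Rightarrow> 'v set \<Rightarrow> bool" where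
  "minimal_cut G \<A> \<Omega> D \<longleftrightarrow> (\<exists>R\<in>\<Omega>. ev R D \<and> (\<forall>B\<in>\<A>. ev R B \<longrightarrow> bdc G D \<le> bdc G B))"

text \<open>If \<open>D\<close> crosses \<open>A\<close> and no edge of \<open>bd G A\<close> runs
  inside \<open>D\<close>, then the boundaries of \<open>D \<inter> A\<close> and
  \<open>D - A\<close> are disjoint parts of \<open>bd G D\<close>, both nonempty since
  \<open>C\<close> is connected. Hence both are smaller than \<open>bd G D\<close>, but the
  witnessing ray lives in one of the two sets. So each crossing \<open>D\<close> owns an edge of the
  finite set \<open>bd G A\<close>, and disjoint sets own different edges.\<close>

lemma finite_crossing:
  assumes C: "conn G C" "Y \<subseteq> C" and \<Omega>: "\<Omega> \<subseteq> {R. is_ray G R}"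
    and A: "A \<in> cut_ring G Y \<P>" and \<D>: "\<D> \<subseteq> cut_ring G Y \<P>" "disjoint \<D>"
    and min: "\<And>D. D \<in> \<D> \<Longrightarrow> minimal_cut G (cut_ring G Y \<P>) \<Omega> D"
  shows "finite {D \<in> \<D>. D \<inter> A \<noteq> {} \<and> \<not> D \<subseteq> A}" (is "finite ?X")
proof -
  have ex: "\<exists>e. e \<in> bd G A \<and> endpts G e \<subseteq> D" if DX: "D \<in> ?X" for D
  proof (rule ccontr)
    assume no: "\<not> ?thesis"
    have D: "D \<in> cut_ring G Y \<P>" "D \<inter> A \<noteq> {}" "D - A \<noteq> {}" using that \<D> by auto
    have r: "D \<inter> A \<in> cut_ring G Y \<P>" "D - A \<in> cut_ring G Y \<P>"
      using D A by (auto intro: cut_ring_Int cut_ring_Diff)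
    have f: "finite (bd G (D \<inter> A))" "finite (bd G (D - A))" "finite (bd G D)"
      using r D(1) by (auto intro: cut_ring_finite)
    have no': "\<not> (e \<in> edges G \<and> endpts G e = {u, v} \<and> u \<in> D \<inter> A \<and> v \<in> D - A)" for e u v
      using no by (auto simp: bd_endpts dest!: spec[of _ e])
    have "bd G (D \<inter> A) \<inter> bd G (D - A) = {}"
    proof (rule ccontr)
      assume "\<not> ?thesis"
      then obtain e where e1: "e \<in> bd G (D \<inter> A)" and e': "e \<in> bd G (D - A)" by blast
      from e1 obtain u v where e: "e \<in> edges G" "endpts G e = {u, v}" "u \<in> D \<inter> A" "v \<notin> D \<inter> A" by (rule bdE)
      then have "v \<in> D - A" using e' bd_endpts[OF e(1,2), of "D - A"] by blast
      then show False using no' e by blast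
    qed
    moreover have "bd G (D \<inter> A) \<subseteq> bd G D"
    proof
      fix e assume "e \<in> bd G (D \<inter> A)"
      then obtain u v where e: "e \<in> edges G" "endpts G e = {u, v}" "u \<in> D \<inter> A" "v \<notin> D \<inter> A" by (rule bdE)
      then have "v \<notin> D" using no'[of e u v] by blast
      then show "e \<in> bd G D" using e bd_endpts[OF e(1,2)] by blast
    qed
    moreover have "bd G (D - A) \<subseteq> bd G D"
    proof
      fix e assume "e \<in> bd G (D - A)"
      then obtain u v where e: "e \<in> edges G" "endpts G e = {u, v}" "u \<in> D - A" "v \<notin> D - A" by (rule bdE)
      then have "v \<notin> D" using no'[of e v u] by (auto simp: insert_commute)
      then show "e \<in> bd G D" using e bd_endpts[OF e(1,2)] by blast
    qed
    ultimately have s: "bdc G (D \<inter> A) + bdc G (D - A) \<le> bdc G D"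
      using f card_Un_disjoint[of "bd G (D \<inter> A)" "bd G (D - A)"]
        card_mono[of "bd G D" "bd G (D \<inter> A) \<union> bd G (D - A)"] by auto
    have p: "0 < bdc G (D \<inter> A)" "0 < bdc G (D - A)"
    proof -
      have s: "D \<subseteq> C" using C(2) cut_ring_sub[OF D(1)] by blast
      have "D \<inter> A \<subseteq> C" "D - A \<subseteq> C" "D \<inter> A \<noteq> C" "D - A \<noteq> C" using s D(2,3) by blast+
      then show "0 < bdc G (D \<inter> A)" "0 < bdc G (D - A)"
        using D(2,3) f(1,2) conn_bdc_pos[OF C(1)] by simp_all
    qed
    obtain R where R: "R \<in> \<Omega>" "ev R D" "\<forall>B\<in>cut_ring G Y \<P>. ev R B \<longrightarrow> bdc G D \<le> bdc G B"
      using min[of D] DX unfolding minimal_cut_def by blast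
    have "ev R (D \<inter> A) \<or> ev R (D - A)"
      using ev_Un_imp[of G R "D \<inter> A" "D - A"] R \<Omega> f by (auto simp: Int_Diff_Un)
    then have "bdc G D \<le> bdc G (D \<inter> A) \<or> bdc G D \<le> bdc G (D - A)" using R(3) r by blast
    then show False using s p by linarith
  qed
  then have "\<forall>D\<in>?X. \<exists>e. e \<in> bd G A \<and> endpts G e \<subseteq> D" by blast
  from bchoice[OF this] obtain f where f: "\<And>D. D \<in> ?X \<Longrightarrow> f D \<in> bd G A \<and> endpts G (f D) \<subseteq> D" by blast
  have "inj_on f ?X"
  proof (rule inj_onI)
    fix D D' assume d: "D \<in> ?X" "D' \<in> ?X" "f D = f D'"
    have "endpts G (f D) \<noteq> {}" using f[OF d(1)] by (auto simp: bd_def)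
    moreover have "endpts G (f D) \<subseteq> D \<inter> D'" using f[OF d(1)] f[OF d(2)] d(3) by simp
    ultimately have "D \<inter> D' \<noteq> {}" by blast
    then show "D = D'" using d(1,2) \<D>(2) unfolding disjoint_def by blast
  qed
  moreover have "f ` ?X \<subseteq> bd G A" using f by blast
  ultimately show ?thesis using cut_ring_finite[OF A] by (rule inj_on_finite)
qed

text \<open>The outer end of a boundary edge of the union avoids every member. So a finite set of
  such edges lies in the boundary of any member that contains all their inner ends, and directedness
  provides one; more than \<open>k\<close> boundary edges are therefore impossible.\<close>

lemma directed_union_bdc:
  assumes "\<S> \<noteq> {}" "\<And>A B. A \<in> \<S> \<Longrightarrow> B \<in> \<S> \<Longrightarrow> A \<union> B \<in> \<S>"
    and "\<And>A. A \<in> \<S> \<Longrightarrow> finite (bd G A) \<and> bdc G A \<le> k"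
  shows "finite (bd G (\<Union>\<S>)) \<and> bdc G (\<Union>\<S>) \<le> k"
proof (rule ccontr)
  assume "\<not> ?thesis"
  then obtain F where F: "F \<subseteq> bd G (\<Union>\<S>)" "finite F" "card F = Suc k"
    by (metis infinite_arbitrarily_large not_less_eq_eq obtain_subset_with_card_n)
  have "F \<subseteq> bd G (\<Union>\<S>) \<Longrightarrow> \<exists>A\<in>\<S>. F \<subseteq> bd G A"
    using F(2)
  proof (induction F rule: finite_induct)
    case empty
    then show ?case using assms(1) by auto
  next
    case (insert e F)
    then obtain A where A: "A \<in> \<S>" "F \<subseteq> bd G A" by auto
    obtain u v where e: "e \<in> edges G" "endpts G e = {u, v}" "u \<in> \<Union>\<S>" "v \<notin> \<Union>\<S>"
      using insert.prems bdE[of e G "\<Union>\<S>"] by blast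
    then obtain B where B: "B \<in> \<S>" "u \<in> B" by auto
    have AB: "A \<union> B \<in> \<S>" using assms(2) A B by auto
    have "f \<in> bd G (A \<union> B)" if "f \<in> F" for f
    proof -
      have f: "f \<in> bd G A" "f \<in> bd G (\<Union>\<S>)" using A that insert.prems by auto
      from f(1) obtain x y where xy: "f \<in> edges G" "endpts G f = {x, y}" "x \<in> A" "y \<notin> A" by (rule bdE)
      then have "y \<notin> \<Union>\<S>" using f(2) A(1) bd_endpts[OF xy(1,2), of "\<Union>\<S>"] by blast
      then show ?thesis using xy AB bd_endpts[OF xy(1,2), of "A \<union> B"] by blast
    qed
    moreover have "e \<in> bd G (A \<union> B)" using e B AB by (auto simp: bd_endpts)
    ultimately show ?case using AB by blast
  qed
  then obtain A where "A \<in> \<S>" "F \<subseteq> bd G A" using F by auto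
  then show False using assms(3)[of A] F(3) by (metis card_mono not_less_eq_eq order_trans)
qed

lemma wfp_ex_least:
  assumes "wfp lt" "Z \<in> Q"
  shows "\<exists>Z'\<in>Q. \<forall>Y. lt Y Z' \<longrightarrow> Y \<notin> Q"
  using assms unfolding wfp_eq_minimal by blast

lemma strict_well_order:
  obtains lt :: "'a \<Rightarrow> 'a \<Rightarrow> bool"
  where "wfp lt" "transp lt" "\<And>x y. x \<noteq> y \<Longrightarrow> lt x y \<or> lt y x"
proof -
  obtain r :: "'a rel" where r: "Well_order r \<and> Field r = UNIV" using well_ordering by (rule exE)
  then have l: "linear_order_on UNIV r" and w: "wf (r - Id)" by (auto simp: well_order_on_def)
  have t: "trans r" "antisym r" "total r"
    using l by (auto simp: linear_order_on_def partial_order_on_def preorder_on_def)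
  show ?thesis
  proof
    show "wfp (\<lambda>x y. (x, y) \<in> r - Id)"
      unfolding wfp_def using w by (rule back_subst[of wf]) auto
    show "transp (\<lambda>x y. (x, y) \<in> r - Id)"
    proof (rule transpI)
      fix x y z assume "(x, y) \<in> r - Id" "(y, z) \<in> r - Id"
      then show "(x, z) \<in> r - Id" using t(1,2) by (auto dest: transD antisymD)
    qed
    show "(x, y) \<in> r - Id \<or> (y, x) \<in> r - Id" if "x \<noteq> y" for x y
      using t(3) that by (auto simp: total_on_def)
  qed
qed

text \<open>Maximal cuts of the minimal size \<open>k\<close> may cross, but no ray of \<open>\<Omega>\<close> lives in two of them, so
  posimodularity allows to remove from each cut those that precede it in a well-order.\<close>

lemma disjoint_level:
  assumes C: "conn G C" "Y \<subseteq> C" and \<Omega>: "\<Omega> \<subseteq> {R. is_ray G R}"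
    and ex: "\<And>R. R \<in> \<Omega> \<Longrightarrow> \<exists>A\<in>cut_ring G Y \<P>. ev R A \<and> bdc G A = k"
    and min: "\<And>R A. R \<in> \<Omega> \<Longrightarrow> A \<in> cut_ring G Y \<P> \<Longrightarrow> ev R A \<Longrightarrow> k \<le> bdc G A"
  obtains \<D> where "\<D> \<subseteq> cut_ring G Y \<P>" "disjoint \<D>"
    "\<And>D. D \<in> \<D> \<Longrightarrow> bdc G D = k \<and> (\<exists>R\<in>\<Omega>. ev R D)" "\<And>R. R \<in> \<Omega> \<Longrightarrow> \<exists>D\<in>\<D>. ev R D"
proof -
  let ?A = "cut_ring G Y \<P>"
  define S where "S R = {A \<in> ?A. ev R A \<and> bdc G A = k}" for R :: "('a, 'b) mgraph"
  \<comment> \<open>All cuts of the minimal size \<open>k\<close> around \<open>R\<close> are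
    united; \<open>PS\<close> shows that the union is again such a cut, hence the largest
    one.\<close>
  define P where "P R = \<Union>(S R)" for R :: "('a, 'b) mgraph"
  define \<Q> where "\<Q> = P ` \<Omega>"
  have SUn: "A \<union> B \<in> S R" if "R \<in> \<Omega>" "A \<in> S R" "B \<in> ?A" "bdc G B = k" "k \<le> bdc G (A \<inter> B)" for R A B
  proof -
    have "bdc G (A \<inter> B) + bdc G (A \<union> B) \<le> bdc G A + bdc G B"
      using that by (intro bdc_submodular) (auto simp: S_def cut_ring_finite)
    moreover have "ev R (A \<union> B)" using that by (auto simp: S_def intro: ev_mono)
    moreover have "A \<union> B \<in> ?A" using that by (auto simp: S_def intro: cut_ring_Un)
    ultimately show ?thesis using that min[of R "A \<union> B"] by (auto simp: S_def)
  qed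
  have PS: "P R \<in> S R" if R: "R \<in> \<Omega>" for R
  proof -
    have "S R \<noteq> {}" using ex[OF R] by (auto simp: S_def)
    moreover have "A \<union> B \<in> S R" if "A \<in> S R" "B \<in> S R" for A B
    proof (rule SUn[OF R that(1)])
      show "k \<le> bdc G (A \<inter> B)" using that by (intro min[OF R]) (auto simp: S_def intro: cut_ring_Int ev_Int)
    qed (use that in \<open>auto simp: S_def\<close>)
    ultimately have "finite (bd G (P R)) \<and> bdc G (P R) \<le> k"
      unfolding P_def by (intro directed_union_bdc) (auto simp: S_def cut_ring_finite)
    moreover have "ev R (P R)" using ex[OF R] by (auto simp: P_def S_def intro: ev_mono)
    ultimately have "P R \<in> ?A" unfolding P_def S_def cut_ring_def by blast
    then show ?thesis using min[OF R] \<open>ev R (P R)\<close> \<open>finite (bd G (P R)) \<and> bdc G (P R) \<le> k\<close>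
      by (auto simp: S_def intro: antisym)
  qed
  \<comment> \<open>If \<open>R\<close> lives in the largest cuts of two rays, their union still has
    size \<open>k\<close> and is a cut for both rays, so each largest cut contains it.\<close>
  have uniq: "P R = X" if R: "R \<in> \<Omega>" and X: "X \<in> \<Q>" "ev R X" for R X
  proof -
    obtain R' where R': "R' \<in> \<Omega>" "X = P R'" using X by (auto simp: \<Q>_def)
    have s: "P R \<in> S R" "X \<in> S R'" using PS R R' by auto
    have i: "k \<le> bdc G (P R \<inter> X)" using s X by (intro min[OF R]) (auto simp: S_def intro: cut_ring_Int ev_Int)
    have "P R \<union> X \<in> S R" using SUn[OF R s(1) _ _ i] s by (auto simp: S_def)
    moreover have "X \<union> P R \<in> S R'" using SUn[OF R'(1) s(2), of "P R"] s i by (auto simp: S_def Int_commute)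
    ultimately show ?thesis unfolding R'(2) P_def by blast
  qed
  have \<Q>E: "\<exists>R\<in>\<Omega>. X = P R \<and> ev R X \<and> X \<in> ?A \<and> bdc G X = k" if "X \<in> \<Q>" for X
    using that PS by (auto simp: \<Q>_def S_def)
  obtain lt :: "'a set \<Rightarrow> 'a set \<Rightarrow> bool" where lt: "wfp lt" "transp lt" "\<And>x y. x \<noteq> y \<Longrightarrow> lt x y \<or> lt y x"
    using strict_well_order by blast
  define E where "E X = {x \<in> X. \<forall>Z\<in>\<Q>. lt Z X \<longrightarrow> x \<notin> Z}" for X
  have E_sub: "E X \<subseteq> X" for X by (auto simp: E_def)
  have E_disj: "E X \<inter> E Z = {}" if "X \<in> \<Q>" "Z \<in> \<Q>" "X \<noteq> Z" for X Z
    using that lt(3)[of X Z] by (auto simp: E_def)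
  have main: "X \<in> \<Q> \<longrightarrow> E X \<in> ?A \<and> bdc G (E X) = k \<and> (\<forall>R\<in>\<Omega>. ev R X \<longrightarrow> ev R (E X))" for X
  proof (induction X rule: wfp_induct_rule[OF lt(1)])
    case (1 X)
    show ?case
    proof
      assume X: "X \<in> \<Q>"
      define \<E> where "\<E> = E ` {Z \<in> \<Q>. lt Z X}"
      define \<W> where "\<W> = {W \<in> \<E>. W \<inter> X \<noteq> {}}"
      obtain R0 where R0: "R0 \<in> \<Omega>" "X = P R0" "ev R0 X" "X \<in> ?A" "bdc G X = k" using \<Q>E[OF X] by blast
      have \<E>: "W \<in> ?A \<and> bdc G W = k \<and> (\<exists>R\<in>\<Omega>. ev R W \<and> \<not> ev R X) \<and> (\<forall>R\<in>\<Omega>. ev R X \<longrightarrow> \<not> ev R W)"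
        if W: "W \<in> \<E>" for W
      proof -
        obtain Z where Z: "Z \<in> \<Q>" "lt Z X" "W = E Z" using W by (auto simp: \<E>_def)
        have "Z \<noteq> X" using lt(1) Z(2) by (metis wfp_imp_irreflp irreflpD)
        then have no: "\<not> (ev R X \<and> ev R Z)" if "R \<in> \<Omega>" for R using uniq[OF that] X Z by blast
        obtain R where R: "R \<in> \<Omega>" "ev R Z" using \<Q>E[OF Z(1)] by blast
        then have "ev R W" "\<not> ev R X" using 1[OF Z(2)] Z no by auto
        moreover have "\<forall>R\<in>\<Omega>. ev R X \<longrightarrow> \<not> ev R W" using no ev_mono E_sub Z(3) by metis
        ultimately show ?thesis using 1[OF Z(2)] Z R by auto
      qed
      \<comment> \<open>No earlier piece lies inside \<open>X\<close>, since some ray lives in the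
        piece but not in \<open>X\<close>. So every piece meeting \<open>X\<close> crosses it, and
        \<open>finite_crossing\<close> leaves finitely many.\<close>
      have "{D \<in> \<E>. D \<inter> X \<noteq> {} \<and> \<not> D \<subseteq> X} = \<W>"
        unfolding \<W>_def using \<E> ev_mono by blast
      moreover have "finite {D \<in> \<E>. D \<inter> X \<noteq> {} \<and> \<not> D \<subseteq> X}"
      proof (rule finite_crossing[OF C \<Omega> R0(4)])
        show "\<E> \<subseteq> ?A" using \<E> by auto
        show "disjoint \<E>" unfolding \<E>_def disjoint_def using E_disj by auto
        show "minimal_cut G ?A \<Omega> D" if "D \<in> \<E>" for D
          using \<E>[OF that] min unfolding minimal_cut_def by metis
      qed
      ultimately have fin: "finite \<W>" by simp
      have \<W>: "W \<in> ?A \<and> bdc G W = k \<and> (\<exists>R\<in>\<Omega>. ev R W \<and> \<not> ev R X) \<and> (\<forall>R\<in>\<Omega>. ev R X \<longrightarrow> \<not> ev R W)"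
        if "W \<in> \<W>" for W using \<E> that by (auto simp: \<W>_def)
      \<comment> \<open>A point of an earlier set lies in the piece of the least set that contains
        it. Hence removing the pieces from \<open>X\<close> removes all earlier sets.\<close>
      have "X \<inter> Z \<subseteq> \<Union>\<E>" if Z: "Z \<in> \<Q>" "lt Z X" for Z
      proof
        fix x assume x: "x \<in> X \<inter> Z"
        define Q where "Q = {Z \<in> \<Q>. lt Z X \<and> x \<in> Z}"
        have "Z \<in> Q" using x Z by (simp add: Q_def)
        from wfp_ex_least[OF lt(1) this] obtain Z' where Z'Q: "Z' \<in> Q" "\<And>Y. lt Y Z' \<Longrightarrow> Y \<notin> Q"
          by blast
        note Z' = Z'Q[unfolded Q_def]
        have "x \<in> E Z'"
        proof -
          have "x \<notin> Y" if "Y \<in> \<Q>" "lt Y Z'" for Y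
            using Z'(1) Z'(2)[of Y] that transpD[OF lt(2), of Y Z' X] by auto
          then show ?thesis using Z'(1) by (auto simp: E_def)
        qed
        then show "x \<in> \<Union>\<E>" using Z'(1) by (auto simp: \<E>_def)
      qed
      note cov = this
      have dj: "\<Union>\<E> \<inter> E X = {}"
        using E_sub unfolding \<E>_def by (fastforce simp: E_def)
      have EW: "X \<inter> \<Union>\<E> = X \<inter> \<Union>\<W>" unfolding \<W>_def by blast
      have EX: "E X = X - \<Union>\<W>"
      proof
        show "E X \<subseteq> X - \<Union>\<W>" using E_sub[of X] EW dj by blast
        show "X - \<Union>\<W> \<subseteq> E X"
        proof
          fix x assume x: "x \<in> X - \<Union>\<W>"
          then have "x \<notin> \<Union>\<E>" using EW by blast
          then have "x \<notin> Z" if "Z \<in> \<Q>" "lt Z X" for Z using cov[OF that] x by blast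
          then show "x \<in> E X" using x by (simp add: E_def)
        qed
      qed
      have "X - \<Union>\<W>' \<in> ?A \<and> bdc G (X - \<Union>\<W>') \<le> k" if "\<W>' \<subseteq> \<W>" for \<W>'
      proof -
        have "finite \<W>'" using that fin finite_subset by blast
        then show ?thesis using that
        proof (induction \<W>' rule: finite_induct)
          case empty
          then show ?case using R0 by simp
        next
          case (insert W \<W>')
          let ?B = "X - \<Union>\<W>'"
          have B: "?B \<in> ?A" "bdc G ?B \<le> k" using insert by auto
          have "W \<in> \<W>" using insert.prems by blast
          from \<W>[OF this] obtain R where R: "W \<in> ?A" "bdc G W = k" "R \<in> \<Omega>" "ev R W" "\<not> ev R X" by blast
          have "\<not> ev R ?B" using R(5) ev_mono by blast
          \<comment> \<open>The ray of \<open>W\<close> does not live in \<open>X\<close>, so it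
            stays in \<open>W\<close> when \<open>?B\<close> is taken away. This bounds
            \<open>W - ?B\<close> from below by \<open>k\<close>, and posimodularity then shows that
            deleting \<open>W\<close> from \<open>?B\<close> adds no boundary edges.\<close>
          then have "ev R (W - ?B)" using ev_Diff R \<Omega> B cut_ring_finite by blast
          then have "k \<le> bdc G (W - ?B)" using min R B cut_ring_Diff by blast
          moreover have "bdc G (?B - W) + bdc G (W - ?B) \<le> bdc G ?B + bdc G W"
            using B R by (intro bdc_posimodular) (auto intro: cut_ring_finite)
          ultimately have "bdc G (?B - W) \<le> k" using B R by linarith
          moreover have "X - \<Union>(insert W \<W>') = ?B - W" by auto
          ultimately show ?case using B R cut_ring_Diff by auto
        qed
      qed
      then have 1: "E X \<in> ?A" "bdc G (E X) \<le> k" by (auto simp: EX)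
      have 2: "ev R (E X)" if "R \<in> \<Omega>" "ev R X" for R
      proof -
        have "\<not> ev R (\<Union>\<W>)"
          using ev_UN_imp[of G R \<W>] that \<Omega> fin \<W> cut_ring_finite by blast
        moreover have "finite (bd G (\<Union>\<W>))"
          using \<W> by (intro finite_bd_Union[OF fin] cut_ring_finite) blast
        ultimately show ?thesis unfolding EX using ev_Diff that \<Omega> by blast
      qed
      have "k \<le> bdc G (E X)" using min[OF R0(1) 1(1)] 2 R0 by blast
      then show "E X \<in> ?A \<and> bdc G (E X) = k \<and> (\<forall>R\<in>\<Omega>. ev R X \<longrightarrow> ev R (E X))" using 1 2 by auto
    qed
  qed
  show ?thesis
  proof (rule that[of "E ` \<Q>"])
    show "E ` \<Q> \<subseteq> ?A" using main by auto
    show "disjoint (E ` \<Q>)" unfolding disjoint_def using E_disj by auto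
    show "bdc G D = k \<and> (\<exists>R\<in>\<Omega>. ev R D)" if "D \<in> E ` \<Q>" for D using that main \<Q>E by blast
    show "\<exists>D\<in>E ` \<Q>. ev R D" if "R \<in> \<Omega>" for R
      using that main PS by (fastforce simp: \<Q>_def S_def)
  qed
qed

text \<open>Crossings are resolved one at a time. If the witness of a crossing \<open>D\<close>
  lives in \<open>A\<close>, then \<open>D\<close> is added to \<open>A\<close> (submodularity),
  otherwise it is deleted (posimodularity); neither enlarges the boundary. As \<open>\<D>\<close> is
  disjoint, no new crossing arises, and as \<open>R\<close> lives in no member of
  \<open>\<D>\<close>, it survives every deletion. The induction runs over the finite number of
  crossings.\<close>

lemma uncross:
  assumes C: "conn G C" "Y \<subseteq> C" and \<Omega>: "\<Omega> \<subseteq> {R. is_ray G R}"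
    and \<D>: "\<D> \<subseteq> cut_ring G Y \<P>" "disjoint \<D>"
    and min: "\<And>D. D \<in> \<D> \<Longrightarrow> minimal_cut G (cut_ring G Y \<P>) \<Omega> D"
    and R: "is_ray G R" "\<And>D. D \<in> \<D> \<Longrightarrow> \<not> ev R D"
    and A: "A \<in> cut_ring G Y \<P>" "ev R A"
  shows "\<exists>A'\<in>cut_ring G Y (\<P> \<union> \<D>). ev R A' \<and> bdc G A' \<le> bdc G A"
  using A
proof (induction "card {D \<in> \<D>. D \<inter> A \<noteq> {} \<and> \<not> D \<subseteq> A}" arbitrary: A rule: less_induct)
  case less
  let ?X = "\<lambda>A. {D \<in> \<D>. D \<inter> A \<noteq> {} \<and> \<not> D \<subseteq> A}"
  note A = less.prems
  have fin: "finite (?X A)" using finite_crossing[OF C \<Omega> A(1) \<D> min] .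
  show ?case
  proof (cases "?X A = {}")
    case True
    then have "A \<in> cut_ring G Y (\<P> \<union> \<D>)" using A by (auto simp: cut_ring_def)
    then show ?thesis using A by blast
  next
    case False
    then obtain D where D: "D \<in> ?X A" by blast
    then have Dr: "D \<in> \<D>" "D \<in> cut_ring G Y \<P>" using \<D> by auto
    have f: "finite (bd G A)" "finite (bd G D)" using A Dr by (auto intro: cut_ring_finite)
    obtain S where S: "S \<in> \<Omega>" "ev S D" "\<forall>B\<in>cut_ring G Y \<P>. ev S B \<longrightarrow> bdc G D \<le> bdc G B"
      using min[OF Dr(1)] unfolding minimal_cut_def by blast
    have red: "card (?X B) < card (?X A)" if "?X B \<subseteq> ?X A - {D}" for B
      using that D fin by (metis (no_types, lifting) card_Diff1_less card_mono finite_Diff le_less_trans)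
    have dj: "D' \<inter> D = {}" if "D' \<in> \<D>" "D' \<noteq> D" for D'
      using that \<D>(2) Dr(1) unfolding disjoint_def by blast
    show ?thesis
    proof (cases "ev S A")
      case True
      then have "bdc G D \<le> bdc G (A \<inter> D)" using S A Dr by (auto intro: cut_ring_Int ev_Int)
      then have le: "bdc G (A \<union> D) \<le> bdc G A" using bdc_submodular[OF f] by linarith
      have "?X (A \<union> D) \<subseteq> ?X A - {D}" using dj by blast
      moreover have "A \<union> D \<in> cut_ring G Y \<P>" "ev R (A \<union> D)"
        using A Dr by (auto intro: cut_ring_Un ev_mono)
      ultimately show ?thesis using less.hyps[OF red, of "A \<union> D"] le by (meson order_trans)
    next
      case False
      then have "ev S (D - A)" using S \<Omega> f by (intro ev_Diff) auto
      then have "bdc G D \<le> bdc G (D - A)" using S A Dr by (auto intro: cut_ring_Diff)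
      then have le: "bdc G (A - D) \<le> bdc G A" using bdc_posimodular[OF f] by linarith
      have "?X (A - D) \<subseteq> ?X A - {D}" using dj by blast
      moreover have "A - D \<in> cut_ring G Y \<P>" "ev R (A - D)"
        using A Dr R f by (auto intro: cut_ring_Diff ev_Diff)
      ultimately show ?thesis using less.hyps[OF red, of "A - D"] le by (meson order_trans)
    qed
  qed
qed

text \<open>Level \<open>k\<close> is made for the rays of \<open>\<Omega>\<close> whose smallest
  cut has size \<open>k\<close>. Earlier levels are made unsplittable before the next is chosen, and
  \<open>uncross\<close> shows that this costs the rays not yet caught nothing in the size of their
  cuts.\<close>

lemma disjoint_levels:
  assumes C: "conn G C" "Y \<subseteq> C" and \<Omega>: "\<Omega> \<subseteq> {R. is_ray G R}"
  obtains \<D> :: "nat \<Rightarrow> 'v set set" where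
    "\<And>k. \<D> k \<subseteq> cut_ring G Y (\<P> \<union> (\<Union>j<k. \<D> j))" "\<And>k. disjoint (\<D> k)"
    "\<And>k D. D \<in> \<D> k \<Longrightarrow> bdc G D = k \<and> minimal_cut G (cut_ring G Y \<P>) \<Omega> D"
    "\<And>R A. R \<in> \<Omega> \<Longrightarrow> A \<in> cut_ring G Y \<P> \<Longrightarrow> ev R A \<Longrightarrow> \<exists>j\<le>bdc G A. \<exists>D\<in>\<D> j. ev R D"
proof -
  let ?A = "\<lambda>S. cut_ring G Y (\<P> \<union> S)"
  \<comment> \<open>For every ray not caught by \<open>S\<close>, any cut can be made compatible
    with \<open>S\<close> without growing, and the compatible cuts have size at least
    \<open>k\<close>.\<close>
  define I where "I k S \<longleftrightarrow> (\<forall>R\<in>\<Omega>. (\<forall>D\<in>S. \<not> ev R D) \<longrightarrow>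
      (\<forall>A\<in>cut_ring G Y \<P>. ev R A \<longrightarrow> (\<exists>A'\<in>?A S. ev R A' \<and> bdc G A' \<le> bdc G A)) \<and>
      (\<forall>A\<in>?A S. ev R A \<longrightarrow> k \<le> bdc G A))" for k S
  define L where "L k S \<D> \<longleftrightarrow> \<D> \<subseteq> ?A S \<and> disjoint \<D> \<and>
      (\<forall>D\<in>\<D>. bdc G D = k \<and> minimal_cut G (cut_ring G Y \<P>) \<Omega> D)" for k S \<D>
  have step: "\<exists>S'. I (Suc k) S' \<and> (\<exists>\<D>. S' = S \<union> \<D> \<and> L k S \<D>)" if I: "I k S" for k S
  proof -
    define \<Omega>' where "\<Omega>' = {R \<in> \<Omega>. (\<forall>D\<in>S. \<not> ev R D) \<and> (\<exists>A\<in>?A S. ev R A \<and> bdc G A = k)}"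
    have \<Omega>': "\<Omega>' \<subseteq> {R. is_ray G R}" using \<Omega> by (auto simp: \<Omega>'_def)
    have low: "k \<le> bdc G A" if RA: "R \<in> \<Omega>'" "A \<in> cut_ring G Y \<P>" "ev R A" for R A
    proof -
      have "R \<in> \<Omega>" "\<forall>D\<in>S. \<not> ev R D" using RA by (auto simp: \<Omega>'_def)
      then obtain A' where "A' \<in> ?A S" "ev R A'" "bdc G A' \<le> bdc G A" "k \<le> bdc G A'"
        using I RA(2,3) unfolding I_def by meson
      then show ?thesis by linarith
    qed
    have sub: "?A S \<subseteq> cut_ring G Y \<P>" by (rule cut_ring_antimono) auto
    obtain \<D> where \<D>: "\<D> \<subseteq> ?A S" "disjoint \<D>"
      "\<And>D. D \<in> \<D> \<Longrightarrow> bdc G D = k \<and> (\<exists>R\<in>\<Omega>'. ev R D)" "\<And>R. R \<in> \<Omega>' \<Longrightarrow> \<exists>D\<in>\<D>. ev R D"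
    proof (rule disjoint_level[OF C \<Omega>', of "\<P> \<union> S" k])
      show "\<exists>A\<in>?A S. ev R A \<and> bdc G A = k" if "R \<in> \<Omega>'" for R using that by (auto simp: \<Omega>'_def)
      show "k \<le> bdc G A" if "R \<in> \<Omega>'" "A \<in> ?A S" "ev R A" for R A using low that sub by blast
    qed blast
    \<comment> \<open>Minimality is kept with respect to the original ring, because the sets are
      later compared with cuts that may split members of earlier levels; \<open>low\<close> makes
      this possible.\<close>
    have m: "minimal_cut G (cut_ring G Y \<P>) \<Omega>' D" if "D \<in> \<D>" for D
      using \<D>(3)[OF that] low unfolding minimal_cut_def by metis
    have m1: "minimal_cut G (?A S) \<Omega>' D" if "D \<in> \<D>" for D
      using m[OF that] sub unfolding minimal_cut_def by blast
    have m2: "minimal_cut G (cut_ring G Y \<P>) \<Omega> D" if "D \<in> \<D>" for D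
      using m[OF that] unfolding minimal_cut_def \<Omega>'_def by blast
    have "I (Suc k) (S \<union> \<D>)"
      unfolding I_def
    proof (intro ballI impI conjI)
      fix R A assume R: "R \<in> \<Omega>" "\<forall>D\<in>S \<union> \<D>. \<not> ev R D"
      {
        assume A: "A \<in> cut_ring G Y \<P>" "ev R A"
        then obtain A' where A': "A' \<in> ?A S" "ev R A'" "bdc G A' \<le> bdc G A"
          using I R unfolding I_def by blast
 then obtain A'' where "A'' \<in> cut_ring G Y (\<P> \<union> S \<union> \<D>)" "ev R A''" "bdc G A'' \<le> bdc G A'"
          using uncross[OF C \<Omega>' \<D>(1,2) m1, of R A'] R \<Omega> by auto
        then show "\<exists>A'\<in>?A (S \<union> \<D>). ev R A' \<and> bdc G A' \<le> bdc G A"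
          using A'(3) by (intro bexI[of _ A'']) (auto simp: Un_assoc)
      next
        assume A: "A \<in> ?A (S \<union> \<D>)" "ev R A"
        then have A': "A \<in> ?A S" using cut_ring_antimono[of "\<P> \<union> S" "\<P> \<union> (S \<union> \<D>)"] by auto
        then have "k \<le> bdc G A" using I R A unfolding I_def by blast
        moreover have "R \<notin> \<Omega>'" using \<D>(4) R by blast
        ultimately show "Suc k \<le> bdc G A" using A A' R unfolding \<Omega>'_def by (auto simp: Suc_le_eq le_less)
      }
    qed
    moreover have "L k S \<D>" using \<D> m2 by (auto simp: L_def)
    ultimately show ?thesis by blast
  qed
  have "I 0 {}" by (auto simp: I_def)
  have "\<exists>S. \<forall>k. (I k (S k) \<and> (k = 0 \<longrightarrow> S k = {})) \<and> (\<exists>\<D>. S (Suc k) = S k \<union> \<D> \<and> L k (S k) \<D>)"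
  proof (rule dependent_nat_choice)
    show "\<exists>S. I 0 S \<and> (0 = (0::nat) \<longrightarrow> S = {})" using \<open>I 0 {}\<close> by blast
    show "\<exists>S'. (I (Suc k) S' \<and> (Suc k = 0 \<longrightarrow> S' = {})) \<and> (\<exists>\<D>. S' = S \<union> \<D> \<and> L k S \<D>)"
      if "I k S \<and> (k = 0 \<longrightarrow> S = {})" for S k
      using step[of k S] that by simp
  qed
  then obtain S where S: "\<And>k. I k (S k)" "\<And>k. \<exists>\<D>. S (Suc k) = S k \<union> \<D> \<and> L k (S k) \<D>" "S 0 = {}"
    by metis
  then obtain \<D> where \<D>: "\<And>k. S (Suc k) = S k \<union> \<D> k \<and> L k (S k) (\<D> k)" by metis
  have Sk: "S k = (\<Union>j<k. \<D> j)" for k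
    by (induction k) (auto simp: S(3) \<D> lessThan_Suc)
  show ?thesis
  proof (rule that[of \<D>])
    show "\<D> k \<subseteq> cut_ring G Y (\<P> \<union> (\<Union>j<k. \<D> j))" "disjoint (\<D> k)" for k
      using \<D>[of k] unfolding L_def Sk by auto
    show "bdc G D = k \<and> minimal_cut G (cut_ring G Y \<P>) \<Omega> D" if "D \<in> \<D> k" for k D
      using \<D>[of k] that unfolding L_def by auto
    show "\<exists>j\<le>bdc G A. \<exists>D\<in>\<D> j. ev R D" if RA: "R \<in> \<Omega>" "A \<in> cut_ring G Y \<P>" "ev R A" for R A
    proof (rule ccontr)
      assume no: "\<not> ?thesis"
      \<comment> \<open>A ray missed by all levels up to \<open>bdc G A\<close> would have a
        compatible cut of size at most \<open>bdc G A\<close> and, by the other half of the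
        invariant, larger than that.\<close>
      let ?k = "Suc (bdc G A)"
      have "\<forall>D\<in>S ?k. \<not> ev R D" using no unfolding Sk by (auto simp: less_Suc_eq_le)
      then obtain A' where "A' \<in> ?A (S ?k)" "ev R A'" "bdc G A' \<le> bdc G A" "?k \<le> bdc G A'"
        using S(1)[of ?k] RA unfolding I_def by meson
      then show False by linarith
    qed
  qed
qed

text \<open>\<open>N\<close> may have infinite increasing chains and hence no maximal members. Two
  members are related if they have a common superset in \<open>N\<close>, and each class gets a base
  member. The members of the class containing the base form a chain; by the rank \<open>d\<close>,
  each has only finitely many chain members below it. The differences of consecutive chain members
  are disjoint, and since every member of the class lies in one of the chain, they still catch every
  ray.\<close>

lemma laminar_pieces:
  fixes d :: "'v set \<Rightarrow> nat"
  assumes lam: "\<And>D D'. D \<in> N \<Longrightarrow> D' \<in> N \<Longrightarrow> D \<inter> D' \<noteq> {} \<Longrightarrow>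
      D = D' \<or> (d D < d D' \<and> D \<subseteq> D') \<or> (d D' < d D \<and> D' \<subseteq> D)"
    and ne: "{} \<notin> N" and N: "N \<subseteq> cut_ring G Y \<P>"
  obtains \<Q> where "\<Q> \<subseteq> cut_ring G Y \<P>" "disjoint \<Q>"
    "\<And>R D. is_ray G R \<Longrightarrow> D \<in> N \<Longrightarrow> ev R D \<Longrightarrow> \<exists>Q\<in>\<Q>. ev R Q"
proof -
  define rel where "rel D D' \<longleftrightarrow> (\<exists>D''\<in>N. D \<subseteq> D'' \<and> D' \<subseteq> D'')" for D D'
  \<comment> \<open>Related members satisfy the same predicate under \<open>SOME\<close>, so the
    base depends only on the class; this is \<open>b_eq\<close>.\<close>
  define b where "b D = (SOME B. B \<in> N \<and> rel D B)" for D
  define below where "below D = {D' \<in> N. b D \<subseteq> D' \<and> D' \<subset> D}" for D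
  define Q where "Q D = D - \<Union>(below D)" for D
  have comp: "D \<subseteq> D' \<or> D' \<subseteq> D" if "D \<in> N" "D' \<in> N" "D \<inter> D' \<noteq> {}" for D D'
    using lam[OF that] by blast
  have rank: "d D < d D'" if "D \<in> N" "D' \<in> N" "D \<subset> D'" for D D'
  proof -
    have "D \<inter> D' \<noteq> {}" using that ne by (cases "D = {}") auto
    then show ?thesis using lam[OF that(1,2)] that(3) by blast
  qed
  have rel_trans: "rel A D" if "rel A B" "rel B D" "B \<in> N" for A B D
  proof -
    obtain E F where E: "E \<in> N" "A \<subseteq> E" "B \<subseteq> E" and F: "F \<in> N" "B \<subseteq> F" "D \<subseteq> F"
      using \<open>rel A B\<close> \<open>rel B D\<close> unfolding rel_def by blast
    have "B \<noteq> {}" using ne \<open>B \<in> N\<close> by metis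
    then have "E \<inter> F \<noteq> {}" using E(3) F(2) by blast
    then have "E \<subseteq> F \<or> F \<subseteq> E" by (rule comp[OF E(1) F(1)])
    then consider "A \<subseteq> F" | "D \<subseteq> E" using E F by blast
    then show ?thesis
    proof cases
      case 1 then show ?thesis unfolding rel_def using F by blast
    next
      case 2 then show ?thesis unfolding rel_def using E by blast
    qed
  qed
  have rel_sym: "rel A B \<Longrightarrow> rel B A" for A B unfolding rel_def by blast
  have b: "b D \<in> N" "rel D (b D)" if "D \<in> N" for D
  proof -
    have "D \<in> N \<and> rel D D" using that unfolding rel_def by blast
    then have "b D \<in> N \<and> rel D (b D)" unfolding b_def by (rule someI)
    then show "b D \<in> N" "rel D (b D)" by auto
  qed
  have b_eq: "b D = b D'" if "D \<in> N" "D' \<in> N" "rel D D'" for D D'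
  proof -
    have "rel D B \<longleftrightarrow> rel D' B" for B using rel_trans rel_sym that by meson
    then show ?thesis by (simp add: b_def)
  qed
  have fin: "finite (below D)" if D: "D \<in> N" for D
  proof -
    have "inj_on d (below D)"
    proof (rule inj_onI)
      fix A B assume AB: "A \<in> below D" "B \<in> below D" "d A = d B"
      then have "A \<in> N" "B \<in> N" "b D \<subseteq> A \<inter> B" unfolding below_def by auto
      moreover have "b D \<noteq> {}" using b(1)[OF D] ne by metis
      ultimately show "A = B" using lam[of A B] AB(3) by fastforce
    qed
    moreover have "d ` below D \<subseteq> {..<d D}" using rank D unfolding below_def by auto
    ultimately show ?thesis by (meson finite_lessThan inj_on_finite)
  qed
  have bel: "below D \<subseteq> cut_ring G Y \<P>" for D using N by (auto simp: below_def)
  show ?thesis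
  proof (rule that[of "Q ` {D \<in> N. b D \<subseteq> D}"])
    show "Q ` {D \<in> N. b D \<subseteq> D} \<subseteq> cut_ring G Y \<P>"
    proof
      fix A assume "A \<in> Q ` {D \<in> N. b D \<subseteq> D}"
      then obtain D where D: "D \<in> N" "A = D - \<Union>(below D)" unfolding Q_def by blast
      have "D \<in> cut_ring G Y \<P>" using D N by blast
      then show "A \<in> cut_ring G Y \<P>" unfolding D(2)
        by (intro cut_ring_Diff cut_ring_Union[OF fin[OF D(1)] bel])
    qed
    show "disjoint (Q ` {D \<in> N. b D \<subseteq> D})"
    proof -
      have *: "Q D \<inter> Q D' = {}" if D: "D \<in> N" "D' \<in> N" "b D \<subseteq> D" "D \<subset> D'" for D D'
      proof -
        have "b D = b D'" using D by (intro b_eq) (auto simp: rel_def)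
        then have "D \<in> below D'" using D by (auto simp: below_def)
        then show ?thesis unfolding Q_def by blast
      qed
      have "Q D \<inter> Q D' = {}" if D: "D \<in> N" "D' \<in> N" "b D \<subseteq> D" "b D' \<subseteq> D'" "D \<noteq> D'" for D D'
      proof (cases "D \<inter> D' = {}")
        case True then show ?thesis unfolding Q_def by blast
      next
        case False
        then have "D \<subset> D' \<or> D' \<subset> D" using comp D by blast
        then show ?thesis using *[of D D'] *[of D' D] D by blast
      qed
      then show ?thesis unfolding disjoint_def by blast
    qed
    show "\<exists>Q\<in>Q ` {D \<in> N. b D \<subseteq> D}. ev R Q" if R: "is_ray G R" "D \<in> N" "ev R D" for R D
    proof -
      obtain D1 where D1: "D1 \<in> N" "D \<subseteq> D1" "b D \<subseteq> D1" using b(2)[OF R(2)] unfolding rel_def by blast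
      have b1: "b D1 = b D" using D1 R by (intro b_eq) (auto simp: rel_def)
      \<comment> \<open>The ray lives in some chain member; in one of least rank it lives in none of
        the finitely many smaller ones, so it lives in the difference.\<close>
      let ?M = "\<lambda>E. E \<in> N \<and> b D \<subseteq> E \<and> b E = b D \<and> ev R E"
      have "?M D1" using D1 b1 R ev_mono by blast
      then obtain E where E: "?M E" "\<And>F. ?M F \<Longrightarrow> d E \<le> d F"
        using ex_has_least_nat[of ?M D1 d] by blast
      have no: "\<not> ev R F" if F: "F \<in> below E" for F
      proof
        assume evF: "ev R F"
        have F': "F \<in> N" "b D \<subseteq> F" "F \<subset> E" using F E(1) unfolding below_def by auto
        have "b F = b E" using F' E by (intro b_eq) (auto simp: rel_def)
        then have "?M F" using F' evF E by simp
        then show False using E(2)[of F] rank[of F E] F' E(1) by simp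
      qed
      have EN: "E \<in> N" using E by blast
      have f: "\<And>A. A \<in> below E \<Longrightarrow> finite (bd G A)" using bel cut_ring_finite by blast
      have "\<not> ev R (\<Union>(below E))" using ev_UN_imp[OF R(1) fin[OF EN] _ f] no by blast
      then have "ev R (Q E)" unfolding Q_def using E R(1) f fin[OF EN]
        by (intro ev_Diff) (auto intro: finite_bd_Union)
      then show ?thesis using E by auto
    qed
  qed
qed

text \<open>The component in which the witnessing ray lives competes with \<open>P\<close>, so by
  minimality it has the whole boundary of \<open>P\<close>. The rest of \<open>P\<close> then has no
  boundary edge at all, which inside the connected \<open>C\<close> forces it to be empty.\<close>

lemma minimal_cut_conn:
  assumes "conn G C" "\<Omega> \<subseteq> {R. is_ray G R}" "P \<in> cut_ring G C {}" "minimal_cut G (cut_ring G C {}) \<Omega> P"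
  shows "conn G P"
proof -
  obtain R where R: "is_ray G R" "ev R P" "\<And>B. B \<in> cut_ring G C {} \<Longrightarrow> ev R B \<Longrightarrow> bdc G P \<le> bdc G B"
    using assms unfolding minimal_cut_def by blast
  obtain u where u: "u \<in> P" "ev R (cmp G P u)" using ev_cmp[OF R(1,2)] by blast
  let ?K = "cmp G P u"
  have P: "P \<subseteq> C" "finite (bd G P)" using assms(3) by (auto simp: cut_ring_def)
  have K: "?K \<subseteq> P" "bd G ?K \<subseteq> bd G P" "u \<in> ?K"
    using cmp_subset[OF u(1), of G] bd_cmp_sub[OF u(1), of G] cmp_self[of u G P] by auto
  have "?K \<in> cut_ring G C {}" using K P finite_subset by (auto simp: cut_ring_def)
  then have "bdc G P \<le> bdc G ?K" using R(3) u(2) by blast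
  then have "bd G ?K = bd G P" using K(2) P(2) by (intro card_seteq) auto
  then have "bd G (P - ?K) = {}" using bd_Diff_cmp[OF u(1), of G] by blast
  moreover have "P - ?K \<subset> C" using P K u(1) by blast
  ultimately have "P - ?K = {}" using conn_bd_nonempty[OF assms(1)] by blast
  then have "P = ?K" using K by blast
  then show ?thesis using cmp_conn by metis
qed

section \<open>Choosing the children of a node\<close>

lemma finite_bd_INT:
  "finite I \<Longrightarrow> I \<noteq> {} \<Longrightarrow> (\<And>i. i \<in> I \<Longrightarrow> finite (bd G (f i))) \<Longrightarrow> finite (bd G (\<Inter>i\<in>I. f i))"
  by (induction I rule: finite_ne_induct) (auto intro: finite_bd_Int)

text \<open>Sets of one level are disjoint, and a set of a later level contains or avoids each set
  of an earlier one; the level of a set is its boundary size, so inclusion follows size.\<close>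

lemma levels_laminar:
  assumes "\<And>k. \<D> k \<subseteq> cut_ring G Y (\<P> \<union> (\<Union>j<k. \<D> j))" "\<And>k. disjoint (\<D> k)"
    and "\<And>k D. D \<in> \<D> k \<Longrightarrow> bdc G D = k"
    and "D \<in> \<D> i" "D' \<in> \<D> j" "D \<inter> D' \<noteq> {}"
  shows "D = D' \<or> (bdc G D < bdc G D' \<and> D \<subseteq> D') \<or> (bdc G D' < bdc G D \<and> D' \<subseteq> D)"
proof -
  have *: "A \<subseteq> B \<or> A \<inter> B = {}" if "A \<in> \<D> i" "B \<in> \<D> j" "i < j" for A B i j
    using assms(1)[of j] that unfolding cut_ring_def by blast
  have b: "bdc G D = i" "bdc G D' = j" using assms by auto
  consider "i = j" | "i < j" | "j < i" by linarith
  then show ?thesis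
  proof cases
    case 1
    then show ?thesis using assms(2)[of i] assms(4-6) unfolding disjoint_def by blast
  next
    case 2
    then show ?thesis using *[OF assms(4,5)] assms(6) b by blast
  next
    case 3
    then show ?thesis using *[OF assms(5,4)] assms(6) b by blast
  qed
qed

text \<open>What the tree needs at one node. The fourth and fifth clauses serve linkedness: each
  child has a free ray around which no cut inside \<open>C\<close> is smaller than both boundaries,
  and a cut around a ray of the child with fewer edges than \<open>bd G C\<close> can be pushed into
  the child without growing. The last clause is the progress condition along rays of the tree. The
  guard \<open>conn G C\<close> is there for the root, whose set may be disconnected.\<close>

definition good_children :: "('v, 'e) mgraph \<Rightarrow> 'v set \<Rightarrow> 'v set set \<Rightarrow> bool" where
  "good_children G C \<S> \<longleftrightarrow> disjoint \<S> \<and>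
    (\<forall>S\<in>\<S>. S \<subseteq> C \<and> (conn G C \<longrightarrow> S \<noteq> C) \<and> S \<noteq> {} \<and> conn G S \<and> finite (bd G S)) \<and>
    (\<forall>R. free_ray G R \<longrightarrow> ev R C \<longrightarrow> (\<exists>S\<in>\<S>. ev R S)) \<and>
    (\<forall>S\<in>\<S>. \<exists>R. free_ray G R \<and> ev R S \<and> (\<forall>D\<subseteq>C. finite (bd G D) \<longrightarrow> ev R D \<longrightarrow>
       min (bdc G S) (bdc G C) \<le> bdc G D)) \<and>
    (\<forall>S\<in>\<S>. \<forall>R D. free_ray G R \<longrightarrow> ev R S \<longrightarrow> D \<subseteq> C \<longrightarrow> finite (bd G D) \<longrightarrow> ev R D \<longrightarrow>
       bdc G D < bdc G C \<longrightarrow> (\<exists>D'\<subseteq>S. finite (bd G D') \<and> ev R D' \<and> bdc G D' \<le> bdc G D)) \<and>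
    (\<forall>S\<in>\<S>. bdc G S < bdc G C \<or> (\<forall>u\<in>S. \<forall>e\<in>bd G C. u \<notin> endpts G e))"

text \<open>The sets \<open>\<P>\<close> of size below \<open>bdc G C\<close> keep the decomposition linked; the remaining children
  avoid the vertices of \<open>C\<close> at its boundary, which forces every ray of the tree to make progress.\<close>

lemma good_children_conn:
  assumes C: "conn G C" "C \<subseteq> verts G" "C \<noteq> {}" "finite (bd G C)" and mG: "multigraph G"
  shows "\<exists>\<S>. good_children G C \<S>"
proof -
  define \<Omega> where "\<Omega> = {R. free_ray G R \<and> ev R C}"
  have \<Omega>: "\<Omega> \<subseteq> {R. is_ray G R}" by (auto simp: \<Omega>_def free_ray_def)
  let ?A = "cut_ring G C {}"
  have A_iff: "D \<in> ?A \<longleftrightarrow> D \<subseteq> C \<and> finite (bd G D)" for D by (auto simp: cut_ring_def)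
  obtain \<D> where \<D>: "\<And>k. \<D> k \<subseteq> cut_ring G C ({} \<union> (\<Union>j<k. \<D> j))" "\<And>k. disjoint (\<D> k)"
    "\<And>k D. D \<in> \<D> k \<Longrightarrow> bdc G D = k \<and> minimal_cut G ?A \<Omega> D"
    "\<And>R A. R \<in> \<Omega> \<Longrightarrow> A \<in> ?A \<Longrightarrow> ev R A \<Longrightarrow> \<exists>j\<le>bdc G A. \<exists>D\<in>\<D> j. ev R D"
    by (rule disjoint_levels[OF C(1) order_refl \<Omega>, of "{}"]) (rule that; assumption)
  define N where "N = (\<Union>j<bdc G C. \<D> j)"
  have N: "D \<in> ?A \<and> bdc G D < bdc G C \<and> minimal_cut G ?A \<Omega> D" if DN: "D \<in> N" for D
  proof -
    obtain j where "j < bdc G C" "D \<in> \<D> j" using DN by (auto simp: N_def)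
    then show ?thesis using \<D>(1)[of j] \<D>(3)[of D j] by (auto simp: cut_ring_def)
  qed
  have N_ne: "D \<noteq> {}" if "D \<in> N" for D
    using N[OF that] \<Omega> ev_nonempty unfolding minimal_cut_def by blast
  have N_lam: "D = D' \<or> (bdc G D < bdc G D' \<and> D \<subseteq> D') \<or> (bdc G D' < bdc G D \<and> D' \<subseteq> D)"
    if DD: "D \<in> N" "D' \<in> N" "D \<inter> D' \<noteq> {}" for D D'
  proof -
    obtain i j where ij: "D \<in> \<D> i" "D' \<in> \<D> j" using DD(1,2) unfolding N_def by blast
    have "\<And>k D. D \<in> \<D> k \<Longrightarrow> bdc G D = k" using \<D>(3) by simp
    from levels_laminar[OF \<D>(1,2) this ij DD(3)] show ?thesis .
  qed
  \<comment> \<open>The maximal members of \<open>N\<close>. Sizes in \<open>N\<close> are below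
    \<open>bdc G C\<close> and grow with inclusion, so every member lies in a maximal one.\<close>
  define \<P> where "\<P> = {D \<in> N. \<forall>D'\<in>N. D \<subseteq> D' \<longrightarrow> D' = D}"
  have \<P>: "P \<in> ?A" "bdc G P < bdc G C" "minimal_cut G ?A \<Omega> P" "conn G P" "P \<noteq> {}" if "P \<in> \<P>" for P
    using N[of P] N_ne[of P] that minimal_cut_conn[OF C(1) \<Omega>, of P] by (auto simp: \<P>_def)
  have \<P>_disj: "disjoint \<P>"
    unfolding disjoint_def
  proof (intro ballI impI)
    fix a b assume "a \<in> \<P>" "b \<in> \<P>" "a \<noteq> b"
    then have ab: "a \<in> N" "b \<in> N" "\<not> a \<subseteq> b" "\<not> b \<subseteq> a" unfolding \<P>_def by auto
    then show "a \<inter> b = {}" using N_lam[OF ab(1,2)] by blast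
  qed
  have \<P>_cover: "\<exists>P\<in>\<P>. ev R P"
    if R: "R \<in> \<Omega>" "D \<subseteq> C" "finite (bd G D)" "ev R D" "bdc G D < bdc G C" for R D
  proof -
    obtain j E where "j \<le> bdc G D" "E \<in> \<D> j" "ev R E" using \<D>(4)[OF R(1) _ R(4)] R A_iff by blast
    then have E: "E \<in> N" "ev R E" using R by (auto simp: N_def)
    let ?M = "\<lambda>F. F \<in> N \<and> E \<subseteq> F"
    obtain F where F: "?M F" "\<And>F'. ?M F' \<Longrightarrow> bdc G F' \<le> bdc G F"
      using ex_has_greatest_nat[of ?M E "bdc G" "bdc G C"] E N by (meson less_imp_le order_refl)
    have "F' = F" if F': "F' \<in> N" "F \<subseteq> F'" for F'
    proof -
      have "bdc G F' \<le> bdc G F" using F F' by blast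
      moreover have "F \<inter> F' \<noteq> {}" using F(1) F' N_ne by blast
      ultimately show ?thesis using N_lam[of F F'] F F' by (auto simp: not_less)
    qed
    then have "F \<in> \<P>" using F by (auto simp: \<P>_def)
    moreover have "ev R F" using E F ev_mono by blast
    ultimately show ?thesis by blast
  qed
  define X0 where "X0 = {u \<in> C. \<exists>e\<in>bd G C. u \<in> endpts G e}"
  \<comment> \<open>When no boundary edge meets \<open>C\<close>, as for a connected graph at the
    root, an arbitrary vertex is removed instead, so that the second kind of children consists of
    proper subsets of \<open>C\<close>.\<close>
  define X where "X = (if X0 = {} then {SOME c. c \<in> C} else X0)"
  have "finite (\<Union>e\<in>bd G C. endpts G e)"
  proof (rule finite_UN_I[OF C(4)])
    fix e assume "e \<in> bd G C"
    then obtain u v where "endpts G e = {u, v}" by (auto simp: bd_def)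
    then show "finite (endpts G e)" by simp
  qed
  then have "finite X0" by (rule rev_finite_subset) (auto simp: X0_def)
  then have X: "finite X" "X \<noteq> {}" "X \<subseteq> C" "X0 \<subseteq> X"
    using C(3) by (auto simp: X_def X0_def some_in_eq)
  define \<Omega>2 where "\<Omega>2 = {R \<in> \<Omega>. \<forall>P\<in>\<P>. \<not> ev R P}"
  have \<Omega>2: "\<Omega>2 \<subseteq> {R. is_ray G R}" using \<Omega> by (auto simp: \<Omega>2_def)
  let ?Y = "C - X" let ?B = "cut_ring G (C - X) \<P>"
  obtain \<E> where \<E>: "\<And>k. \<E> k \<subseteq> cut_ring G ?Y (\<P> \<union> (\<Union>j<k. \<E> j))" "\<And>k. disjoint (\<E> k)"
    "\<And>k D. D \<in> \<E> k \<Longrightarrow> bdc G D = k \<and> minimal_cut G ?B \<Omega>2 D"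
    "\<And>R A. R \<in> \<Omega>2 \<Longrightarrow> A \<in> ?B \<Longrightarrow> ev R A \<Longrightarrow> \<exists>j\<le>bdc G A. \<exists>D\<in>\<E> j. ev R D"
    by (rule disjoint_levels[OF C(1) Diff_subset \<Omega>2]) (rule that; assumption)
  \<comment> \<open>The ray is free, so each vertex of the finite \<open>X\<close> is avoided by a
    cut around it; the intersection avoids all of \<open>X\<close>. The finitely many members of
    \<open>\<P>\<close> that cross it are then deleted, which is harmless as the ray lives in none
    of them.\<close>
  have ex2: "\<exists>A\<in>?B. ev R A" if R: "R \<in> \<Omega>2" for R
  proof -
    have R': "is_ray G R" "free_ray G R" "ev R C" using R \<Omega> by (auto simp: \<Omega>2_def \<Omega>_def)
    have "\<forall>x\<in>X. \<exists>A. finite (bd G A) \<and> ev R A \<and> x \<notin> A"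
      using R'(2) X(3) C(2) unfolding free_ray_def by blast
    from bchoice[OF this] obtain f where f: "\<And>x. x \<in> X \<Longrightarrow> finite (bd G (f x)) \<and> ev R (f x) \<and> x \<notin> f x"
      by blast
    define A where "A = C \<inter> (\<Inter>x\<in>X. f x)"
    have A: "finite (bd G A)" "ev R A" "A \<subseteq> ?Y"
      unfolding A_def using f X R' C by (auto intro!: finite_bd_Int finite_bd_INT ev_Int ev_INT)
    have AA: "A \<in> ?A" using A A_iff by blast
    define \<W> where "\<W> = {D \<in> \<P>. D \<inter> A \<noteq> {} \<and> \<not> D \<subseteq> A}"
    have fin: "finite \<W>" unfolding \<W>_def
      by (rule finite_crossing[OF C(1) order_refl \<Omega> AA _ \<P>_disj]) (use \<P> in auto)
    have fW: "finite (bd G W)" if "W \<in> \<W>" for W using that cut_ring_finite[OF \<P>(1)[of W]] by (auto simp: \<W>_def)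
    have "\<not> ev R (\<Union>\<W>)" using ev_UN_imp[OF R'(1) fin _ fW] R by (auto simp: \<W>_def \<Omega>2_def)
    then have "ev R (A - \<Union>\<W>)" using A(2) R'(1) fin fW by (intro ev_Diff) (auto intro: finite_bd_Union)
    moreover have "P \<subseteq> A - \<Union>\<W> \<or> P \<inter> (A - \<Union>\<W>) = {}" if "P \<in> \<P>" for P
    proof (cases "P \<subseteq> A")
      case True
      then have "P \<inter> W = {}" if "W \<in> \<W>" for W
        using that \<P>_disj \<open>P \<in> \<P>\<close> unfolding \<W>_def disjoint_def by blast
      then show ?thesis using True by blast
    next
      case False
      then show ?thesis using \<open>P \<in> \<P>\<close> unfolding \<W>_def by blast
    qed
    moreover have "finite (bd G (A - \<Union>\<W>))" using A(1) fin fW by (intro finite_bd_Diff finite_bd_Union)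
    ultimately show ?thesis using A(3) by (intro bexI[of _ "A - \<Union>\<W>"]) (auto simp: cut_ring_def)
  qed
  \<comment> \<open>All levels are used here, without a bound on the size; hence
    \<open>laminar_pieces\<close> rather than maximal members.\<close>
  define M where "M = (\<Union>k. \<E> k)"
  have M: "M \<subseteq> ?B"
  proof
    fix D assume "D \<in> M"
    then obtain k where "D \<in> \<E> k" by (auto simp: M_def)
    then have "D \<in> cut_ring G ?Y (\<P> \<union> (\<Union>j<k. \<E> j))" using \<E>(1) by blast
    then show "D \<in> ?B" by (auto simp: cut_ring_def)
  qed
  have M_ne: "{} \<notin> M"
  proof
    assume "{} \<in> M"
    then obtain k where "{} \<in> \<E> k" by (auto simp: M_def)
    then obtain R where "R \<in> \<Omega>2" "ev R {}" using \<E>(3) unfolding minimal_cut_def by blast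
    then show False using ev_nonempty \<Omega>2 by blast
  qed
  have M_lam: "D = D' \<or> (bdc G D < bdc G D' \<and> D \<subseteq> D') \<or> (bdc G D' < bdc G D \<and> D' \<subseteq> D)"
    if DD: "D \<in> M" "D' \<in> M" "D \<inter> D' \<noteq> {}" for D D'
  proof -
    obtain i j where ij: "D \<in> \<E> i" "D' \<in> \<E> j" using DD(1,2) unfolding M_def by blast
    have "\<And>k D. D \<in> \<E> k \<Longrightarrow> bdc G D = k" using \<E>(3) by simp
    from levels_laminar[OF \<E>(1,2) this ij DD(3)] show ?thesis .
  qed
  obtain \<Q> where \<Q>: "\<Q> \<subseteq> ?B" "disjoint \<Q>"
    "\<And>R D. is_ray G R \<Longrightarrow> D \<in> M \<Longrightarrow> ev R D \<Longrightarrow> \<exists>Q\<in>\<Q>. ev R Q"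
    by (rule laminar_pieces[OF M_lam M_ne M]) (assumption | rule that)+
  \<comment> \<open>Pieces need not be connected, so their components are taken, but only those in
    which a ray of \<open>\<Omega>2\<close> lives. Members of \<open>\<P>\<close> are connected,
    hence are still not split.\<close>
  define \<K> where "\<K> = {K. \<exists>Q\<in>\<Q>. \<exists>u\<in>Q. K = cmp G Q u \<and> (\<exists>R\<in>\<Omega>2. ev R K)}"
  have \<K>: "K \<subseteq> C - X" "finite (bd G K)" "conn G K" "\<exists>R\<in>\<Omega>2. ev R K"
      "\<And>P. P \<in> \<P> \<Longrightarrow> P \<subseteq> K \<or> P \<inter> K = {}" if K: "K \<in> \<K>" for K
  proof -
    obtain Q u where Q: "Q \<in> \<Q>" "u \<in> Q" "K = cmp G Q u" and R: "\<exists>R\<in>\<Omega>2. ev R K"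
      using K by (auto simp: \<K>_def)
    have QB: "Q \<subseteq> ?Y" "finite (bd G Q)" "\<And>P. P \<in> \<P> \<Longrightarrow> P \<subseteq> Q \<or> P \<inter> Q = {}"
      using Q(1) \<Q>(1) unfolding cut_ring_def by blast+
    show "\<exists>R\<in>\<Omega>2. ev R K" by (rule R)
    show "K \<subseteq> C - X" using cmp_subset[OF Q(2)] Q QB by auto
    show "finite (bd G K)" unfolding Q(3) by (rule finite_subset[OF bd_cmp_sub[OF Q(2)] QB(2)])
    show "conn G K" unfolding Q(3) by (rule cmp_conn)
    show "P \<subseteq> K \<or> P \<inter> K = {}" if P: "P \<in> \<P>" for P
    proof (rule disjCI)
      assume "P \<inter> K \<noteq> {}"
      then obtain x where x: "x \<in> P" "x \<in> K" by blast
      then have "x \<in> Q" using cmp_subset[OF Q(2)] Q(3) by blast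
      then have "P \<subseteq> Q" using QB(3)[OF P] x by blast
      then have "P \<subseteq> cmp G Q x" using conn_sub_cmp \<P>(4)[OF P] x by metis
      then show "P \<subseteq> K" using cmp_eq[of x G Q u] x Q(3) by auto
    qed
  qed
  have \<K>_disj: "K \<inter> K' = {}" if K: "K \<in> \<K>" "K' \<in> \<K>" "K \<noteq> K'" for K K'
  proof -
    obtain Q u Q' u' where Q: "Q \<in> \<Q>" "u \<in> Q" "K = cmp G Q u" "Q' \<in> \<Q>" "u' \<in> Q'" "K' = cmp G Q' u'"
      using K by (auto simp: \<K>_def)
    have s: "K \<subseteq> Q" "K' \<subseteq> Q'"
      unfolding Q(3,6) by (rule cmp_subset[OF Q(2)], rule cmp_subset[OF Q(5)])
    show ?thesis
    proof (cases "Q = Q'")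
      case True then show ?thesis using cmp_disjoint Q K(3) by metis
    next
      case False
      then have "Q \<inter> Q' = {}" using \<Q>(2) Q unfolding disjoint_def by blast
      then show ?thesis using s by blast
    qed
  qed
  \<comment> \<open>Members of \<open>\<P>\<close> inside a set of \<open>\<K>\<close> are not
    children; their rays live in that larger set.\<close>
  define \<P>' where "\<P>' = {P \<in> \<P>. \<forall>K\<in>\<K>. \<not> P \<subseteq> K}"
  have \<K>\<P>': "K \<inter> P = {}" if "K \<in> \<K>" "P \<in> \<P>'" for K P
    using \<K>(5)[OF that(1), of P] that by (auto simp: \<P>'_def)
  \<comment> \<open>Rays outside all of \<open>\<P>\<close> have no cut inside \<open>C\<close>
    smaller than \<open>bd G C\<close>; this is the lower bound that the children in
    \<open>\<K>\<close> need.\<close>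
  have le_low: "bdc G C \<le> bdc G D" if "R \<in> \<Omega>2" "D \<subseteq> C" "finite (bd G D)" "ev R D" for R D
    using \<P>_cover[of R D] that unfolding \<Omega>2_def by (auto simp: not_less[symmetric])
  have child: "S \<subset> C \<and> S \<noteq> {} \<and> conn G S \<and> finite (bd G S)" if "S \<in> \<K> \<union> \<P>'" for S
  proof (cases "S \<in> \<K>")
    case True
    moreover have "S \<noteq> {}" using \<K>(4)[OF True] \<Omega>2 ev_nonempty by blast
    ultimately show ?thesis using \<K>(1-3)[OF True] X by blast
  next
    case False
    then have "S \<in> \<P>" using that by (auto simp: \<P>'_def)
    then show ?thesis using \<P>[of S] A_iff by auto
  qed
  have "good_children G C (\<K> \<union> \<P>')"
    unfolding good_children_def
  proof (intro conjI ballI allI impI)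
    show "S \<subseteq> C" "S \<noteq> C" "S \<noteq> {}" "conn G S" "finite (bd G S)" if "S \<in> \<K> \<union> \<P>'" for S
      using child[OF that] by auto
    show "disjoint (\<K> \<union> \<P>')"
      unfolding disjoint_def
    proof (intro ballI impI)
      fix a b assume ab: "a \<in> \<K> \<union> \<P>'" "b \<in> \<K> \<union> \<P>'" "a \<noteq> b"
      have "a \<inter> b = {}" if "a \<in> \<P>'" "b \<in> \<P>'"
        using that \<P>_disj ab(3) unfolding \<P>'_def disjoint_def by blast
      then show "a \<inter> b = {}" using ab \<K>\<P>' \<K>_disj by blast
    qed
    show "\<exists>S\<in>\<K> \<union> \<P>'. ev R S" if "free_ray G R" "ev R C" for R
    proof -
      have R: "R \<in> \<Omega>" using that by (simp add: \<Omega>_def)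
      show ?thesis
      proof (cases "R \<in> \<Omega>2")
        case True
        then obtain A where "A \<in> ?B" "ev R A" using ex2 by blast
        then obtain j D where "D \<in> \<E> j" "ev R D" using \<E>(4) True by blast
        then have "D \<in> M" "ev R D" by (auto simp: M_def)
        then obtain Q where Q: "Q \<in> \<Q>" "ev R Q" using \<Q>(3) True \<Omega>2 by blast
        then obtain u where "u \<in> Q" "ev R (cmp G Q u)" using ev_cmp[of G R Q] True \<Omega>2 by blast
        then have "cmp G Q u \<in> \<K>" using Q True unfolding \<K>_def by blast
        then show ?thesis using \<open>ev R (cmp G Q u)\<close> by blast
      next
        case False
        then obtain P where P: "P \<in> \<P>" "ev R P" using R by (auto simp: \<Omega>2_def)
        show ?thesis
        proof (cases "P \<in> \<P>'")
          case False
          then obtain K where "K \<in> \<K>" "P \<subseteq> K" using P by (auto simp: \<P>'_def)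
          then show ?thesis using P ev_mono by blast
        qed (use P in blast)
      qed
    qed
    show "\<exists>R. free_ray G R \<and> ev R S \<and>
       (\<forall>D\<subseteq>C. finite (bd G D) \<longrightarrow> ev R D \<longrightarrow> min (bdc G S) (bdc G C) \<le> bdc G D)"
      if S: "S \<in> \<K> \<union> \<P>'" for S
    proof (cases "S \<in> \<K>")
      case True
      then obtain R where "R \<in> \<Omega>2" "ev R S" using \<K>(4) by blast
      then show ?thesis using le_low by (intro exI[of _ R]) (auto simp: \<Omega>2_def \<Omega>_def min.coboundedI2)
    next
      case False
      then have "S \<in> \<P>" using S by (auto simp: \<P>'_def)
      then obtain R where "R \<in> \<Omega>" "ev R S" "\<forall>B\<in>?A. ev R B \<longrightarrow> bdc G S \<le> bdc G B"
        using \<P>(3) unfolding minimal_cut_def by blast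
      then show ?thesis using A_iff by (intro exI[of _ R]) (auto simp: \<Omega>_def min.coboundedI1)
    qed
    show "\<exists>D'\<subseteq>S. finite (bd G D') \<and> ev R D' \<and> bdc G D' \<le> bdc G D"
      if S: "S \<in> \<K> \<union> \<P>'" and free: "free_ray G R" "ev R S"
        and D: "D \<subseteq> C" "finite (bd G D)" "ev R D" "bdc G D < bdc G C" for S R D
    proof -
      have R: "R \<in> \<Omega>" "ev R S" using free ev_mono[OF D(3,1)] by (simp_all add: \<Omega>_def)
      obtain P where P: "P \<in> \<P>" "ev R P" using \<P>_cover[OF R(1) D] by blast
      have "P \<inter> S \<noteq> {}" using ev_disjoint[of G R] P R \<Omega> by blast
      then have PS: "P \<subseteq> S"
        using S P \<K>(5)[of S P] \<P>_disj unfolding \<P>'_def disjoint_def by blast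
      obtain T where T: "T \<in> \<Omega>" "ev T P" "\<forall>B\<in>?A. ev T B \<longrightarrow> bdc G P \<le> bdc G B"
        using \<P>(3)[OF P(1)] unfolding minimal_cut_def by blast
      have fP: "finite (bd G P)" "P \<subseteq> C" using \<P>(1)[OF P(1)] A_iff by auto
      \<comment> \<open>The ray that witnesses minimality of \<open>P\<close> also lives in
        \<open>D \<union> P\<close>, so the union has no fewer boundary edges than \<open>P\<close>,
        and submodularity leaves at most \<open>bdc G D\<close> for
        \<open>D \<inter> P\<close>.\<close>
      have "D \<union> P \<in> ?A" using D fP A_iff finite_bd_Un by blast
      moreover have "ev T (D \<union> P)" using T(2) by (rule ev_mono) auto
      ultimately have "bdc G P \<le> bdc G (D \<union> P)" using T(3) by blast
      then have "bdc G (D \<inter> P) \<le> bdc G D" using bdc_submodular[OF D(2) fP(1)] by linarith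
      then show ?thesis using PS D P fP by (intro exI[of _ "D \<inter> P"]) (auto intro: finite_bd_Int ev_Int)
    qed
    show "bdc G S < bdc G C \<or> (\<forall>u\<in>S. \<forall>e\<in>bd G C. u \<notin> endpts G e)" if S: "S \<in> \<K> \<union> \<P>'" for S
    proof (cases "S \<in> \<K>")
      case True
      then have "S \<subseteq> C" "S \<inter> X0 = {}" using \<K>(1)[OF True] X(4) by auto
      then show ?thesis unfolding X0_def by blast
    next
      case False
      then show ?thesis using S \<P>(2) by (auto simp: \<P>'_def)
    qed
  qed
  then show ?thesis by blast
qed

section \<open>Edge-disjoint paths between finite cuts\<close>

text \<open>An arc counts \<open>1\<close> if it leaves \<open>S\<close>, \<open>-1\<close> if it
  enters \<open>S\<close>, and \<open>0\<close> otherwise; summed over a flow this gives the amount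
  carried out of \<open>S\<close>, and for a single vertex the defect of conservation.\<close>

definition tip_diff :: "'v set \<Rightarrow> 'e \<times> 'v \<times> 'v \<Rightarrow> int" where
  "tip_diff S a = of_bool (fst (snd a) \<in> S) - of_bool (snd (snd a) \<in> S)"

definition net :: "'v set \<Rightarrow> ('e \<times> 'v \<times> 'v) set \<Rightarrow> int" where
  "net S F = (\<Sum>a\<in>F. tip_diff S a)"

text \<open>The source is \<open>- B\<close> and the sink is \<open>A\<close>. No arc enters the
  source or leaves the sink, so a path along these arcs from source to sink begins with an edge of
  \<open>bd G B\<close>, ends with one of \<open>bd G A\<close>, and has its inner vertices in
  \<open>B - A\<close>.\<close>

definition cut_arcs :: "('v, 'e) mgraph \<Rightarrow> 'v set \<Rightarrow> 'v set \<Rightarrow> ('e \<times> 'v \<times> 'v) set" where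
  "cut_arcs G A B = {(e, u, v) \<in> arcs G. u \<noteq> v \<and> u \<notin> A \<and> v \<in> B}"

definition preflow :: "('v, 'e) mgraph \<Rightarrow> 'v set \<Rightarrow> 'v set \<Rightarrow> ('e \<times> 'v \<times> 'v) set \<Rightarrow> bool" where
  "preflow G A B F \<longleftrightarrow> finite F \<and> F \<subseteq> cut_arcs G A B \<and> (\<forall>e u v. (e, u, v) \<in> F \<longrightarrow> (e, v, u) \<notin> F)"

definition flow :: "('v, 'e) mgraph \<Rightarrow> 'v set \<Rightarrow> 'v set \<Rightarrow> ('e \<times> 'v \<times> 'v) set \<Rightarrow> nat \<Rightarrow> bool" where
  "flow G A B F k \<longleftrightarrow> preflow G A B F \<and> (\<forall>x\<in>B - A. net {x} F = 0) \<and> net (- B) F = int k"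

lemma chain_mono: "chain F vs es \<Longrightarrow> F \<subseteq> F' \<Longrightarrow> chain F' vs es"
  by (auto simp: chain_def)

lemma chain_length: "chain F vs es \<Longrightarrow> length vs = Suc (length es)"
  by (simp add: chain_def)

lemma chain_hd: "chain F vs es \<Longrightarrow> hd vs = vs ! 0"
  by (metis chain_length hd_conv_nth list.size(3) nat.distinct(1))

lemma chain_last: "chain F vs es \<Longrightarrow> last vs = vs ! length es"
  by (metis chain_length diff_Suc_1 last_conv_nth length_0_conv nat.distinct(1))

lemma chain_distinct_edges:
  assumes "chain (arcs G) vs es" "distinct vs"
  shows "distinct es"
  unfolding distinct_conv_nth
proof (intro allI impI notI)
  fix i j assume ij: "i < length es" "j < length es" "i \<noteq> j" "es ! i = es ! j"
  have e: "endpts G (es ! a) = {vs ! a, vs ! Suc a}" if "a < length es" for a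
    using assms(1) that by (auto simp: chain_def arcs_def)
  have "{vs ! i, vs ! Suc i} = {vs ! j, vs ! Suc j}" using e[OF ij(1)] e[OF ij(2)] ij(4) by simp
  then have "(vs ! i = vs ! j \<and> vs ! Suc i = vs ! Suc j) \<or> (vs ! i = vs ! Suc j \<and> vs ! Suc i = vs ! j)"
    by (simp only: doubleton_eq_iff)
  moreover have "a = b" if "a < length vs" "b < length vs" "vs ! a = vs ! b" for a b
    using that assms(2) by (simp add: nth_eq_iff_index_eq)
  moreover have "i < length vs" "j < length vs" "Suc i < length vs" "Suc j < length vs"
    using ij chain_length[OF assms(1)] by auto
  ultimately have "i = j \<or> (i = Suc j \<and> Suc i = j)" by blast
  then show False using ij(3) by linarith
qed

text \<open>The value of a flow can be read off at any cut between source and sink. \<open>S\<close>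
  may exceed \<open>- B\<close> by infinitely many vertices, but only those on arcs of the finite
  \<open>F\<close> contribute, and conservation makes each contribution vanish.\<close>

lemma net_cut:
  assumes F: "flow G A B F k" and S: "- B \<subseteq> S" "S \<inter> A = {}"
  shows "net S F = int k"
proof -
  have fin: "finite F" using F by (simp add: flow_def preflow_def)
  define W where "W = S \<inter> B \<inter> (fst ` snd ` F \<union> snd ` snd ` F)"
  have W: "finite W" "W \<subseteq> B - A" using fin S by (auto simp: W_def)
  have pt: "(of_bool (u \<in> S) :: int) = of_bool (u \<in> - B) + (\<Sum>x\<in>W. of_bool (u = x))"
    if u: "u \<in> fst ` snd ` F \<union> snd ` snd ` F" for u
  proof -
    have "(\<Sum>x\<in>W. of_bool (u = x)) = (of_bool (u \<in> W) :: int)"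
      using W(1) by (simp add: of_bool_def)
    moreover have "u \<in> W \<longleftrightarrow> u \<in> S \<and> u \<in> B" using u by (auto simp: W_def)
    ultimately show ?thesis using S(1) by auto
  qed
  have "tip_diff S a = tip_diff (- B) a + (\<Sum>x\<in>W. tip_diff {x} a)" if "a \<in> F" for a
    using pt[of "fst (snd a)"] pt[of "snd (snd a)"] that by (simp add: tip_diff_def sum_subtractf)
  then have "net S F = (\<Sum>a\<in>F. tip_diff (- B) a + (\<Sum>x\<in>W. tip_diff {x} a))"
    unfolding net_def by (rule sum.cong[OF refl])
  also have "\<dots> = net (- B) F + (\<Sum>x\<in>W. net {x} F)"
    unfolding net_def sum.distrib sum.swap[of _ F W] ..
  also have "(\<Sum>x\<in>W. net {x} F) = 0"
    using F W by (intro sum.neutral) (auto simp: flow_def)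
  finally show ?thesis using F by (simp add: flow_def)
qed

text \<open>If the reverse arc carries flow, it is cancelled, otherwise the arc is added; both
  change \<open>net\<close> in the same way.\<close>

lemma augment_arc:
  assumes F: "preflow G A B F" and a: "(e, u, v) \<in> cut_arcs G A B" "(e, u, v) \<notin> F"
  obtains F' where "preflow G A B F'" "\<And>S. net S F' = net S F + of_bool (u \<in> S) - of_bool (v \<in> S)"
    "\<And>e' x y. e' \<noteq> e \<Longrightarrow> (e', x, y) \<in> F' \<longleftrightarrow> (e', x, y) \<in> F"
proof (cases "(e, v, u) \<in> F")
  case True
  have n1: "net S (F - {(e, v, u)}) = net S F + of_bool (u \<in> S) - of_bool (v \<in> S)" for S
    using F True by (simp add: net_def preflow_def sum_diff1 tip_diff_def)
  have n2: "preflow G A B (F - {(e, v, u)})" using F unfolding preflow_def by blast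
  have n3: "(e', x, y) \<in> F - {(e, v, u)} \<longleftrightarrow> (e', x, y) \<in> F" if "e' \<noteq> e" for e' x y
    using that by blast
  show ?thesis by (rule that[OF n2 n1 n3])
next
  case False
  have uv: "u \<noteq> v" using a by (auto simp: cut_arcs_def)
  have n1: "net S (insert (e, u, v) F) = net S F + of_bool (u \<in> S) - of_bool (v \<in> S)" for S
    using F a(2) by (simp add: net_def preflow_def tip_diff_def)
  have n2: "preflow G A B (insert (e, u, v) F)"
    unfolding preflow_def
  proof (intro conjI allI impI)
    show "finite (insert (e, u, v) F)" "insert (e, u, v) F \<subseteq> cut_arcs G A B"
      using F a by (auto simp: preflow_def)
    fix e' x y assume xy: "(e', x, y) \<in> insert (e, u, v) F"
    show "(e', y, x) \<notin> insert (e, u, v) F"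
    proof (cases "(e', x, y) = (e, u, v)")
      case True
      then show ?thesis using False uv by simp
    next
      case xyF: False
      then have "(e', x, y) \<in> F" using xy by blast
      then have "(e', y, x) \<notin> F" "(e', y, x) \<noteq> (e, u, v)"
        using F False unfolding preflow_def by blast+
      then show ?thesis by blast
    qed
  qed
  have n3: "(e', x, y) \<in> insert (e, u, v) F \<longleftrightarrow> (e', x, y) \<in> F" if "e' \<noteq> e" for e' x y
    using that by blast
  show ?thesis by (rule that[OF n2 n1 n3])
qed

lemma augment_chain:
  assumes F: "preflow G A B F" and c: "chain (cut_arcs G A B - F) vs es" "distinct es" and i: "i \<le> length es"
  shows "\<exists>F'. preflow G A B F' \<and> (\<forall>S. net S F' = net S F + of_bool (vs ! 0 \<in> S) - of_bool (vs ! i \<in> S))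
    \<and> (\<forall>e x y. e \<notin> set (take i es) \<longrightarrow> ((e, x, y) \<in> F' \<longleftrightarrow> (e, x, y) \<in> F))"
  using i
proof (induction i)
  case 0
  then show ?case using F by (intro exI[of _ F]) auto
next
  case (Suc i)
  then obtain F' where F': "preflow G A B F'"
    "\<And>S. net S F' = net S F + of_bool (vs ! 0 \<in> S) - of_bool (vs ! i \<in> S)"
    "\<And>e x y. e \<notin> set (take i es) \<Longrightarrow> ((e, x, y) \<in> F' \<longleftrightarrow> (e, x, y) \<in> F)" by auto
  have a: "(es ! i, vs ! i, vs ! Suc i) \<in> cut_arcs G A B - F"
    using c(1) Suc.prems by (simp add: chain_def)
  have t: "take (Suc i) es = take i es @ [es ! i]" using Suc.prems by (simp add: take_Suc_conv_app_nth)
  have "distinct (take (Suc i) es)" using c(2) by simp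
  then have ni: "es ! i \<notin> set (take i es)" unfolding t by simp
  then have "(es ! i, vs ! i, vs ! Suc i) \<notin> F'" using F'(3) a by blast
  then obtain F'' where F'': "preflow G A B F''"
    "\<And>S. net S F'' = net S F' + of_bool (vs ! i \<in> S) - of_bool (vs ! Suc i \<in> S)"
    "\<And>e' x y. e' \<noteq> es ! i \<Longrightarrow> (e', x, y) \<in> F'' \<longleftrightarrow> (e', x, y) \<in> F'"
    using augment_arc[OF F'(1), of "es ! i" "vs ! i" "vs ! Suc i"] a by blast
  show ?case
    using F'' F'(2,3) unfolding t by (intro exI[of _ F'']) auto
qed

lemma flow_augment:
  assumes F: "flow G A B F k" and AB: "A \<subseteq> B"
    and cut: "\<And>D. A \<subseteq> D \<Longrightarrow> D \<subseteq> B \<Longrightarrow> finite (bd G D) \<Longrightarrow> k < bdc G D"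
  shows "\<exists>F'. flow G A B F' (Suc k)"
proof -
  let ?A = "cut_arcs G A B"
  let ?r = "{(x, y). \<exists>e. (e, x, y) \<in> ?A - F}"
  have pF: "finite F" "F \<subseteq> ?A" "\<And>e u v. (e, u, v) \<in> F \<Longrightarrow> (e, v, u) \<notin> F"
    using F by (auto simp: flow_def preflow_def)
  define S where "S = {v. \<exists>u\<in>- B. (u, v) \<in> ?r\<^sup>*}"
  have BS: "- B \<subseteq> S" by (auto simp: S_def)
  have closed: "v \<in> S" if "u \<in> S" "(e, u, v) \<in> ?A - F" for e u v
    using that unfolding S_def by (blast intro: rtrancl_into_rtrancl)
  have "S \<inter> A \<noteq> {}"
  proof
    assume SA: "S \<inter> A = {}"
    define O' where "O' = {a \<in> F. fst (snd a) \<in> S \<and> snd (snd a) \<notin> S}"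
    have "tip_diff S a = of_bool (a \<in> O')" if "a \<in> F" for a
    proof -
      obtain e u v where a: "a = (e, u, v)" by (cases a) auto
      have "\<not> (v \<in> S \<and> u \<notin> S)"
      proof
        assume vu: "v \<in> S \<and> u \<notin> S"
        have "(e, u, v) \<in> ?A" using that a pF by blast
        then have "(e, v, u) \<in> ?A" using vu SA BS by (auto simp: cut_arcs_def arcs_def insert_commute)
        moreover have "(e, v, u) \<notin> F" using pF(3) that a by blast
        ultimately show False using closed[of v e u] vu by blast
      qed
      then show ?thesis using that by (auto simp: tip_diff_def O'_def a)
    qed
    then have "net S F = (\<Sum>a\<in>F. of_bool (a \<in> O'))" unfolding net_def by (rule sum.cong[OF refl])
    also have "\<dots> = int (card O')"
      using pF(1) by (simp add: O'_def of_bool_def sum.If_cases Int_def)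
    finally have cO: "card O' = k" using net_cut[OF F BS SA] by simp
    have "bd G S \<subseteq> fst ` O'"
    proof
      fix e assume "e \<in> bd G S"
      then obtain u v where e: "e \<in> edges G" "endpts G e = {u, v}" "u \<in> S" "v \<notin> S" by (rule bdE)
      have "(e, u, v) \<in> ?A" using e SA BS by (auto simp: cut_arcs_def arcs_def)
      then have "(e, u, v) \<in> F" using closed e by blast
      then show "e \<in> fst ` O'" using e by (force simp: O'_def)
    qed
    moreover have "finite O'" using pF(1) by (simp add: O'_def)
    ultimately have "finite (bd G S)" "bdc G S \<le> k"
      using cO by (auto intro: finite_subset surj_card_le)
    then show False using cut[of "- S"] SA BS by (auto simp: bd_Compl)
  qed
  then obtain u v where uv: "u \<notin> B" "v \<in> A" "(u, v) \<in> ?r\<^sup>*" unfolding S_def by blast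
  from rtrancl_imp_chain[OF uv(3)] obtain vs es where
    c: "chain (?A - F) vs es" "distinct vs" "hd vs = u" "last vs = v" by blast
  have "chain (arcs G) vs es" using c(1) by (rule chain_mono) (auto simp: cut_arcs_def)
  then have "distinct es" using c(2) by (rule chain_distinct_edges)
  then obtain F' where F': "preflow G A B F'"
    "\<And>S. net S F' = net S F + of_bool (u \<in> S) - of_bool (v \<in> S)"
    using augment_chain[OF _ c(1), of "length es"] F c chain_hd[OF c(1)] chain_last[OF c(1)]
    by (auto simp: flow_def)
  have "flow G A B F' (Suc k)"
    using F F' uv AB by (auto simp: flow_def)
  then show ?thesis by blast
qed

lemma flow_exists:
  assumes AB: "A \<subseteq> B" and cut: "\<And>D. A \<subseteq> D \<Longrightarrow> D \<subseteq> B \<Longrightarrow> finite (bd G D) \<Longrightarrow> k \<le> bdc G D"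
  shows "\<exists>F. flow G A B F k"
proof -
  have "j \<le> k \<Longrightarrow> \<exists>F. flow G A B F j" for j
  proof (induction j)
    case 0
    show ?case by (intro exI[of _ "{}"]) (auto simp: flow_def preflow_def net_def)
  next
    case (Suc j)
    then obtain F where "flow G A B F j" by auto
    then show ?case using flow_augment[OF _ AB] cut Suc.prems by (meson Suc_le_lessD less_le_trans)
  qed
  then show ?thesis by blast
qed

text \<open>One path is peeled off at a time. If the vertices reached from the source along
  \<open>F\<close> missed \<open>A\<close>, no flow would leave this set, against the positive
  value. Recording that the paths use only edges of the flow makes the path just removed
  edge-disjoint from all later ones.\<close>

lemma flow_paths:
  assumes mG: "multigraph G" and AB: "A \<subseteq> B"
  shows "flow G A B F k \<Longrightarrow> \<exists>P. finite P \<and> card P = k \<and>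
    (\<forall>p\<in>P. is_path_from_edge_to_edge G (bd G B) (bd G A) (fst p) (snd p) \<and> set (snd p) \<subseteq> fst ` F) \<and>
    (\<forall>p\<in>P. \<forall>q\<in>P. p \<noteq> q \<longrightarrow> set (snd p) \<inter> set (snd q) = {})"
proof (induction k arbitrary: F)
  case 0
  then show ?case by (intro exI[of _ "{}"]) auto
next
  case (Suc k)
  let ?A = "cut_arcs G A B"
  let ?r = "{(x, y). \<exists>e. (e, x, y) \<in> F}"
  have pF: "finite F" "F \<subseteq> ?A" "\<And>e u v. (e, u, v) \<in> F \<Longrightarrow> (e, v, u) \<notin> F"
    using Suc.prems by (auto simp: flow_def preflow_def)
  define S where "S = {v. \<exists>u\<in>- B. (u, v) \<in> ?r\<^sup>*}"
  have BS: "- B \<subseteq> S" by (auto simp: S_def)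
  have closed: "v \<in> S" if "u \<in> S" "(e, u, v) \<in> F" for e u v
    using that unfolding S_def by (blast intro: rtrancl_into_rtrancl)
  have "S \<inter> A \<noteq> {}"
  proof
    assume SA: "S \<inter> A = {}"
    have "net S F \<le> 0"
      unfolding net_def by (rule sum_nonpos) (auto simp: tip_diff_def dest: closed)
    then show False using net_cut[OF Suc.prems BS SA] by simp
  qed
  then obtain u v where uv: "u \<notin> B" "v \<in> A" "(u, v) \<in> ?r\<^sup>*" unfolding S_def by blast
  from rtrancl_imp_chain[OF uv(3)] obtain vs es where
    c: "chain F vs es" "distinct vs" "hd vs = u" "last vs = v" by blast
  have cA: "chain (arcs G) vs es" using c(1) by (rule chain_mono) (use pF in \<open>auto simp: cut_arcs_def\<close>)
  then have de: "distinct es" using c(2) by (rule chain_distinct_edges)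
  have len: "length vs = Suc (length es)" using chain_length[OF cA] .
  have v0: "vs ! 0 = u" and vn: "vs ! length es = v" using chain_hd[OF cA] chain_last[OF cA] c by auto
  have ne: "es \<noteq> []" using v0 vn uv AB by (metis list.size(3) subsetD)
  have arc: "(es ! i, vs ! i, vs ! Suc i) \<in> F" if "i < length es" for i
    using c(1) that by (simp add: chain_def)
  have arcA: "(es ! i, vs ! i, vs ! Suc i) \<in> ?A" if "i < length es" for i
    using arc[OF that] pF by blast
  have a0: "es ! 0 \<in> edges G" "endpts G (es ! 0) = {u, vs ! Suc 0}" "vs ! Suc 0 \<in> B"
    using arcA[of 0] ne v0 by (auto simp: cut_arcs_def arcs_def)
  define n where "n = length es - 1"
  have n: "n < length es" "Suc n = length es" using ne by (auto simp: n_def)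
  have an: "es ! n \<in> edges G" "endpts G (es ! n) = {vs ! n, v}" "vs ! n \<notin> A"
    using arcA[of n] n vn by (auto simp: cut_arcs_def arcs_def)
  have "u \<in> verts G" using a0 mG by (auto simp: multigraph_def)
  then have "is_path G vs es" using is_path_iff[OF mG] cA c by auto
  moreover have "hd es \<in> bd G B" using a0 uv ne by (auto simp: hd_conv_nth bd_endpts)
  moreover have "last es \<in> bd G A" using an uv ne by (auto simp: last_conv_nth bd_endpts n_def)
  ultimately have path: "is_path_from_edge_to_edge G (bd G B) (bd G A) vs es"
    using ne by (simp add: is_path_from_edge_to_edge_def)
  define f where "f i = (es ! i, vs ! i, vs ! Suc i)" for i
  define Q where "Q = f ` {..<length es}"
  have QF: "Q \<subseteq> F" using arc by (auto simp: Q_def f_def)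
  have inj: "inj_on f {..<length es}"
    using de by (auto simp: inj_on_def f_def nth_eq_iff_index_eq)
  have netQ: "net S (F - Q) = net S F - (of_bool (u \<in> S) - of_bool (v \<in> S))" for S
  proof -
    have "net S Q = (\<Sum>i<length es. of_bool (vs ! i \<in> S) - of_bool (vs ! Suc i \<in> S))"
      unfolding net_def Q_def sum.reindex[OF inj] by (simp add: tip_diff_def f_def)
    also have "\<dots> = of_bool (vs ! 0 \<in> S) - of_bool (vs ! length es \<in> S)"
      by (rule sum_lessThan_telescope')
    finally show ?thesis using sum_diff[OF pF(1) QF, of "tip_diff S"] v0 vn by (simp add: net_def)
  qed
  have "flow G A B (F - Q) k"
  proof -
    have "preflow G A B (F - Q)" using Suc.prems unfolding flow_def preflow_def by blast
    moreover have "net {x} (F - Q) = 0" if "x \<in> B - A" for x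
      using netQ[of "{x}"] Suc.prems uv that by (auto simp: flow_def)
    moreover have "net (- B) (F - Q) = int k"
      using netQ[of "- B"] Suc.prems uv AB by (auto simp: flow_def)
    ultimately show ?thesis by (simp add: flow_def)
  qed
  from Suc.IH[OF this] obtain P where P0: "finite P \<and> card P = k \<and>
    (\<forall>p\<in>P. is_path_from_edge_to_edge G (bd G B) (bd G A) (fst p) (snd p) \<and> set (snd p) \<subseteq> fst ` (F - Q)) \<and>
    (\<forall>p\<in>P. \<forall>q\<in>P. p \<noteq> q \<longrightarrow> set (snd p) \<inter> set (snd q) = {})" by (rule exE)
  then have P: "finite P" "card P = k"
    "\<And>p. p \<in> P \<Longrightarrow> is_path_from_edge_to_edge G (bd G B) (bd G A) (fst p) (snd p) \<and> set (snd p) \<subseteq> fst ` (F - Q)"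
    "\<And>p q. p \<in> P \<Longrightarrow> q \<in> P \<Longrightarrow> p \<noteq> q \<Longrightarrow> set (snd p) \<inter> set (snd q) = {}"
    by simp_all
  \<comment> \<open>A remaining arc on an edge of the path would run in the same direction, hence
    belong to \<open>Q\<close>, or in the opposite one, which a preflow excludes.\<close>
  have dj: "fst ` (F - Q) \<inter> set es = {}"
  proof (rule ccontr)
    assume "\<not> ?thesis"
    then obtain a where a: "a \<in> F - Q" "fst a \<in> set es" by blast
    then obtain e x y where e: "(e, x, y) \<in> F - Q" "e \<in> set es" by (cases a) auto
    then obtain i where i: "i < length es" "e = es ! i" by (auto simp: in_set_conv_nth)
    have "endpts G e = {x, y}" using e pF by (auto simp: cut_arcs_def arcs_def)
    moreover have "endpts G e = {vs ! i, vs ! Suc i}" using arcA[OF i(1)] i by (auto simp: cut_arcs_def arcs_def)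
    ultimately have "(x = vs ! i \<and> y = vs ! Suc i) \<or> (x = vs ! Suc i \<and> y = vs ! i)"
      by (auto simp: doubleton_eq_iff)
    then show False
    proof
      assume "x = vs ! i \<and> y = vs ! Suc i"
      then have "(e, x, y) \<in> Q" using i by (auto simp: Q_def f_def)
      then show False using e by blast
    next
      assume "x = vs ! Suc i \<and> y = vs ! i"
      then show False using pF(3)[OF arc[OF i(1)]] e i by simp
    qed
  qed
  have esF: "set es \<subseteq> fst ` F"
  proof
    fix e assume "e \<in> set es"
    then obtain i where "i < length es" "e = es ! i" by (auto simp: in_set_conv_nth)
    then show "e \<in> fst ` F" using arc[of i] image_eqI[of e fst "(es ! i, vs ! i, vs ! Suc i)" F] by simp
  qed
  have "(vs, es) \<notin> P"
  proof
    assume "(vs, es) \<in> P"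
    from conjunct2[OF P(3)[OF this]] have "set es \<subseteq> fst ` (F - Q)" unfolding snd_conv .
    then have "set es = fst ` (F - Q) \<inter> set es" by (rule inf.absorb2[symmetric])
    then have "set es = {}" unfolding dj .
    then show False using ne by simp
  qed
  then have "card (insert (vs, es) P) = Suc k" using P(1,2) by simp
  moreover have new: "set (snd p) \<inter> set es = {}" if "p \<in> P" for p using P(3)[OF that] dj by blast
  moreover have "is_path_from_edge_to_edge G (bd G B) (bd G A) (fst p) (snd p) \<and> set (snd p) \<subseteq> fst ` F"
    if p: "p \<in> insert (vs, es) P" for p
  proof (cases "p \<in> P")
    case True
    then show ?thesis using P(3)[OF True] by blast
  next
    case False
    then show ?thesis using p path esF by simp
  qed
  moreover have "set (snd p) \<inter> set (snd q) = {}"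
    if pq: "p \<in> insert (vs, es) P" "q \<in> insert (vs, es) P" "p \<noteq> q" for p q
  proof -
    consider "p \<in> P" "q \<in> P" | "p = (vs, es)" "q \<in> P" | "p \<in> P" "q = (vs, es)" using pq by blast
    then show ?thesis
    proof cases
      case 1
      then show ?thesis by (rule P(4)[OF _ _ pq(3)])
    next
      case 2
      then show ?thesis using new[of q] by (simp add: Int_commute)
    next
      case 3
      then show ?thesis using new[of p] by simp
    qed
  qed
  moreover have "finite (insert (vs, es) P)" using P(1) by simp
  ultimately show ?case by (intro exI[of _ "insert (vs, es) P"] conjI ballI impI) blast+
qed

text \<open>Menger's theorem for edge cuts in a possibly infinite graph: only sets \<open>D\<close>
  of finite boundary can be small cuts, and the flow that supplies the \<open>k\<close> paths is a
  finite set of arcs.\<close>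

lemma menger_cut:
  assumes "multigraph G" "A \<subseteq> B"
    and "\<And>D. A \<subseteq> D \<Longrightarrow> D \<subseteq> B \<Longrightarrow> finite (bd G D) \<Longrightarrow> k \<le> bdc G D"
  shows "\<exists>P. card P = k \<and>
    (\<forall>(vs, fs)\<in>P. is_path_from_edge_to_edge G (bd G B) (bd G A) vs fs) \<and>
    (\<forall>p\<in>P. \<forall>q\<in>P. p \<noteq> q \<longrightarrow> set (snd p) \<inter> set (snd q) = {})"
proof -
  obtain F where "flow G A B F k" using flow_exists[OF assms(2,3)] by blast
  from flow_paths[OF assms(1,2) this] obtain P where "card P = k"
    "\<forall>p\<in>P. is_path_from_edge_to_edge G (bd G B) (bd G A) (fst p) (snd p)"
    "\<forall>p\<in>P. \<forall>q\<in>P. p \<noteq> q \<longrightarrow> set (snd p) \<inter> set (snd q) = {}" by blast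
  then show ?thesis by (intro exI[of _ P]) auto
qed

section \<open>Trees given by parent functions\<close>

text \<open>The height \<open>h\<close> drops by one at each parent and is positive off the root, so
  iterated parents reach \<open>r\<close>. The value \<open>par r\<close> is left open; the edges
  and the child relation never use it.\<close>

locale ptree =
  fixes N :: "'n set" and r :: 'n and par :: "'n \<Rightarrow> 'n" and h :: "'n \<Rightarrow> nat"
  assumes root: "r \<in> N" "h r = 0"
    and par: "\<And>x. x \<in> N \<Longrightarrow> x \<noteq> r \<Longrightarrow> par x \<in> N \<and> h x = Suc (h (par x))"
begin

definition T :: "('n, 'n set) mgraph" where
  "T = \<lparr>verts = N, edges = (\<lambda>x. {x, par x}) ` (N - {r}), endpts = (\<lambda>e. e)\<rparr>"

definition cr :: "('n \<times> 'n) set" where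
  "cr = (\<lambda>x. (par x, x)) ` (N - {r})"

text \<open>The nodes above \<open>s\<close> in the tree order (\<open>tree_le_iff\<close>); for
  \<open>s\<close> other than the root, also the component of \<open>s\<close> after the edge
  \<open>{s, par s}\<close> is deleted (\<open>components_T\<close>).\<close>

definition up :: "'n \<Rightarrow> 'n set" where
  "up s = {t. (s, t) \<in> cr\<^sup>*}"

lemma T_simps [simp]: "verts T = N" "endpts T = (\<lambda>e. e)" "edges T = (\<lambda>x. {x, par x}) ` (N - {r})"
  by (simp_all add: T_def)

lemma crD: "(s, t) \<in> cr \<Longrightarrow> s \<in> N \<and> t \<in> N \<and> t \<noteq> r \<and> s = par t \<and> h t = Suc (h s)"
  using par by (auto simp: cr_def)

lemma cr_par: "x \<in> N \<Longrightarrow> x \<noteq> r \<Longrightarrow> (par x, x) \<in> cr"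
  by (auto simp: cr_def)

lemma up_self: "s \<in> up s" by (simp add: up_def)

lemma up_sub: "s \<in> N \<Longrightarrow> up s \<subseteq> N"
proof
  fix t assume "s \<in> N" "t \<in> up s"
  then have "(s, t) \<in> cr\<^sup>*" by (simp add: up_def)
  then show "t \<in> N" using \<open>s \<in> N\<close> by (induction rule: rtrancl_induct) (simp_all add: crD)
qed

lemma up_h: "t \<in> up s \<Longrightarrow> h s \<le> h t \<and> (h s = h t \<longrightarrow> s = t)"
proof -
  assume "t \<in> up s"
  then have "(s, t) \<in> cr\<^sup>*" by (simp add: up_def)
  then show ?thesis
  proof (induction rule: rtrancl_induct)
    case (step y z)
    then show ?case using crD[OF step(2)] by simp
  qed simp
qed

lemma up_trans: "t \<in> up s \<Longrightarrow> u \<in> up t \<Longrightarrow> u \<in> up s"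
  by (auto simp: up_def)

lemma up_child: "x \<in> N \<Longrightarrow> x \<noteq> r \<Longrightarrow> x \<in> up (par x)"
  using cr_par by (auto simp: up_def)

lemma up_par: "x \<in> up s \<Longrightarrow> x \<noteq> s \<Longrightarrow> x \<in> N \<and> x \<noteq> r \<and> par x \<in> up s"
  unfolding up_def mem_Collect_eq by (erule rtranclE) (use crD in blast)+

lemma up_root: "x \<in> N \<Longrightarrow> x \<in> up r"
proof (induction "h x" arbitrary: x)
  case 0
  have "x = r"
    proof (rule ccontr)
      assume "x \<noteq> r"
      then show False using par[OF 0(2)] 0(1) by simp
    qed
    then show ?case using up_self by simp
next
  case (Suc n)
  then have "x \<noteq> r" using root by auto
  then have "par x \<in> N" "h x = Suc (h (par x))" using par Suc.prems by auto
  then have "par x \<in> up r" using Suc by auto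
  then show ?case using up_child[OF Suc.prems \<open>x \<noteq> r\<close>] up_trans by blast
qed

lemma up_root_eq: "up r = N"
  using up_root up_sub[OF root(1)] by auto

lemma par_notin_up: "s \<in> N \<Longrightarrow> s \<noteq> r \<Longrightarrow> par s \<notin> up s"
  using up_h[of "par s" s] par[of s] by auto

lemma up_comparable: "t \<in> up s \<Longrightarrow> t \<in> up s' \<Longrightarrow> s' \<in> up s \<or> s \<in> up s'"
proof -
  assume "t \<in> up s" "t \<in> up s'"
  then have "(s, t) \<in> cr\<^sup>*" "t \<in> up s'" by (auto simp: up_def)
  then show ?thesis
  proof (induction rule: rtrancl_induct)
    case base
    then show ?case by simp
  next
    case (step y z)
    show ?case
    proof (cases "z = s'")
      case True
      have "(s, z) \<in> cr\<^sup>*" using step(1,2) by simp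
      then show ?thesis using True by (simp add: up_def)
    next
      case False
      then have "par z \<in> up s'" using up_par step by blast
      then show ?thesis using step crD by auto
    qed
  qed
qed

lemma edge_inj: "z \<in> N - {r} \<Longrightarrow> s \<in> N - {r} \<Longrightarrow> {z, par z} = {s, par s} \<Longrightarrow> z = s"
  using par[of z] par[of s] by (auto simp: doubleton_eq_iff)

lemma multigraph_T: "multigraph T"
  using par by (fastforce simp: multigraph_def card_insert_if)

lemma adj_T: "(x, y) \<in> adj T \<longleftrightarrow> (x, y) \<in> cr \<or> (y, x) \<in> cr"
  by (auto simp: adj_def cr_def doubleton_eq_iff)

text \<open>At most one edge leaves \<open>up s\<close>, namely \<open>{s, par s}\<close>.
  Acyclicity, the tree order, the components after deleting an edge and the description of the ends
  are all drawn from this.\<close>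

lemma adj_crossing:
  assumes "(x, y) \<in> adj T" "x \<in> up s" "y \<notin> up s"
  shows "x = s \<and> y = par s \<and> s \<in> N - {r}"
  using assms(1) unfolding adj_T
proof
  assume "(x, y) \<in> cr"
  then have "y \<in> up s" using assms(2) by (auto simp: up_def)
  then show ?thesis using assms by simp
next
  assume "(y, x) \<in> cr"
  then have x: "x \<in> N" "x \<noteq> r" "y = par x" using crD by auto
  then show ?thesis using up_par[OF assms(2)] assms(3) by auto
qed

lemma cr_adj: "(x, y) \<in> cr\<^sup>* \<Longrightarrow> (x, y) \<in> (adj T)\<^sup>*"
  by (rule subsetD[OF rtrancl_mono]) (auto simp: adj_T)

lemma connected_T: "connected_graph T"
  unfolding connected_graph_def linked_by_path_iff[OF multigraph_T]
proof (intro ballI conjI)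
  fix u v assume "u \<in> verts T" "v \<in> verts T"
  then have "(r, u) \<in> (adj T)\<^sup>*" "(r, v) \<in> (adj T)\<^sup>*" using up_root cr_adj by (auto simp: up_def)
  then show "(u, v) \<in> (adj T)\<^sup>*" using sym_rtrancl_adj[of T] by (meson rtrancl_trans symD)
qed

lemma path_crossing:
  assumes "is_path T vs es" "i \<le> j" "j \<le> length es" "vs ! i \<in> up s \<longleftrightarrow> vs ! j \<notin> up s"
  shows "\<exists>k. i \<le> k \<and> k < j \<and> s \<in> N - {r} \<and> es ! k = {s, par s} \<and>
    (if vs ! i \<in> up s then vs ! k = s \<and> vs ! Suc k = par s else vs ! k = par s \<and> vs ! Suc k = s)"
proof -
  have c: "chain (arcs T) vs es" using assms(1) is_path_iff[OF multigraph_T] by blast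
  have a: "(vs ! k, vs ! Suc k) \<in> adj T" "es ! k = {vs ! k, vs ! Suc k}" if "k < length es" for k
  proof -
    have "(es ! k, vs ! k, vs ! Suc k) \<in> arcs T" using c that unfolding chain_def by blast
    then show "(vs ! k, vs ! Suc k) \<in> adj T" "es ! k = {vs ! k, vs ! Suc k}"
      unfolding adj_arcs by (blast, simp add: arcs_def)
  qed
  show ?thesis
  proof (cases "vs ! i \<in> up s")
    case True
    then obtain k where k: "i \<le> k" "k < j" "vs ! k \<in> up s" "vs ! Suc k \<notin> up s"
      using chain_crossing[OF c assms(2,3), of "up s"] assms(4) by blast
    then show ?thesis
      using adj_crossing[OF a(1) k(3,4)] a(2)[of k] assms(3) True by (intro exI[of _ k]) auto
  next
    case False
    then obtain k where k: "i \<le> k" "k < j" "vs ! k \<notin> up s" "vs ! Suc k \<in> up s"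
      using chain_crossing[OF c assms(2,3), of "- up s"] assms(4) by auto
    then have "(vs ! Suc k, vs ! k) \<in> adj T" using a(1)[of k] assms(3) adj_sym by fastforce
    from adj_crossing[OF this k(4,3)] show ?thesis
      using a(2)[of k] assms(3) k False by (intro exI[of _ k]) auto
  qed
qed

lemma path_ends:
  assumes "is_path G vs es"
  shows "length vs = Suc (length es)" "vs ! 0 = hd vs" "vs ! length es = last vs"
proof -
  show l: "length vs = Suc (length es)" using assms by (simp add: is_path_def)
  then have "vs \<noteq> []" by auto
  then show "vs ! 0 = hd vs" "vs ! length es = last vs"
    using l by (simp_all add: hd_conv_nth last_conv_nth)
qed

text \<open>The closing edge of a cycle is some \<open>{x, par x}\<close>, and its ends lie on
  different sides of \<open>up x\<close>; the path of the cycle would have to use that same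
  edge.\<close>

lemma acyclic_T: "acyclic_graph T"
  unfolding acyclic_graph_def
proof clarify
  fix vs es e assume p: "is_path T vs es" and e: "e \<in> edges T" "e \<notin> set es" "endpts T e = {hd vs, last vs}"
  obtain x where x: "x \<in> N - {r}" "e = {x, par x}" using e by auto
  have "x \<in> up x" "par x \<notin> up x" using x up_self par_notin_up by auto
  moreover have "{x, par x} = {vs ! 0, vs ! length es}" using e(3) x path_ends[OF p] by simp
  ultimately have "vs ! 0 \<in> up x \<longleftrightarrow> vs ! length es \<notin> up x" by (auto simp: doubleton_eq_iff)
  then obtain k where "k < length es" "es ! k = {x, par x}"
    using path_crossing[OF p, of 0 "length es" x] by auto
  then show False using e x by (metis nth_mem)
qed

lemma rooted_tree_T: "rooted_tree T r"
  using multigraph_T connected_T acyclic_T root by (simp add: rooted_tree_def)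

lemma path_from_root:
  assumes "is_path T vs es" "hd vs = r" "last vs \<in> up s" "s \<in> N"
  shows "s \<in> set vs"
proof (cases "s = r")
  case True
  have "vs \<noteq> []" using path_ends(1)[OF assms(1)] by auto
  then show ?thesis using True assms(2) by force
next
  case False
  have "r \<notin> up s" using up_h[of r s] root False by auto
  then obtain k where "k < length es" "vs ! Suc k = s"
    using path_crossing[OF assms(1), of 0 "length es" s] path_ends[OF assms(1)] assms by auto
  then show ?thesis using path_ends(1)[OF assms(1)] by (metis Suc_less_eq nth_mem)
qed

text \<open>A path from the root enters \<open>up s\<close> from \<open>par s\<close>. If it ended
  outside, it would leave again to \<open>par s\<close> and repeat that node.\<close>

lemma tree_le_iff: "tree_le T r s t \<longleftrightarrow> s \<in> N \<and> t \<in> up s"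
proof
  assume "tree_le T r s t"
  then obtain vs es where p: "is_path T vs es" "hd vs = r" "last vs = t" "s \<in> set vs"
    by (auto simp: tree_le_def)
  have sN: "s \<in> N" using p by (auto simp: is_path_def)
  note pe = path_ends[OF p(1)]
  obtain i where i: "i < length vs" "vs ! i = s" using p(4) by (auto simp: in_set_conv_nth)
  have "t \<in> up s"
  proof (rule ccontr)
    assume t: "t \<notin> up s"
    have "s \<noteq> r"
    proof
      assume "s = r"
      moreover have "t \<in> N"
      proof -
        have "vs \<noteq> []" using pe(1) by auto
        then show ?thesis using p(1,3) last_in_set by (force simp: is_path_def)
      qed
      ultimately show False using t up_root by simp
    qed
    then have "r \<notin> up s" using up_h[of r s] root by auto
    then obtain k where k: "k < i" "vs ! k = par s"
      using path_crossing[OF p(1), of 0 i s] i pe p up_self[of s] by auto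
    obtain k' where k': "i \<le> k'" "k' < length es" "vs ! Suc k' = par s"
      using path_crossing[OF p(1), of i "length es" s] i pe p t up_self[of s] by auto
    have "distinct vs" using p by (simp add: is_path_def)
    moreover have "k < length vs" "Suc k' < length vs" "vs ! k = vs ! Suc k'" "k \<noteq> Suc k'"
      using k k' pe(1) i by auto
    ultimately show False by (simp add: nth_eq_iff_index_eq)
  qed
  then show "s \<in> N \<and> t \<in> up s" using sN by simp
next
  assume a: "s \<in> N \<and> t \<in> up s"
  then have "t \<in> N" using up_sub by blast
  then have "linked_by_path T r t" using connected_T root by (simp add: connected_graph_def)
  then obtain vs es where "is_path T vs es" "hd vs = r" "last vs = t" by (auto simp: linked_by_path_def)
  then show "tree_le T r s t" using path_from_root a unfolding tree_le_def by blast
qed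

lemma components_T:
  assumes s: "s \<in> N - {r}"
  shows "components (del_edges T {{s, par s}}) = {up s, N - up s}"
proof -
  let ?H = "del_edges T {{s, par s}}"
  have mH: "multigraph ?H" using multigraph_T by (rule multigraph_del_edges)
  have vH: "verts ?H = N" by (simp add: del_edges_def)
  have adjH: "(x, y) \<in> adj ?H \<longleftrightarrow> (x, y) \<in> adj T \<and> {x, y} \<noteq> {s, par s}" for x y
    by (auto simp: adj_def del_edges_def)
  have inv: "y \<in> up s \<longleftrightarrow> x \<in> up s" if "(x, y) \<in> (adj ?H)\<^sup>*" for x y
    using that
  proof (induction rule: rtrancl_induct)
    case (step y z)
    have "(y, z) \<in> adj T" "{y, z} \<noteq> {s, par s}" using step(2) adjH by blast+
    moreover have "(z, y) \<in> adj T" using adj_sym[OF \<open>(y, z) \<in> adj T\<close>] .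
    ultimately have "(y, z) \<in> adj T" "(z, y) \<in> adj T" "{y, z} \<noteq> {s, par s}" by blast+
    then have "y \<in> up s \<longleftrightarrow> z \<in> up s"
      using adj_crossing[of y z s] adj_crossing[of z y s] by auto
    then show ?case using step by simp
  qed simp
  have cr1: "(y, z) \<in> adj ?H" if "(y, z) \<in> cr" "z \<noteq> s" for y z
  proof -
    have "z \<in> N - {r}" "y = par z" using crD[OF that(1)] by auto
    then have "{z, y} \<noteq> {s, par s}" using edge_inj[OF _ s] that(2) by blast
    then show ?thesis using that by (auto simp: adjH adj_T insert_commute)
  qed
  have A: "(s, t) \<in> (adj ?H)\<^sup>*" if "t \<in> up s" for t
  proof -
    have "(s, t) \<in> cr\<^sup>*" using that by (simp add: up_def)
    then show ?thesis
    proof (induction rule: rtrancl_induct)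
      case (step y z)
      have "y \<in> up s" using step by (simp add: up_def)
      then have "h s \<le> h y" using up_h by blast
      moreover have "h z = Suc (h y)" using crD[OF step(2)] by blast
      ultimately have "z \<noteq> s" by auto
      then show ?case using cr1[OF step(2)] step by (auto intro: rtrancl_into_rtrancl)
    qed simp
  qed
  have B: "(r, t) \<in> (adj ?H)\<^sup>*" if "t \<in> N" "t \<notin> up s" for t
  proof -
    have "(r, t) \<in> cr\<^sup>*" using up_root[OF that(1)] by (simp add: up_def)
    then show ?thesis using that(2)
    proof (induction rule: rtrancl_induct)
      case (step y z)
      have "z \<noteq> s" using step(4) up_self by blast
      moreover have "y \<notin> up s"
        using step(2,4) unfolding up_def mem_Collect_eq by (meson rtrancl_into_rtrancl)
      ultimately show ?case using cr1[OF step(2)] step by (auto intro: rtrancl_into_rtrancl)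
    qed simp
  qed
  have sy: "(a, b) \<in> (adj ?H)\<^sup>* \<Longrightarrow> (b, a) \<in> (adj ?H)\<^sup>*" for a b
    using sym_rtrancl_adj[of ?H] by (meson symD)
  have comp: "{v. linked_by_path ?H u v} = (if u \<in> up s then up s else N - up s)" if u: "u \<in> N" for u
  proof -
    have "v \<in> N" if "(u, v) \<in> (adj ?H)\<^sup>*" for v
      using rtrancl_adj_verts[OF mH that] u vH by simp
    moreover have "(u, v) \<in> (adj ?H)\<^sup>*" if v: "v \<in> N" "u \<in> up s \<longleftrightarrow> v \<in> up s" for v
    proof (cases "u \<in> up s")
      case True
      then have "(u, s) \<in> (adj ?H)\<^sup>*" "(s, v) \<in> (adj ?H)\<^sup>*" using A[of u] A[of v] sy v by simp_all
      then show ?thesis by (rule rtrancl_trans)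
    next
      case False
      then have "(u, r) \<in> (adj ?H)\<^sup>*" "(r, v) \<in> (adj ?H)\<^sup>*" using B[of u] B[of v] sy u v by simp_all
      then show ?thesis by (rule rtrancl_trans)
    qed
    moreover have "v \<in> up s \<longleftrightarrow> u \<in> up s" if "(u, v) \<in> (adj ?H)\<^sup>*" for v using inv[OF that] .
    moreover have "up s \<subseteq> N" using up_sub s by blast
    ultimately have "linked_by_path ?H u v \<longleftrightarrow> v \<in> N \<and> (v \<in> up s \<longleftrightarrow> u \<in> up s)" for v
      using u unfolding linked_by_path_iff[OF mH] vH by blast
    then show ?thesis using \<open>up s \<subseteq> N\<close> by auto
  qed
  have rs: "r \<notin> up s" using up_h[of r s] root s by auto
  show ?thesis
  proof
    show "components ?H \<subseteq> {up s, N - up s}"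
      unfolding components_def vH using comp by auto
    have "up s = {v. linked_by_path ?H s v}" "N - up s = {v. linked_by_path ?H r v}"
      using comp[of s] comp[of r] s rs root up_self[of s] by auto
    then show "{up s, N - up s} \<subseteq> components ?H"
      unfolding components_def vH using s root by blast
  qed
qed

subsection \<open>Ends of the tree\<close>

text \<open>Heights cannot fall forever, so some step goes up; after an upward step a downward one
  would return to the unique parent and repeat a node.\<close>

lemma ray_ascends:
  assumes "is_ray T R"
  obtains p m where "inj p" "verts R = range p" "\<And>i::nat. i \<ge> m \<Longrightarrow> (p i, p (Suc i)) \<in> cr"
proof -
  obtain p q where p: "inj p" "verts R = range p" "\<And>i::nat. endpts T (q i) = {p i, p (Suc i)}"
    "range q \<subseteq> edges T"
    using ray_seq[OF assms] by metis
  have a: "(p i, p (Suc i)) \<in> cr \<or> (p (Suc i), p i) \<in> cr" for i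
    using p(3)[of i] p(4) unfolding adj_T[symmetric] adj_def by blast
  have s: "(p (Suc i), p (Suc (Suc i))) \<in> cr" if "(p i, p (Suc i)) \<in> cr" for i
  proof (rule ccontr)
    assume "\<not> ?thesis"
    then have "(p (Suc (Suc i)), p (Suc i)) \<in> cr" using a[of "Suc i"] by auto
    then have "p (Suc (Suc i)) = par (p (Suc i))" using crD by blast
    moreover have "p i = par (p (Suc i))" using crD[OF that] by blast
    ultimately have "p (Suc (Suc i)) = p i" by simp
    then show False using p(1) by (auto simp: inj_eq)
  qed
  have "\<exists>m. (p m, p (Suc m)) \<in> cr"
  proof (rule ccontr)
    assume no: "\<nexists>m. (p m, p (Suc m)) \<in> cr"
    have "h (p i) + i = h (p 0)" for i
    proof (induction i)
      case (Suc i)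
      have "(p (Suc i), p i) \<in> cr" using no a[of i] by blast
      then have "h (p i) = Suc (h (p (Suc i)))" using crD by blast
      then show ?case using Suc by simp
    qed simp
    from this[of "Suc (h (p 0))"] show False by simp
  qed
  then obtain m where m: "(p m, p (Suc m)) \<in> cr" by blast
  have "(p i, p (Suc i)) \<in> cr" if "i \<ge> m" for i
    using that by (induction i rule: dec_induct) (use m s in auto)
  then show ?thesis using that p by blast
qed

lemma ascending_up:
  assumes "\<And>i::nat. i \<ge> m \<Longrightarrow> (p i, p (Suc i)) \<in> cr" "m \<le> i" "i \<le> j"
  shows "p j \<in> up (p i) \<and> h (p j) = h (p i) + (j - i)"
  using assms(3)
proof (induction j rule: dec_induct)
  case base
  then show ?case using up_self by simp
next
  case (step j)
  then have "(p j, p (Suc j)) \<in> cr" using assms by auto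
  then have "h (p (Suc j)) = Suc (h (p j))" "p (Suc j) \<in> up (p j)"
    using crD by (blast, auto simp: up_def)
  then show ?case using step up_trans by auto
qed

lemma bd_up: "s \<in> N \<Longrightarrow> bd T (up s) \<subseteq> {{s, par s}}"
proof
  fix e assume "s \<in> N" "e \<in> bd T (up s)"
  then obtain x y where e: "e \<in> edges T" "endpts T e = {x, y}" "x \<in> up s" "y \<notin> up s" by (auto simp: bd_def)
  then have "(x, y) \<in> adj T" by (auto simp: adj_def)
  from adj_crossing[OF this e(3,4)] show "e \<in> {{s, par s}}" using e by auto
qed

lemma finite_bd_up: "s \<in> N \<Longrightarrow> finite (bd T (up s))"
  using bd_up finite_subset by blast

text \<open>A node far out on \<open>R\<close> and the node of \<open>S\<close> at the same height
  both lie below a later node of \<open>S\<close>. They are therefore comparable, and having equal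
  height they coincide.\<close>

lemma ray_sub_ray:
  assumes R: "is_ray T R" and S: "is_ray T S" and up: "\<And>s. s \<in> N \<Longrightarrow> ev R (up s) \<Longrightarrow> ev S (up s)"
  shows "ev R (verts S)"
proof -
  obtain p m where p: "inj p" "verts R = range p" "\<And>i::nat. i \<ge> m \<Longrightarrow> (p i, p (Suc i)) \<in> cr"
    using ray_ascends[OF R] by metis
  obtain q n where q: "inj q" "verts S = range q" "\<And>i::nat. i \<ge> n \<Longrightarrow> (q i, q (Suc i)) \<in> cr"
    using ray_ascends[OF S] by metis
  have "p i \<in> verts S" if i: "i \<ge> m + h (q n)" for i
  proof -
    have "h (p i) = h (p m) + (i - m)" using ascending_up[where p = p and m = m and i = m and j = i, OF p(3)] i by simp
    then have hi: "h (q n) \<le> h (p i)" using i by simp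
    have "(p i, p (Suc i)) \<in> cr" using p(3)[of i] i by simp
    then have "p i \<in> N" using crD by blast
    moreover have "ev R (up (p i))"
      unfolding ev_seq[OF p(1,2)] using ascending_up[where p = p and m = m and i = i, OF p(3)] i by (intro exI[of _ i]) auto
    ultimately have "ev S (up (p i))" using up by blast
    then obtain k where k: "\<forall>j\<ge>k. q j \<in> up (p i)" using ev_seq[OF q(1,2)] by blast
    define j where "j = max k (n + h (p i))"
    have j: "q j \<in> up (p i)" "j \<ge> n" "j \<ge> n + h (p i)" using k by (auto simp: j_def)
    \<comment> \<open>The index at which \<open>q\<close> has the height of \<open>p i\<close>:
      beyond \<open>n\<close> the height rises by one at each step.\<close>
    define l where "l = n + (h (p i) - h (q n))"
    have l: "n \<le> l" "l \<le> j" using j by (auto simp: l_def)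
    have hl: "h (q l) = h (p i)" using ascending_up[where p = q and m = n and i = n and j = l, OF q(3)] l hi by (simp add: l_def)
    have "q j \<in> up (q l)" using ascending_up[where p = q and m = n and i = l and j = j, OF q(3)] l by simp
    then have "p i \<in> up (q l) \<or> q l \<in> up (p i)" using up_comparable j(1) by blast
    then have "p i = q l" using up_h[of "p i" "q l"] up_h[of "q l" "p i"] hl by auto
    then show ?thesis using q(2) by auto
  qed
  then show ?thesis unfolding ev_seq[OF p(1,2)] by blast
qed

definition end_rel :: "(('n, 'n set) mgraph \<times> ('n, 'n set) mgraph) set" where
  "end_rel = {(R, S). is_ray T R \<and> is_ray T S \<and>
        (\<forall>X. finite X \<and> X \<subseteq> verts T \<longrightarrow>
           (\<exists>C \<in> components (del_verts T X). \<exists>R' S'.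
              is_tail R' R \<and> is_tail S' S \<and> verts R' \<subseteq> C \<and> verts S' \<subseteq> C))}"

lemma graph_ends_alt: "graph_ends T = {R. is_ray T R} // end_rel"
  unfolding graph_ends_def end_rel_def ..

lemma end_rel_alt:
  "(R, S) \<in> end_rel \<longleftrightarrow> is_ray T R \<and> is_ray T S \<and>
    (\<forall>X. finite X \<and> X \<subseteq> N \<longrightarrow> (\<exists>C \<in> components (del_verts T X). ev R C \<and> ev S C))"
proof -
  have "(\<exists>R' S'. is_tail R' R \<and> is_tail S' S \<and> verts R' \<subseteq> C \<and> verts S' \<subseteq> C) \<longleftrightarrow> ev R C \<and> ev S C"
    if "is_ray T R" "is_ray T S" for C
    unfolding tail_in_iff[OF that(1), symmetric] tail_in_iff[OF that(2), symmetric] by blast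
  then show ?thesis unfolding end_rel_def T_simps mem_Collect_eq prod.case by (metis (lifting))
qed

lemma del_verts_T:
  "multigraph (del_verts T X)" "verts (del_verts T X) = N - X"
  "adj (del_verts T X) = adj T \<inter> (N - X) \<times> (N - X)"
  using multigraph_induced[OF multigraph_T] by (auto simp: del_verts_def adj_induced, auto simp: induced_def)

text \<open>Deleting the single node \<open>s\<close> is enough: a component of the rest that meets
  \<open>up s\<close> lies inside it.\<close>

lemma end_rel_up:
  assumes "(R, S) \<in> end_rel" "s \<in> N" "ev R (up s)"
  shows "ev S (up s)"
proof -
  let ?H = "del_verts T {s}"
  have rs: "is_ray T R" "is_ray T S" using assms by (auto simp: end_rel_def)
  obtain C where C: "C \<in> components ?H" "ev R C" "ev S C"
    using assms by (force simp: end_rel_alt)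
  obtain u where u: "u \<in> N - {s}" "C = {v. linked_by_path ?H u v}"
    using C(1) unfolding components_def del_verts_T by blast
  have C_iff: "v \<in> C \<longleftrightarrow> (u, v) \<in> (adj ?H)\<^sup>*" for v
    using u unfolding linked_by_path_iff[OF del_verts_T(1)] del_verts_T(2) by simp
  have inv: "x \<in> up s \<longleftrightarrow> u \<in> up s" if "(u, x) \<in> (adj ?H)\<^sup>*" for x
    using that
  proof (induction rule: rtrancl_induct)
    case (step y z)
    have "(y, z) \<in> adj T" "(z, y) \<in> adj T" "y \<noteq> s" "z \<noteq> s"
      using step(2) del_verts_T(3) adj_sym by auto
    then have "y \<in> up s \<longleftrightarrow> z \<in> up s" using adj_crossing by blast
    then show ?case using step by simp
  qed simp
  have "C \<inter> up s \<noteq> {}" using ev_disjoint[OF rs(1) C(2) assms(3)] .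
  then have "u \<in> up s" using inv C_iff by blast
  then have "C \<subseteq> up s" using inv C_iff by blast
  then show ?thesis using C(3) ev_mono by blast
qed

text \<open>Ends of the tree are identified by the sets \<open>up s\<close> in which they live.
  Conversely, an ascending ray eventually avoids a finite \<open>X\<close>, its remaining tail lies
  in one component, and by \<open>ray_sub_ray\<close> almost all of the other ray lies on
  it.\<close>

lemma end_rel_iff:
  "(R, S) \<in> end_rel \<longleftrightarrow> is_ray T R \<and> is_ray T S \<and> (\<forall>s\<in>N. ev R (up s) \<longleftrightarrow> ev S (up s))"
proof
  assume a: "(R, S) \<in> end_rel"
  then have "(S, R) \<in> end_rel" unfolding end_rel_alt by blast
  then show "is_ray T R \<and> is_ray T S \<and> (\<forall>s\<in>N. ev R (up s) \<longleftrightarrow> ev S (up s))"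
    using a end_rel_up by (auto simp: end_rel_def)
next
  assume a: "is_ray T R \<and> is_ray T S \<and> (\<forall>s\<in>N. ev R (up s) \<longleftrightarrow> ev S (up s))"
  obtain p m where p: "inj p" "verts R = range p" "\<And>i::nat. i \<ge> m \<Longrightarrow> (p i, p (Suc i)) \<in> cr"
    using ray_ascends a by metis
  have SR: "ev S (verts R)" using ray_sub_ray[of S R] a by blast
  have "\<exists>C \<in> components (del_verts T X). ev R C \<and> ev S C" if X: "finite X" "X \<subseteq> N" for X
  proof -
    let ?H = "del_verts T X"
    have "ev R (- X)" unfolding ev_def using X(1) by (simp add: Diff_Compl)
    then obtain k where k: "\<forall>i\<ge>k. p i \<notin> X" using ev_seq[OF p(1,2)] by auto
    define n where "n = max m k"
    have pn: "p i \<in> N - X" "(p i, p (Suc i)) \<in> cr" if "i \<ge> n" for i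
    proof -
      have "m \<le> i" "k \<le> i" using that by (auto simp: n_def)
      then show "(p i, p (Suc i)) \<in> cr" using p(3) by blast
      then show "p i \<in> N - X" using crD k \<open>k \<le> i\<close> by blast
    qed
    define C where "C = {v. linked_by_path ?H (p n) v}"
    have C: "C \<in> components ?H" unfolding components_def C_def del_verts_T using pn[of n] by blast
    have "(p n, p i) \<in> (adj ?H)\<^sup>*" if "i \<ge> n" for i
      using that
    proof (induction i rule: dec_induct)
      case (step i)
      have "(p i, p (Suc i)) \<in> adj ?H"
        using pn[of i] pn[of "Suc i"] step by (auto simp: del_verts_T adj_T)
      then show ?case using step by (auto intro: rtrancl_into_rtrancl)
    qed simp
    then have inC: "p i \<in> C" if "i \<ge> n" for i
      using that pn[of n] unfolding C_def linked_by_path_iff[OF del_verts_T(1)] del_verts_T(2) by simp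
    then have "ev R C" unfolding ev_seq[OF p(1,2)] by blast
    moreover have "verts S - C \<subseteq> (verts S - verts R) \<union> p ` {..<n}"
      using inC p(2) by (auto simp: not_less[symmetric])
    then have "ev S C" using SR unfolding ev_def by (meson finite_UnI finite_imageI finite_lessThan finite_subset)
    ultimately show ?thesis using C by blast
  qed
  then show "(R, S) \<in> end_rel" using a unfolding end_rel_alt by blast
qed

lemma equiv_end_rel: "equiv {R. is_ray T R} end_rel"
  by (rule equivI) (auto simp: refl_on_def sym_def trans_def end_rel_iff)

lemma graph_endE:
  assumes "\<epsilon> \<in> graph_ends T"
  obtains R where "is_ray T R" "R \<in> \<epsilon>" "\<epsilon> = end_rel `` {R}"
  using assms unfolding graph_ends_alt
  by (metis (no_types, lifting) equiv_class_self equiv_end_rel mem_Collect_eq quotientE)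

lemma lives_in_up:
  assumes "\<epsilon> = end_rel `` {R}" "is_ray T R" "s \<in> N"
  shows "lives_in \<epsilon> (up s) \<longleftrightarrow> ev R (up s)" "lives_in \<epsilon> (N - up s) \<longleftrightarrow> \<not> ev R (up s)"
proof -
  have S: "is_ray T S \<and> (ev S (up s) \<longleftrightarrow> ev R (up s))" if "S \<in> \<epsilon>" for S
    using that assms by (auto simp: end_rel_iff)
  have R: "R \<in> \<epsilon>" using assms by (simp add: end_rel_iff)
  have c: "ev S (N - up s) \<longleftrightarrow> \<not> ev S (up s)" if "is_ray T S" for S
  proof -
    have "verts S - (N - up s) = verts S - (- up s)" using ray_verts[OF that] by auto
    then have "ev S (N - up s) \<longleftrightarrow> ev S (- up s)" by (simp add: ev_def)
    also have "\<dots> \<longleftrightarrow> \<not> ev S (up s)"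
      using ev_dichotomy[OF that finite_bd_up[OF assms(3)]] ev_disjoint[OF that, of "up s" "- up s"] by auto
    finally show ?thesis .
  qed
  show "lives_in \<epsilon> (up s) \<longleftrightarrow> ev R (up s)"
    unfolding lives_in_def using S R tail_in_iff by metis
  show "lives_in \<epsilon> (N - up s) \<longleftrightarrow> \<not> ev R (up s)"
    unfolding lives_in_def using S R tail_in_iff c by metis
qed

end

section \<open>Rays through decreasing sequences of connected sets\<close>

text \<open>A vertex of level \<open>n\<close> lies in \<open>D n\<close> but not in \<open>D (Suc n)\<close>. Always stepping closer to the next
  set inside the current one never decreases the level, and within a level it decreases the distance;
  hence no vertex is repeated.\<close>

lemma ray_through:
  assumes mG: "multigraph G" and dec: "\<And>n. D (Suc n) \<subseteq> D n" and con: "\<And>n. conn G (D n)"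
    and ne: "\<And>n. D n \<noteq> {}" and int: "(\<Inter>n. D n) = {}" and sub: "D 0 \<subseteq> verts G"
  shows "\<exists>R. is_ray G R \<and> (\<forall>n. ev R (D n))"
proof -
  have mono: "D n \<subseteq> D m" if "m \<le> n" for m n
    using that by (induction n rule: dec_induct) (use dec in auto)
  define lv where "lv u = (LEAST k. u \<notin> D (Suc k))" for u
  have exk: "\<exists>k. u \<notin> D (Suc k)" for u
    using int mono[of n "Suc n" for n] by (metis INT_I UNIV_I dec empty_iff subsetD)
  have lv_not: "u \<notin> D (Suc (lv u))" for u unfolding lv_def by (rule LeastI_ex[OF exk])
  have lv_in: "u \<in> D (lv u)" if "u \<in> D 0" for u
  proof (cases "lv u")
    case (Suc k)
    then show ?thesis using not_less_Least[of k "\<lambda>k. u \<notin> D (Suc k)"] unfolding lv_def by force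
  qed (use that in simp)
  have lv_ge: "n \<le> lv u" if "u \<in> D n" for u n
  proof (rule ccontr)
    assume "\<not> n \<le> lv u"
    then have "D n \<subseteq> D (Suc (lv u))" by (intro mono) simp
    then show False using that lv_not by blast
  qed
  define rl where "rl n = adj G \<inter> D n \<times> D n" for n
  define reach where "reach n u k \<longleftrightarrow> (\<exists>v\<in>D (Suc n). (u, v) \<in> rl n ^^ k)" for n u k
  define ds where "ds n u = (LEAST k. reach n u k)" for n u
  have ex_reach: "\<exists>k. reach n u k" if "u \<in> D n" for n u
  proof -
    obtain v where v: "v \<in> D (Suc n)" using ne by blast
    then have "(u, v) \<in> (rl n)\<^sup>*" using con[of n] that dec unfolding conn_def rl_def by blast
    then show ?thesis using v unfolding reach_def by (auto simp: rtrancl_power)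
  qed
  have step: "\<exists>w. (u, w) \<in> adj G \<and> w \<in> D (lv u) \<and> ds (lv u) w < ds (lv u) u" if u: "u \<in> D 0" for u
  proof -
    let ?n = "lv u"
    have "reach ?n u (ds ?n u)" unfolding ds_def by (rule LeastI_ex[OF ex_reach[OF lv_in[OF u]]])
    then obtain v where v: "v \<in> D (Suc ?n)" "(u, v) \<in> rl ?n ^^ ds ?n u" unfolding reach_def by blast
    have "ds ?n u \<noteq> 0"
    proof
      assume "ds ?n u = 0"
      then show False using v lv_not by auto
    qed
    then obtain k where k: "ds ?n u = Suc k" by (cases "ds ?n u") auto
    then obtain w where w: "(u, w) \<in> rl ?n" "(w, v) \<in> rl ?n ^^ k" using v(2) by (metis relpow_Suc_D2)
    then have "reach ?n w k" using v(1) unfolding reach_def by blast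
    then have "ds ?n w \<le> k" unfolding ds_def by (rule Least_le)
    then show ?thesis using w(1) k unfolding rl_def by auto
  qed
  define nx where "nx u = (SOME w. (u, w) \<in> adj G \<and> w \<in> D (lv u) \<and> ds (lv u) w < ds (lv u) u)" for u
  have nx: "(u, nx u) \<in> adj G" "nx u \<in> D (lv u)" "ds (lv u) (nx u) < ds (lv u) u" if "u \<in> D 0" for u
    using someI_ex[OF step[OF that]] unfolding nx_def by auto
  obtain w0 where w0: "w0 \<in> D 0" using ne by blast
  define w where "w i = (nx ^^ i) w0" for i
  have wS: "w (Suc i) = nx (w i)" for i by (simp add: w_def)
  have wD: "w i \<in> D 0" for i
  proof (induction i)
    case (Suc i)
    then show ?case using nx(2)[OF Suc] mono[of 0 "lv (w i)"] wS by auto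
  qed (simp add: w_def w0)
  have lv_mono1: "lv (w i) \<le> lv (w (Suc i))" for i
    using lv_ge[OF nx(2)[OF wD[of i]]] wS by simp
  have lv_mono: "lv (w i) \<le> lv (w j)" if "i \<le> j" for i j
    using that by (induction j rule: dec_induct) (use lv_mono1 order_trans in blast)+
  have prog: "lv (w i) < lv (w j) \<or> (lv (w i) = lv (w j) \<and> ds (lv (w i)) (w j) < ds (lv (w i)) (w i))"
    if "i < j" for i j
    using that
  proof (induction j)
    case (Suc j)
    have s: "ds (lv (w j)) (w (Suc j)) < ds (lv (w j)) (w j)" using nx(3)[OF wD[of j]] wS by simp
    show ?case
    proof (cases "i = j")
      case True
      then show ?thesis using s lv_mono1[of j] by auto
    next
      case False
      then show ?thesis using Suc s lv_mono1[of j] by (auto simp: le_less)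
    qed
  qed simp
  have inj: "inj w"
  proof (rule injI)
    fix i j assume "w i = w j"
    then show "i = j" using prog[of i j] prog[of j i] by (cases i j rule: linorder_cases) auto
  qed
  \<comment> \<open>The sequence cannot stay on one level, as the distance to the next set drops at
    each step there; hence it finally enters every \<open>D n\<close>.\<close>
  have lv_unb: "\<exists>i. n \<le> lv (w i)" for n
  proof (induction n)
    case (Suc n)
    then obtain i where i: "n \<le> lv (w i)" by blast
    show ?case
    proof (rule ccontr)
      assume no: "\<nexists>i. Suc n \<le> lv (w i)"
      have eq: "lv (w j) = n" if "i \<le> j" for j
        using i lv_mono[OF that] no by (meson le_antisym not_less_eq_eq order_trans)
      have "ds n (w (i + k)) + k \<le> ds n (w i)" for k
      proof (induction k)
        case (Suc k)
        have "ds n (w (Suc (i + k))) < ds n (w (i + k))"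
          using nx(3)[OF wD[of "i + k"]] eq[of "i + k"] wS by simp
        then show ?case using Suc by simp
      qed simp
      from this[of "Suc (ds n (w i))"] show False by simp
    qed
  qed simp
  have "\<forall>i. \<exists>e. e \<in> edges G \<and> endpts G e = {w i, w (Suc i)}"
    using nx(1)[OF wD] wS unfolding adj_def by fastforce
  then obtain q where q: "\<And>i. q i \<in> edges G \<and> endpts G (q i) = {w i, w (Suc i)}" by metis
  define R where "R = G\<lparr>verts := range w, edges := range q\<rparr>"
  have R: "verts R = range w" "edges R = range q" "endpts R = endpts G" by (simp_all add: R_def)
  have "multigraph R" using mG q by (fastforce simp: multigraph_def R)
  then have "is_ray G R" unfolding is_ray_def subgraph_def R
    using q inj wD sub by blast
  moreover have "ev R (D n)" for n
  proof -
    obtain i where i: "n \<le> lv (w i)" using lv_unb by blast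
    have "w j \<in> D n" if "i \<le> j" for j
      using lv_in[OF wD] mono[of n "lv (w j)"] lv_mono[OF that] i by (meson order_trans subsetD)
    then show ?thesis unfolding ev_seq[OF inj R(1)] by blast
  qed
  ultimately show ?thesis by blast
qed

section \<open>Decompositions from trees of connected sets\<close>

text \<open>The conditions of \<open>good_children\<close>, spread over a tree whose node
  \<open>x\<close> carries the set \<open>C x\<close>. Connectedness is asked only away from the
  root, and properness only of nodes whose parent is not the root, since \<open>G\<close> may be
  disconnected.\<close>

locale cut_tree = ptree N r par h for N :: "'n set" and r par h +
  fixes G :: "('v, 'e) mgraph" and C :: "'n \<Rightarrow> 'v set"
  assumes mG: "multigraph G" and C_root: "C r = verts G"
    and C_sub: "\<And>x. x \<in> N - {r} \<Longrightarrow> C x \<subseteq> C (par x)"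
    and C_strict: "\<And>x. x \<in> N - {r} \<Longrightarrow> par x \<noteq> r \<Longrightarrow> C x \<noteq> C (par x)"
    and C_props: "\<And>x. x \<in> N - {r} \<Longrightarrow> C x \<noteq> {} \<and> conn G (C x) \<and> finite (bd G (C x))"
    and C_disj: "\<And>x y. x \<in> N - {r} \<Longrightarrow> y \<in> N - {r} \<Longrightarrow> par x = par y \<Longrightarrow> x \<noteq> y \<Longrightarrow> C x \<inter> C y = {}"
    and C_cover: "\<And>x R. x \<in> N \<Longrightarrow> free_ray G R \<Longrightarrow> ev R (C x) \<Longrightarrow> \<exists>y\<in>N - {r}. par y = x \<and> ev R (C y)"
    and C_min: "\<And>x. x \<in> N - {r} \<Longrightarrow> \<exists>R. free_ray G R \<and> ev R (C x) \<and> (\<forall>D\<subseteq>C (par x).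
        finite (bd G D) \<longrightarrow> ev R D \<longrightarrow> min (bdc G (C x)) (bdc G (C (par x))) \<le> bdc G D)"
    and C_shrink: "\<And>x R D. x \<in> N - {r} \<Longrightarrow> free_ray G R \<Longrightarrow> ev R (C x) \<Longrightarrow> D \<subseteq> C (par x) \<Longrightarrow>
        finite (bd G D) \<Longrightarrow> ev R D \<Longrightarrow> bdc G D < bdc G (C (par x)) \<Longrightarrow>
        \<exists>D'\<subseteq>C x. finite (bd G D') \<and> ev R D' \<and> bdc G D' \<le> bdc G D"
    and C_progress: "\<And>x. x \<in> N - {r} \<Longrightarrow> bdc G (C x) < bdc G (C (par x)) \<or>
        (\<forall>u\<in>C x. \<forall>e\<in>bd G (C (par x)). u \<notin> endpts G e)"
begin

definition bag :: "'n \<Rightarrow> 'v set" where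
  "bag t = C t - \<Union>(C ` {s \<in> N - {r}. par s = t})"

section \<open>Bags, their unions, adhesion sets and linkedness\<close>

lemma C_mono: "t \<in> up s \<Longrightarrow> C t \<subseteq> C s"
proof -
  assume "t \<in> up s"
  then have "(s, t) \<in> cr\<^sup>*" by (simp add: up_def)
  then show ?thesis
  proof (induction rule: rtrancl_induct)
    case (step y z)
    have "z \<in> N - {r}" "y = par z" using crD[OF step(2)] by blast+
    then show ?case using C_sub[of z] step(3) by blast
  qed simp
qed

lemma C_verts: "s \<in> N \<Longrightarrow> C s \<subseteq> verts G"
  using C_mono[OF up_root] C_root by simp

lemma bd_verts: "bd G (verts G) = {}"
  using mG by (auto simp: bd_def multigraph_def)

text \<open>By induction on heights, each node is comparable with the parent of the other. If this
  does not settle the matter, the two parents coincide, and then \<open>C_disj\<close> makes the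
  nodes equal.\<close>

lemma C_comparable:
  assumes "s \<in> N" "t \<in> N" "C s \<inter> C t \<noteq> {}"
  shows "s \<in> up t \<or> t \<in> up s"
  using assms
proof (induction "h s + h t" arbitrary: s t rule: less_induct)
  case less
  show ?case
  proof (cases "s = r \<or> t = r")
    case True
    then show ?thesis using up_root less.prems by blast
  next
    case False
    then have st: "s \<in> N - {r}" "t \<in> N - {r}" using less.prems by auto
    have p: "par s \<in> N" "h s = Suc (h (par s))" "par t \<in> N" "h t = Suc (h (par t))"
      using par[of s] par[of t] st by auto
    have "C (par s) \<inter> C t \<noteq> {}" "C s \<inter> C (par t) \<noteq> {}"
      using C_sub[OF st(1)] C_sub[OF st(2)] less.prems(3) by blast+
    then have 1: "par s \<in> up t \<or> t \<in> up (par s)" and 2: "s \<in> up (par t) \<or> par t \<in> up s"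
      using less.hyps[of "par s" t] less.hyps[of s "par t"] p less.prems by auto
    have su: "s \<in> up (par s)" "t \<in> up (par t)" using up_child st by auto
    show ?thesis
    proof (cases "par s \<in> up t \<or> par t \<in> up s")
      case True
      then show ?thesis using su up_trans by blast
    next
      case False
      then have a: "t \<in> up (par s)" "s \<in> up (par t)" using 1 2 by auto
      then have "t \<noteq> par s" "s \<noteq> par t" using False up_self by auto
      then have "par t \<in> up (par s)" "par s \<in> up (par t)" using a up_par by blast+
      then have "par s = par t" using up_h[of "par t" "par s"] up_h[of "par s" "par t"] by auto
      then have "s = t" using C_disj[OF st] less.prems(3) by blast
      then show ?thesis using up_self by simp
    qed
  qed
qed

lemma child_below:
  assumes "t \<in> up s" "t \<noteq> s"
  shows "\<exists>c\<in>N - {r}. par c = s \<and> t \<in> up c"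
proof -
  have "(s, t) \<in> cr\<^sup>*" using assms(1) by (simp add: up_def)
  then show ?thesis
  proof (cases rule: converse_rtranclE)
    case base
    then show ?thesis using assms(2) by simp
  next
    case (step y)
    then have "y \<in> N - {r}" "par y = s" using crD[OF step(1)] by auto
    then show ?thesis using step(2) by (auto simp: up_def)
  qed
qed

lemma bag_disjoint: "disjoint_family_on bag N"
  unfolding disjoint_family_on_def
proof (intro ballI impI)
  fix s t assume st: "s \<in> N" "t \<in> N" "s \<noteq> t"
  have *: "bag s \<inter> bag t = {}" if up: "t \<in> up s" "s \<noteq> t" for s t
  proof -
    obtain c where c: "c \<in> N - {r}" "par c = s" "t \<in> up c" using child_below[OF up(1)] up(2) by blast
    have "bag t \<subseteq> C c" using C_mono[OF c(3)] by (auto simp: bag_def)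
    then show ?thesis using c by (auto simp: bag_def)
  qed
  show "bag s \<inter> bag t = {}"
  proof (cases "C s \<inter> C t = {}")
    case True
    then show ?thesis by (auto simp: bag_def)
  next
    case False
    then show ?thesis using C_comparable[OF st(1,2)] *[of t s] *[of s t] st(3) by blast
  qed
qed

lemma asc_par: "(x, y) \<in> cr \<Longrightarrow> y \<in> N - {r} \<and> par y = x"
  using crD by auto

text \<open>A walk from a common vertex \<open>v\<close> to a vertex \<open>y\<close> outside the
  sets is fixed, and \<open>f i\<close> is the first index on it outside the \<open>i\<close>-th
  set. The pair of \<open>f i\<close> and the boundary size decreases lexicographically at every
  step, which cannot go on forever.\<close>

lemma C_Inter_empty:
  assumes p: "\<And>i::nat. (p i, p (Suc i)) \<in> cr"
  shows "(\<Inter>i. C (p i)) = {}"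
proof (rule ccontr)
  assume "(\<Inter>i. C (p i)) \<noteq> {}"
  then obtain v where v: "\<And>i. v \<in> C (p i)" by blast
  have pN: "p (Suc i) \<in> N - {r}" "par (p (Suc i)) = p i" for i using asc_par[OF p] by auto
  have sub: "C (p (Suc i)) \<subseteq> C (p i)" for i using C_sub[OF pN(1)] pN(2) by metis
  \<comment> \<open>The argument starts at \<open>p 1\<close> because \<open>p 0\<close> may be the
    root, whose set need not be connected.\<close>
  have "C (p 2) \<subset> C (p 1)"
    using sub[of 1] C_strict[OF pN(1)[of 1]] pN[of 1] pN(1)[of 0] by (auto simp: numeral_2_eq_2)
  then obtain y where y: "y \<in> C (p 1)" "y \<notin> C (p 2)" by blast
  have "conn G (C (p 1))" using C_props[OF pN(1)[of 0]] by simp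
  then have "(v, y) \<in> (adj G \<inter> C (p 1) \<times> C (p 1))\<^sup>*" using v y(1) unfolding conn_def by blast
  then have "(v, y) \<in> (adj G)\<^sup>*" by (rule subsetD[OF rtrancl_mono, rotated]) auto
  then obtain vs es where c: "chain (arcs G) vs es" "hd vs = v" "last vs = y"
    using rtrancl_imp_chain[of v y "arcs G"] by (auto simp: adj_arcs)
  have v0: "vs ! 0 = v" "vs ! length es = y" using chain_hd[OF c(1)] chain_last[OF c(1)] c by auto
  define D where "D i = C (p (i + 2))" for i
  have Ddec: "D (Suc i) \<subseteq> D i" for i using sub[of "i + 2"] by (simp add: D_def)
  have y': "y \<notin> D i" for i
  proof (induction i)
    case 0 then show ?case using y(2) by (simp add: D_def numeral_2_eq_2)
  next
    case (Suc i) then show ?case using Ddec by blast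
  qed
  define f where "f i = (LEAST j. vs ! j \<notin> D i)" for i
  have f: "vs ! f i \<notin> D i" "f i \<le> length es" "\<And>j. j < f i \<Longrightarrow> vs ! j \<in> D i" for i
  proof -
    have l: "vs ! length es \<notin> D i" using v0 y' by simp
    show "vs ! f i \<notin> D i" unfolding f_def by (rule LeastI[of "\<lambda>j. vs ! j \<notin> D i", OF l])
    show "f i \<le> length es" unfolding f_def by (rule Least_le[of "\<lambda>j. vs ! j \<notin> D i", OF l])
    show "vs ! j \<in> D i" if "j < f i" for j
      using not_less_Least[of j "\<lambda>j. vs ! j \<notin> D i"] that unfolding f_def by blast
  qed
  have f_le: "f (Suc i) \<le> j" if "vs ! j \<notin> D (Suc i)" for i j
    using f(3)[of j "Suc i"] that by (meson not_less)
  have desc: "f (Suc i) < f i \<or> (f (Suc i) = f i \<and> bdc G (D (Suc i)) < bdc G (D i))" for i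
  proof -
    have le: "f (Suc i) \<le> f i" using f_le f(1) Ddec by blast
    have pr: "bdc G (D (Suc i)) < bdc G (D i) \<or> (\<forall>u\<in>D (Suc i). \<forall>e\<in>bd G (D i). u \<notin> endpts G e)"
      using C_progress[OF pN(1)[of "i + 2"]] pN(2)[of "i + 2"] by (simp add: D_def)
    show ?thesis
    proof (cases "bdc G (D (Suc i)) < bdc G (D i)")
      case True
      then show ?thesis using le by auto
    next
      case False
      have "f i \<noteq> 0"
      proof
        assume "f i = 0"
        then show False using f(1)[of i] v0 v by (simp add: D_def)
      qed
      then obtain j where j: "f i = Suc j" by (cases "f i") auto
      \<comment> \<open>The edge on which the walk first leaves \<open>D i\<close> is a boundary
        edge. If the boundary does not shrink, its inner end drops out of the next set, so the walk
        leaves that set earlier.\<close>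
      have "(es ! j, vs ! j, vs ! Suc j) \<in> arcs G"
        using c(1) f(2)[of i] j by (simp add: chain_def)
      then have e: "es ! j \<in> edges G" "endpts G (es ! j) = {vs ! j, vs ! Suc j}" by (auto simp: arcs_def)
      moreover have "vs ! j \<in> D i" "vs ! Suc j \<notin> D i" using f(3)[of j i] f(1)[of i] j by auto
      ultimately have "es ! j \<in> bd G (D i)" using bd_endpts by metis
      then have "vs ! j \<notin> D (Suc i)" using pr False e(2) by auto
      then show ?thesis using f_le[of j i] j by simp
    qed
  qed
  define g where "g i = (f i, bdc G (D i))" for i
  have "(g (Suc i), g i) \<in> less_than <*lex*> less_than" for i
    using desc[of i] by (auto simp: g_def)
  moreover have "\<nexists>g. \<forall>i. (g (Suc i), g i) \<in> (less_than <*lex*> less_than :: ((nat \<times> nat) \<times> nat \<times> nat) set)"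
    unfolding wf_iff_no_infinite_down_chain[symmetric] by auto
  ultimately show False by blast
qed

lemma descend:
  assumes s: "s \<in> N" "P s" and step: "\<And>t. t \<in> up s \<Longrightarrow> P t \<Longrightarrow> \<exists>c\<in>N - {r}. par c = t \<and> P c"
  obtains p where "p 0 = s" "\<And>i::nat. (p i, p (Suc i)) \<in> cr" "\<And>i. P (p i)"
proof -
  have "\<exists>p. \<forall>i. (p i \<in> up s \<and> P (p i) \<and> (i = 0 \<longrightarrow> p i = s)) \<and> (p i, p (Suc i)) \<in> cr"
  proof (rule dependent_nat_choice)
    show "\<exists>x. x \<in> up s \<and> P x \<and> (0 = (0::nat) \<longrightarrow> x = s)" using s up_self by blast
    fix x and n :: nat assume x: "x \<in> up s \<and> P x \<and> (n = 0 \<longrightarrow> x = s)"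
    then obtain c where c: "c \<in> N - {r}" "par c = x" "P c" using step by blast
    have "(x, c) \<in> cr" using cr_par[of c] c by auto
    moreover have "c \<in> up s" using up_child[of c] c x up_trans by blast
    ultimately show "\<exists>y. (y \<in> up s \<and> P y \<and> (Suc n = 0 \<longrightarrow> y = s)) \<and> (x, y) \<in> cr" using c by blast
  qed
  then show ?thesis using that by blast
qed

text \<open>A vertex of \<open>C s\<close> in no bag above \<open>s\<close> would lie in a child's
  set at every stage, hence in all sets along a ray of the tree, against
  \<open>C_Inter_empty\<close>.\<close>

lemma Union_bag:
  assumes s: "s \<in> N" shows "(\<Union>t\<in>up s. bag t) = C s"
proof
  show "(\<Union>t\<in>up s. bag t) \<subseteq> C s" using C_mono by (fastforce simp: bag_def)
  show "C s \<subseteq> (\<Union>t\<in>up s. bag t)"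
  proof (rule subsetI, rule ccontr)
    fix x assume x: "x \<in> C s" "x \<notin> (\<Union>t\<in>up s. bag t)"
    have "\<exists>c\<in>N - {r}. par c = t \<and> x \<in> C c" if "t \<in> up s" "x \<in> C t" for t
      using that x(2) unfolding bag_def by blast
    then obtain p where "\<And>i::nat. (p i, p (Suc i)) \<in> cr" "\<And>i. x \<in> C (p i)"
      using descend[of s "\<lambda>t. x \<in> C t"] s x(1) by metis
    then show False using C_Inter_empty by blast
  qed
qed

lemma Union_bag_all: "(\<Union>t\<in>N. bag t) = verts G"
  using Union_bag[OF root(1)] C_root by (simp add: up_root_eq)

lemma Union_bag_compl:
  assumes s: "s \<in> N" shows "(\<Union>t\<in>N - up s. bag t) = verts G - C s"
proof -
  have "(\<Union>t\<in>N - up s. bag t) \<inter> (\<Union>t\<in>up s. bag t) = {}"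
  proof (rule ccontr)
    assume "\<not> ?thesis"
    then obtain x a b where "a \<in> N - up s" "b \<in> up s" "x \<in> bag a" "x \<in> bag b" by blast
    moreover have "b \<in> N" "a \<noteq> b" using calculation up_sub[OF s] by blast+
    ultimately show False using bag_disjoint unfolding disjoint_family_on_def by blast
  qed
  moreover have "(\<Union>t\<in>N - up s. bag t) \<union> (\<Union>t\<in>up s. bag t) = verts G"
    using Union_bag_all up_sub[OF s] by blast
  ultimately show ?thesis unfolding Union_bag[OF s] by blast
qed

lemma decomposition: "tree_cut_decomposition G T r bag"
  using rooted_tree_T bag_disjoint Union_bag_all by (simp add: tree_cut_decomposition_def)

lemma adhesion_eq:
  assumes s: "s \<in> N - {r}" shows "adhesion G T bag {s, par s} = bd G (C s)"
proof -
  have sN: "s \<in> N" using s by simp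
  have ne: "up s \<noteq> N - up s" using up_self[of s] sN by blast
  have "adhesion G T bag {s, par s} = {f \<in> edges G. (\<exists>u\<in>C s. \<exists>v\<in>verts G - C s. endpts G f = {u, v}) \<or>
     (\<exists>u\<in>verts G - C s. \<exists>v\<in>C s. endpts G f = {u, v})}"
    unfolding adhesion_def components_T[OF s]
  proof (rule Collect_cong, rule conj_cong[OF refl])
    fix f
    have two: "(\<exists>T1\<in>{A, B}. \<exists>T2\<in>{A, B}. T1 \<noteq> T2 \<and> Q T1 T2) \<longleftrightarrow> Q A B \<or> Q B A"
      if "A \<noteq> B" for A B :: "'n set" and Q
      using that by auto
    show "(\<exists>T1\<in>{up s, N - up s}. \<exists>T2\<in>{up s, N - up s}. T1 \<noteq> T2 \<and>
        (\<exists>u\<in>\<Union>t\<in>T1. bag t. \<exists>v\<in>\<Union>t\<in>T2. bag t. endpts G f = {u, v})) \<longleftrightarrow>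
      (\<exists>u\<in>C s. \<exists>v\<in>verts G - C s. endpts G f = {u, v}) \<or>
      (\<exists>u\<in>verts G - C s. \<exists>v\<in>C s. endpts G f = {u, v})"
      unfolding two[OF ne] Union_bag[OF sN] Union_bag_compl[OF sN] ..
  qed
  also have "\<dots> = bd G (C s)"
    using mG unfolding bd_def multigraph_def by (auto; blast)
  finally show ?thesis .
qed

lemma finite_adhesion: "finite_adhesion G T bag"
  unfolding finite_adhesion_def using adhesion_eq C_props by auto

lemma part_above_eq: "t \<in> N \<Longrightarrow> part_above T r bag t = C t"
proof -
  assume t: "t \<in> N"
  have "{s \<in> verts T. tree_le T r t s} = up t" using tree_le_iff t up_sub[OF t] by auto
  then show ?thesis unfolding part_above_def using Union_bag[OF t] by simp
qed

lemma componental_at_iff: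
  assumes "t \<in> N"
  shows "componental_at G T r bag t \<longleftrightarrow> C t \<noteq> {} \<and> connected_graph (induced G (C t))"
proof -
  have "verts (induced G (C t)) = C t" using C_verts[OF assms] by (auto simp: induced_def)
  then show ?thesis unfolding componental_at_def part_above_eq[OF assms] by simp
qed

lemma componental_at_child:
  assumes "t \<in> N - {r}" shows "componental_at G T r bag t"
proof -
  have "t \<in> N" using assms by simp
  then show ?thesis using componental_at_iff C_props[OF assms] conn_iff[OF mG C_verts] by blast
qed

text \<open>By \<open>menger_cut\<close> it remains to exclude a set \<open>D\<close> between the
  two end sets with fewer than \<open>k\<close> boundary edges. \<open>C_min\<close> supplies a free
  ray in the last set; \<open>C_shrink\<close> pushes \<open>D\<close> along the path, keeping this
  ray, until it lies in the set of the last node's parent, where it contradicts the choice of the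
  ray.\<close>

lemma linked: "linked G T r bag"
  unfolding linked_def
proof (intro allI impI)
  fix ts es assume a: "is_path T ts es \<and> es \<noteq> [] \<and> (\<forall>i<length es. tree_less T r (ts ! i) (ts ! Suc i))"
  \<comment> \<open>The upper end of the \<open>i\<close>-th edge, whose adhesion set is
    \<open>bd G (C (x i))\<close>.\<close>
  define x where "x i = ts ! Suc i" for i
  have es: "x i \<in> N - {r} \<and> par (x i) = ts ! i \<and> es ! i = {x i, par (x i)}" if i: "i < length es" for i
  proof -
    have "is_path T ts es" using a by blast
    then have e: "es ! i = {ts ! i, ts ! Suc i}" and ee: "es ! i \<in> edges T"
      using i nth_mem[OF i] unfolding is_path_def T_simps by blast+
    then have "(ts ! i, ts ! Suc i) \<in> adj T" unfolding adj_def by auto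
    moreover have "ts ! Suc i \<in> up (ts ! i)" "ts ! Suc i \<noteq> ts ! i"
      using a i by (auto simp: tree_less_def tree_le_iff)
    then have "h (ts ! i) < h (ts ! Suc i)" using up_h[of "ts ! Suc i" "ts ! i"] by auto
    then have "(ts ! Suc i, ts ! i) \<notin> cr" using crD by fastforce
    ultimately have "(ts ! i, ts ! Suc i) \<in> cr" unfolding adj_T by blast
    from crD[OF this] show ?thesis using e unfolding x_def by auto
  qed
  have par_x: "par (x (Suc i)) = x i" if "Suc i < length es" for i
    using es[OF that] by (simp add: x_def)
  have adh: "adhesion G T bag (es ! i) = bd G (C (x i))" if "i < length es" for i
    using es[OF that] adhesion_eq[of "x i"] by metis
  define n where "n = length es - 1"
  have n: "n < length es" "length es = Suc n" using a by (auto simp: n_def)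
  define k where "k = Min ((\<lambda>e. card (adhesion G T bag e)) ` set es)"
  have k: "k \<le> bdc G (C (x i))" if "i < length es" for i
    unfolding k_def using that adh[OF that] by (intro Min_le) (auto intro!: image_eqI[of _ _ "es ! i"])
  have Cdec: "C (x j) \<subseteq> C (x i)" if "i \<le> j" "j < length es" for i j
    using that
  proof (induction j rule: dec_induct)
    case (step j)
    have "x (Suc j) \<in> N - {r}" using es step by blast
    then have "C (x (Suc j)) \<subseteq> C (x j)" using C_sub[of "x (Suc j)"] par_x[of j] step by simp
    then show ?case using step by auto
  qed simp
  have "\<exists>P. card P = k \<and>
    (\<forall>(vs, fs)\<in>P. is_path_from_edge_to_edge G (bd G (C (x 0))) (bd G (C (x n))) vs fs) \<and>
    (\<forall>p\<in>P. \<forall>q\<in>P. p \<noteq> q \<longrightarrow> set (snd p) \<inter> set (snd q) = {})"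
  proof (rule menger_cut[OF mG Cdec])
    fix D assume D: "C (x n) \<subseteq> D" "D \<subseteq> C (x 0)" "finite (bd G D)"
    show "k \<le> bdc G D"
    proof (rule ccontr)
      assume lt: "\<not> k \<le> bdc G D"
      obtain R where R: "free_ray G R" "ev R (C (x n))" "\<And>D. D \<subseteq> C (par (x n)) \<Longrightarrow> finite (bd G D) \<Longrightarrow>
          ev R D \<Longrightarrow> min (bdc G (C (x n))) (bdc G (C (par (x n)))) \<le> bdc G D"
        using C_min[of "x n"] es[OF n(1)] by blast
      have *: "\<exists>D'\<subseteq>C (x i). finite (bd G D') \<and> ev R D' \<and> bdc G D' \<le> bdc G D" if "i \<le> n" for i
        using that
      proof (induction i)
        case 0
        have "ev R D" using R(2) D(1) by (rule ev_mono)
        then show ?case using D by blast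
      next
        case (Suc i)
        have "i \<le> n" using Suc.prems by simp
        from Suc.IH[OF this] obtain E where
          E: "E \<subseteq> C (x i)" "finite (bd G E)" "ev R E" "bdc G E \<le> bdc G D" by blast
        have i: "i < length es" "Suc i < length es" using Suc.prems n by auto
        have xi: "x (Suc i) \<in> N - {r}" using es[OF i(2)] by blast
        have "ev R (C (x (Suc i)))" by (rule ev_mono[OF R(2) Cdec[OF Suc.prems n(1)]])
        moreover have "bdc G E < bdc G (C (x i))" using k[OF i(1)] lt E(4) by linarith
        ultimately obtain E' where "E' \<subseteq> C (x (Suc i))" "finite (bd G E')" "ev R E'" "bdc G E' \<le> bdc G E"
          using C_shrink[OF xi R(1), of E] unfolding par_x[OF i(2)] using E(1-3) by blast
        then show ?case using E(4) by (meson order_trans)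
      qed
      show False
      \<comment> \<open>For a single edge the only set between the two is \<open>C (x 0)\<close>
        itself. Otherwise the pushed cut is stopped at \<open>x m\<close>, the parent of the last
        node, where \<open>C_min\<close> applies.\<close>
      proof (cases n)
        case 0
        then have "D = C (x 0)" using D by auto
        then show False using k[of 0] lt n by simp
      next
        case (Suc m)
        then obtain E where E: "E \<subseteq> C (x m)" "finite (bd G E)" "ev R E" "bdc G E \<le> bdc G D"
          using *[of m] by (metis le_SucI order_refl)
        have "par (x n) = x m" using par_x[of m] Suc n by simp
        then have "min (bdc G (C (x n))) (bdc G (C (x m))) \<le> bdc G E" using R(3)[of E] E by simp
        moreover have "k \<le> bdc G (C (x n))" "k \<le> bdc G (C (x m))" using k n Suc by auto
        ultimately show False using E(4) lt by linarith
      qed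
    qed
  qed (use n in auto)
  moreover have "hd es = es ! 0" "last es = es ! n"
    using a by (auto simp: hd_conv_nth last_conv_nth n_def)
  ultimately show "\<exists>P. card P = Min ((\<lambda>e. card (adhesion G T bag e)) ` set es) \<and>
           (\<forall>(vs, fs) \<in> P.
              is_path_from_edge_to_edge G (adhesion G T bag (hd es)) (adhesion G T bag (last es)) vs fs) \<and>
           (\<forall>p \<in> P. \<forall>q \<in> P. p \<noteq> q \<longrightarrow> set (snd p) \<inter> set (snd q) = {})"
    using adh[of 0] adh[OF n(1)] n unfolding k_def by simp
qed

section \<open>Positions of edge-ends in the tree\<close>

lemma edge_end_props:
  assumes "\<omega> \<in> edge_ends G" "R \<in> \<omega>"
  shows "is_ray G R" "\<omega> = equiv_rays G `` {R}"
proof -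
  show eq: "\<omega> = equiv_rays G `` {R}"
    using assms equiv_equiv_rays[OF mG] unfolding edge_ends_alt
    by (metis Image_singleton_iff equiv_class_eq quotientE)
  then show "is_ray G R" using assms(2) by (auto simp: equiv_rays_iff[OF mG])
qed

lemma orients_iff:
  assumes \<omega>: "\<omega> \<in> edge_ends G" "R \<in> \<omega>" and s: "s \<in> N - {r}"
  shows "orients_towards T bag \<omega> {s, par s} K \<longleftrightarrow>
    (K = up s \<and> ev R (C s)) \<or> (K = N - up s \<and> \<not> ev R (C s))"
proof -
  have sN: "s \<in> N" using s by simp
  have R: "is_ray G R" using edge_end_props[OF \<omega>] by simp
  have f: "finite (bd G (C s))" using C_props[OF s] by simp
  have f': "finite (bd G (verts G - C s))" using f bd_verts by (intro finite_bd_Diff) auto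
  have "verts R - (verts G - C s) = verts R - (- C s)" using ray_verts[OF R] by auto
  then have "ev R (verts G - C s) \<longleftrightarrow> ev R (- C s)" by (simp add: ev_def)
  also have "\<dots> \<longleftrightarrow> \<not> ev R (C s)" using ev_dichotomy[OF R f] ev_disjoint[OF R, of "C s" "- C s"] by auto
  finally have c: "ev R (verts G - C s) \<longleftrightarrow> \<not> ev R (C s)" .
  have "lives_in \<omega> (\<Union>t\<in>up s. bag t) \<longleftrightarrow> ev R (C s)"
    unfolding Union_bag[OF sN] using lives_in_iff[OF mG \<omega> f] .
  moreover have "lives_in \<omega> (\<Union>t\<in>N - up s. bag t) \<longleftrightarrow> \<not> ev R (C s)"
    unfolding Union_bag_compl[OF sN] using lives_in_iff[OF mG \<omega> f'] c by simp
  ultimately show ?thesis unfolding orients_towards_def components_T[OF s] by blast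
qed

lemma points_to_node_iff:
  assumes \<omega>: "\<omega> \<in> edge_ends G" "R \<in> \<omega>"
  shows "points_to_node T bag \<omega> t \<longleftrightarrow> t \<in> N \<and> (\<forall>s\<in>N - {r}. ev R (C s) \<longleftrightarrow> t \<in> up s)"
proof -
  have "(\<exists>K. orients_towards T bag \<omega> {s, par s} K \<and> t \<in> K) \<longleftrightarrow> (ev R (C s) \<longleftrightarrow> t \<in> up s)"
    if "s \<in> N - {r}" "t \<in> N" for s
    unfolding orients_iff[OF \<omega> that(1)] using that(2) by auto
  then show ?thesis unfolding points_to_node_def by auto
qed

lemma points_to_end_iff:
  assumes \<omega>: "\<omega> \<in> edge_ends G" "R \<in> \<omega>" and Q: "is_ray T Q"
  shows "points_to_end T bag \<omega> (end_rel `` {Q}) \<longleftrightarrow> (\<forall>s\<in>N - {r}. ev R (C s) \<longleftrightarrow> ev Q (up s))"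
proof -
  have "(\<exists>K. orients_towards T bag \<omega> {s, par s} K \<and> lives_in (end_rel `` {Q}) K) \<longleftrightarrow>
      (ev R (C s) \<longleftrightarrow> ev Q (up s))" if s: "s \<in> N - {r}" for s
  proof -
    have "s \<in> N" using s by simp
    then show ?thesis unfolding orients_iff[OF \<omega> s] using lives_in_up[OF refl Q, of s] by auto
  qed
  moreover have "end_rel `` {Q} \<in> graph_ends T"
    unfolding graph_ends_alt using Q by (auto intro: quotientI)
  ultimately show ?thesis unfolding points_to_end_def by auto
qed

lemma end_eqI:
  assumes "is_ray T Q" "is_ray T Q'" "\<And>s. s \<in> N - {r} \<Longrightarrow> ev Q (up s) \<longleftrightarrow> ev Q' (up s)"
  shows "end_rel `` {Q} = end_rel `` {Q'}"
proof -
  have "ev Q (up r)" "ev Q' (up r)"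
    unfolding up_root_eq ev_def using ray_verts[OF assms(1)] ray_verts[OF assms(2)] by (auto simp: Diff_eq_empty_iff[THEN iffD2])
  then have "(Q, Q') \<in> end_rel" unfolding end_rel_iff using assms by (metis DiffI singletonD)
  then show ?thesis using equiv_end_rel by (rule equiv_class_eq[rotated])
qed

definition pos :: "('v, 'e) mgraph set \<Rightarrow> 'n + ('n, 'n set) mgraph set \<Rightarrow> bool" where
  "pos \<omega> x \<longleftrightarrow> (case x of Inl t \<Rightarrow> points_to_node T bag \<omega> t | Inr \<epsilon> \<Rightarrow> points_to_end T bag \<omega> \<epsilon>)"

text \<open>This justifies the definite description in \<open>end_position\<close>. A node and an
  end cannot both qualify, because a ray of the end ascends beyond the height of the node.\<close>

lemma pos_unique:
  assumes \<omega>: "\<omega> \<in> edge_ends G" and "pos \<omega> x" "pos \<omega> y"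
  shows "x = y"
proof -
  obtain R where R: "R \<in> \<omega>" using edge_endE[OF mG \<omega>] by metis
  have nn: "t = t'" if "points_to_node T bag \<omega> t" "points_to_node T bag \<omega> t'" for t t'
  proof -
    have t: "t \<in> N" "t' \<in> N" "\<And>s. s \<in> N - {r} \<Longrightarrow> t \<in> up s \<longleftrightarrow> t' \<in> up s"
      using that unfolding points_to_node_iff[OF \<omega> R] by blast+
    have "t' \<in> up t" using t(3)[of t] t(1,2) up_self up_root by (cases "t = r") auto
    moreover have "t \<in> up t'" using t(3)[of t'] t(1,2) up_self up_root by (cases "t' = r") auto
    ultimately show ?thesis using up_h[of t t'] up_h[of t' t] by auto
  qed
  have ne: False if t: "points_to_node T bag \<omega> t" and \<epsilon>: "points_to_end T bag \<omega> \<epsilon>" for t \<epsilon>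
  proof -
    have "\<epsilon> \<in> graph_ends T" using \<epsilon> by (simp add: points_to_end_def)
    then obtain Q where Q: "is_ray T Q" "\<epsilon> = end_rel `` {Q}" using graph_endE by metis
    have eq: "ev Q (up s) \<longleftrightarrow> t \<in> up s" if "s \<in> N - {r}" for s
      using t \<epsilon> that unfolding Q(2) points_to_node_iff[OF \<omega> R] points_to_end_iff[OF \<omega> R Q(1)] by blast
    obtain p m where p: "inj p" "verts Q = range p" "\<And>i::nat. i \<ge> m \<Longrightarrow> (p i, p (Suc i)) \<in> cr"
      using ray_ascends[OF Q(1)] by metis
    define i where "i = m + Suc (h t)"
    have hi: "h t < h (p i)" using ascending_up[where p = p and m = m and i = m and j = i, OF p(3)]
      by (simp add: i_def)
    have "(p i, p (Suc i)) \<in> cr" using p(3)[of i] by (simp add: i_def)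
    then have "p i \<in> N - {r}" using crD hi root by fastforce
    moreover have "ev Q (up (p i))"
      unfolding ev_seq[OF p(1,2)]
      using ascending_up[where p = p and m = m and i = i, OF p(3)] by (intro exI[of _ i]) (auto simp: i_def)
    ultimately have "t \<in> up (p i)" using eq by blast
    then show False using up_h[of t "p i"] hi by simp
  qed
  have ee: "\<epsilon> = \<epsilon>'" if \<epsilon>: "points_to_end T bag \<omega> \<epsilon>" "points_to_end T bag \<omega> \<epsilon>'" for \<epsilon> \<epsilon>'
  proof -
    have "\<epsilon> \<in> graph_ends T" "\<epsilon>' \<in> graph_ends T" using \<epsilon> by (simp_all add: points_to_end_def)
    then obtain Q Q' where Q: "is_ray T Q" "\<epsilon> = end_rel `` {Q}" "is_ray T Q'" "\<epsilon>' = end_rel `` {Q'}"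
      using graph_endE by metis
    show ?thesis
      using \<epsilon> unfolding Q(2,4) points_to_end_iff[OF \<omega> R Q(1)] points_to_end_iff[OF \<omega> R Q(3)]
      by (intro end_eqI[OF Q(1,3)]) blast
  qed
  show ?thesis using assms(2,3) nn ne ee unfolding pos_def by (auto split: sum.splits)
qed

lemma end_position_eqI: "\<omega> \<in> edge_ends G \<Longrightarrow> pos \<omega> x \<Longrightarrow> end_position T bag \<omega> = x"
  unfolding end_position_def by (rule the_equality) (auto simp: pos_def[symmetric] intro: pos_unique)

section \<open>Rays of the tree and the edge-ends they display\<close>

lemma ascending_free:
  assumes R: "is_ray G R" and p: "\<And>i::nat. (p i, p (Suc i)) \<in> cr" "\<And>i. ev R (C (p i))"
  shows "free_ray G R"
  unfolding free_ray_def
proof (intro conjI ballI)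
  fix v assume v: "v \<in> verts G"
  obtain i where i: "v \<notin> C (p i)" using C_Inter_empty[where p = p, OF p(1)] by blast
  \<comment> \<open>The next node is taken because it cannot be the root, so \<open>C_props\<close>
    provides a finite boundary.\<close>
  have pi: "p (Suc i) \<in> N - {r}" "par (p (Suc i)) = p i" using asc_par[OF p(1)] by blast+
  then have "v \<notin> C (p (Suc i))" using C_sub[of "p (Suc i)"] i by auto
  then show "\<exists>A. finite (bd G A) \<and> ev R A \<and> v \<notin> A" using C_props[OF pi(1)] p(2) by blast
qed (rule R)

lemma ascending_C_iff:
  assumes R: "is_ray G R" and p: "\<And>i::nat. (p i, p (Suc i)) \<in> cr" "\<And>i. ev R (C (p i))"
    and s: "s \<in> N"
  shows "ev R (C s) \<longleftrightarrow> (\<exists>i. p i \<in> up s)"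
proof
  assume e: "ev R (C s)"
  have as: "h (p i) = h (p 0) + i" for i
    using ascending_up[where p = p and m = 0 and i = 0 and j = i] p(1) by auto
  \<comment> \<open>At this index the sequence has height at least \<open>h s\<close>, so a node
    \<open>s\<close> above \<open>p ?i\<close> must be equal to it.\<close>
  let ?i = "h s"
  have "p ?i \<in> N" using crD[OF p(1)] by blast
  moreover have "C s \<inter> C (p ?i) \<noteq> {}" using ev_disjoint[OF R e p(2)] .
  ultimately have "s \<in> up (p ?i) \<or> p ?i \<in> up s" using C_comparable s by blast
  then show "\<exists>i. p i \<in> up s"
  proof
    assume "s \<in> up (p ?i)"
    then have "s = p ?i" using up_h[of s "p ?i"] as[of ?i] by auto
    then show ?thesis using up_self by metis
  qed blast
next
  assume "\<exists>i. p i \<in> up s"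
  then show "ev R (C s)" using C_mono p(2) ev_mono by blast
qed

lemma ascending_up_iff:
  assumes q: "inj q" "verts Q = range q" and p: "\<And>i::nat. (p i, p (Suc i)) \<in> cr" "\<And>i. p i = q (m + i)"
  shows "ev Q (up s) \<longleftrightarrow> (\<exists>i. p i \<in> up s)"
proof
  assume "ev Q (up s)"
  then obtain n where "\<forall>i\<ge>n. q i \<in> up s" using ev_seq[OF q] by blast
  then have "q (m + n) \<in> up s" by simp
  then show "\<exists>i. p i \<in> up s" using p(2) by metis
next
  assume "\<exists>i. p i \<in> up s"
  then obtain i where i: "p i \<in> up s" by blast
  have "q j \<in> up s" if "m + i \<le> j" for j
  proof -
    have "p (j - m) \<in> up (p i)"
      using ascending_up[where p = p and m = 0 and i = i and j = "j - m"] p(1) that by auto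
    then show ?thesis using i up_trans p(2)[of "j - m"] that by auto
  qed
  then show "ev Q (up s)" using ev_seq[OF q] by blast
qed

lemma ascending_ray:
  assumes p: "\<And>i::nat. (p i, p (Suc i)) \<in> cr"
  obtains Q where "is_ray T Q" "verts Q = range p" "inj p"
proof -
  define Q where "Q = T\<lparr>verts := range p, edges := range (\<lambda>i. {p i, p (Suc i)})\<rparr>"
  have as: "h (p i) = h (p 0) + i" for i
    using ascending_up[where p = p and m = 0 and i = 0 and j = i] p by auto
  have inj: "inj p" by (rule injI) (metis as add_left_cancel)
  have Q: "verts Q = range p" "edges Q = range (\<lambda>i. {p i, p (Suc i)})" "endpts Q = endpts T"
    by (simp_all add: Q_def)
  have pN: "p i \<in> N" for i using crD[OF p] by blast
  have "{p i, p (Suc i)} \<in> edges T" for i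
    using p[of i] by (auto simp: cr_def insert_commute)
  then have e: "edges Q \<subseteq> edges T" unfolding Q(2) by blast
  have "multigraph Q" using inj by (auto simp: multigraph_def Q(1,2) Q(3) card_insert_if inj_eq)
  then have "subgraph Q T" using e Q pN by (auto simp: subgraph_def)
  then have "is_ray T Q"
    unfolding is_ray_def using inj Q by (intro conjI exI[of _ p] exI[of _ "\<lambda>i. {p i, p (Suc i)}"]) auto
  then show ?thesis using that Q inj by blast
qed

text \<open>Either the ray lives in the set of some node but in that of no child, and then
  \<open>C_cover\<close> shows that it is not free; or the descent through children never stops, and
  then the empty intersection makes it free.\<close>

lemma position_cases:
  assumes \<omega>: "\<omega> \<in> edge_ends G" "R \<in> \<omega>"
  obtains (node) t where "\<not> free_ray G R" "end_position T bag \<omega> = Inl t"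
  | (atend) p \<epsilon> where "free_ray G R" "\<epsilon> \<in> graph_ends T" "end_position T bag \<omega> = Inr \<epsilon>"
      "points_to_end T bag \<omega> \<epsilon>" "\<And>i::nat. (p i, p (Suc i)) \<in> cr" "\<And>i. ev R (C (p i))"
proof (cases "\<exists>t\<in>N. ev R (C t) \<and> (\<forall>c\<in>N - {r}. par c = t \<longrightarrow> \<not> ev R (C c))")
  case True
  have R: "is_ray G R" using edge_end_props[OF \<omega>] by simp
  obtain t where t: "t \<in> N" "ev R (C t)" "\<And>c. c \<in> N - {r} \<Longrightarrow> par c = t \<Longrightarrow> \<not> ev R (C c)"
    using True by blast
  have "ev R (C s) \<longleftrightarrow> t \<in> up s" if s: "s \<in> N - {r}" for s
  proof
    assume "t \<in> up s"
    then show "ev R (C s)" using C_mono t(2) ev_mono by blast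
  next
    assume e: "ev R (C s)"
    have "C s \<inter> C t \<noteq> {}" using ev_disjoint[OF R e t(2)] .
    then have "s \<in> up t \<or> t \<in> up s" using C_comparable s t(1) by blast
    moreover have "s = t" if st: "s \<in> up t"
    proof (rule ccontr)
      assume "s \<noteq> t"
      then obtain c where c: "c \<in> N - {r}" "par c = t" "s \<in> up c" using child_below[OF st] by blast
      then have "ev R (C c)" using C_mono e ev_mono by blast
      then show False using t(3) c by blast
    qed
    ultimately show "t \<in> up s" using up_self by blast
  qed
  then have "points_to_node T bag \<omega> t" unfolding points_to_node_iff[OF \<omega>] using t(1) by blast
  then have "end_position T bag \<omega> = Inl t" by (intro end_position_eqI[OF \<omega>(1)]) (simp add: pos_def)
  moreover have "\<not> free_ray G R" using C_cover[OF t(1) _ t(2)] t(3) by blast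
  ultimately show ?thesis using node by blast
next
  case False
  have R: "is_ray G R" using edge_end_props[OF \<omega>] by simp
  have "ev R (C r)" unfolding C_root ev_def using ray_verts[OF R] by (simp add: Diff_eq_empty_iff[THEN iffD2])
  moreover have "\<exists>c\<in>N - {r}. par c = t \<and> ev R (C c)" if "t \<in> up r" "ev R (C t)" for t
    using False that up_root_eq by blast
  ultimately obtain p where p: "\<And>i::nat. (p i, p (Suc i)) \<in> cr" "\<And>i. ev R (C (p i))"
    using descend[of r "\<lambda>t. ev R (C t)"] root(1) by metis
  obtain Q where Q: "is_ray T Q" "verts Q = range p" "inj p" using ascending_ray[where p = p, OF p(1)] by metis
  have "ev R (C s) \<longleftrightarrow> ev Q (up s)" if "s \<in> N - {r}" for s
    using ascending_C_iff[where p = p and s = s, OF R p] ascending_up_iff[where p = p and m = 0 and s = s, OF Q(3,2) p(1)] that by auto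
  then have e: "points_to_end T bag \<omega> (end_rel `` {Q})" unfolding points_to_end_iff[OF \<omega> Q(1)] by blast
  then have "end_position T bag \<omega> = Inr (end_rel `` {Q})"
    by (intro end_position_eqI[OF \<omega>(1)]) (simp add: pos_def)
  moreover have "end_rel `` {Q} \<in> graph_ends T" using e by (simp add: points_to_end_def)
  ultimately show ?thesis using atend[where p = p, OF ascending_free[where p = p, OF R p] _ _ e p] by blast
qed

lemma ends_determined:
  assumes R: "is_ray G R" "is_ray G R'" and p: "\<And>i::nat. (p i, p (Suc i)) \<in> cr"
    and e: "\<And>i. ev R (C (p i))" "\<And>i. ev R' (C (p i))" and A: "finite (bd G A)" "ev R A"
  shows "ev R' A"
proof (rule ccontr)
  assume "\<not> ev R' A"
  then have A': "ev R' (- A)" using ev_dichotomy[OF R(2) A(1)] by blast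
  have pN: "p (Suc i) \<in> N - {r}" "par (p (Suc i)) = p i" for i using asc_par[OF p] by auto
  have dec: "C (p j) \<subseteq> C (p i)" if "i \<le> j" for i j
    using that
  proof (induction j rule: dec_induct)
    case (step j)
    then show ?case using C_sub[OF pN(1)[of j]] pN(2)[of j] by auto
  qed simp
  have "\<exists>i. \<forall>e\<in>F. \<not> endpts G e \<subseteq> C (p i)" if "finite F" "F \<subseteq> bd G A" for F
    using that
  proof (induction F rule: finite_induct)
    case (insert e F)
    then obtain i where i: "\<forall>e\<in>F. \<not> endpts G e \<subseteq> C (p i)" by auto
    obtain u where u: "u \<in> endpts G e" using insert.prems by (auto simp: bd_def)
    obtain j where j: "u \<notin> C (p j)" using C_Inter_empty[where p = p, OF p] by blast
    have "\<not> endpts G f \<subseteq> C (p (max i j))" if "f \<in> insert e F" for f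
      using that i j u dec[of i "max i j"] dec[of j "max i j"] by auto
    then show ?case by blast
  qed simp
  from this[OF A(1) order_refl] obtain i where i: "\<forall>e\<in>bd G A. \<not> endpts G e \<subseteq> C (p i)" by blast
  let ?D = "C (p (Suc i))"
  have con: "conn G ?D" using C_props[OF pN(1)] by blast
  have "?D \<inter> A \<noteq> {}" using ev_disjoint[OF R(1) e(1) A(2)] .
  moreover have "?D \<inter> A \<subset> ?D" using ev_disjoint[OF R(2) e(2)[of "Suc i"] A'] by blast
  ultimately obtain f where f: "f \<in> bd G (?D \<inter> A)" "endpts G f \<subseteq> ?D"
    using conn_bd_nonempty[OF con] by blast
  then obtain u v where uv: "f \<in> edges G" "endpts G f = {u, v}" "u \<in> ?D \<inter> A" "v \<notin> ?D \<inter> A" by (auto simp: bd_def)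
  then have "f \<in> bd G A" using f(2) bd_endpts[OF uv(1,2), of A] by auto
  then show False using i f(2) dec[of i "Suc i"] by auto
qed

lemma displays: "displays G T bag {\<omega> \<in> edge_ends G. undominated G \<omega>}"
  unfolding displays_def
proof
  let ?\<Psi> = "{\<omega> \<in> edge_ends G. undominated G \<omega>}"
  let ?f = "end_position T bag"
  show "{\<omega> \<in> edge_ends G. ?f \<omega> \<in> Inr ` graph_ends T} = ?\<Psi>"
  proof -
    have "?f \<omega> \<in> Inr ` graph_ends T \<longleftrightarrow> undominated G \<omega>" if \<omega>: "\<omega> \<in> edge_ends G" for \<omega>
    proof -
      obtain R where R: "R \<in> \<omega>" using edge_endE[OF mG \<omega>] by metis
      show ?thesis unfolding undominated_iff[OF mG \<omega> R]
        by (rule position_cases[OF \<omega> R]) auto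
    qed
    then show ?thesis by blast
  qed
  show "bij_betw ?f ?\<Psi> (Inr ` graph_ends T)"
    unfolding bij_betw_def
  proof
    show "inj_on ?f ?\<Psi>"
    proof (rule inj_onI)
      fix \<omega> \<omega>' assume w: "\<omega> \<in> ?\<Psi>" "\<omega>' \<in> ?\<Psi>" "?f \<omega> = ?f \<omega>'"
      then have \<omega>: "\<omega> \<in> edge_ends G" "\<omega>' \<in> edge_ends G" by auto
      obtain R where R: "R \<in> \<omega>" "is_ray G R" using edge_endE[OF mG \<omega>(1)] by metis
      obtain R' where R': "R' \<in> \<omega>'" "is_ray G R'" using edge_endE[OF mG \<omega>(2)] by metis
      have free: "free_ray G R" "free_ray G R'"
        using w undominated_iff[OF mG \<omega>(1) R(1)] undominated_iff[OF mG \<omega>(2) R'(1)] by auto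
      obtain p \<epsilon> where p: "points_to_end T bag \<omega> \<epsilon>" "?f \<omega> = Inr \<epsilon>"
        "\<And>i::nat. (p i, p (Suc i)) \<in> cr" "\<And>i. ev R (C (p i))"
        using position_cases[OF \<omega>(1) R(1)] free(1) by metis
      obtain \<epsilon>' where p': "points_to_end T bag \<omega>' \<epsilon>'" "?f \<omega>' = Inr \<epsilon>'"
        using position_cases[OF \<omega>(2) R'(1)] free(2) by metis
      have \<epsilon>: "points_to_end T bag \<omega>' \<epsilon>" using p p' w(3) by simp
      obtain Q where Q: "is_ray T Q" "\<epsilon> = end_rel `` {Q}"
        using p(1) graph_endE unfolding points_to_end_def by metis
      have eq: "ev R (C s) \<longleftrightarrow> ev R' (C s)" if "s \<in> N - {r}" for s
        using p(1) \<epsilon> that unfolding Q(2) points_to_end_iff[OF \<omega>(1) R(1) Q(1)]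
          points_to_end_iff[OF \<omega>(2) R'(1) Q(1)] by blast
      \<comment> \<open>The equivalence \<open>eq\<close> concerns nodes other than the root;
        \<open>p 0\<close> may be the root, so the sequence is shifted by one.\<close>
      define p1 where "p1 i = p (Suc i)" for i
      have p1: "(p1 i, p1 (Suc i)) \<in> cr" "ev R (C (p1 i))" "ev R' (C (p1 i))" for i
        using p(3)[of "Suc i"] p(4)[of "Suc i"] eq[of "p (Suc i)"] asc_par[OF p(3)[of i]]
        by (auto simp: p1_def)
      have "ev R A \<longleftrightarrow> ev R' A" if "finite (bd G A)" for A
        using ends_determined[where p = p1, OF R(2) R'(2) p1 that] ends_determined[where p = p1, OF R'(2) R(2) p1(1,3,2) that] by blast
      then have "(R, R') \<in> equiv_rays G" using R R' equiv_rays_iff[OF mG] by blast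
      then have "equiv_rays G `` {R} = equiv_rays G `` {R'}"
        using equiv_equiv_rays[OF mG] by (rule equiv_class_eq[rotated])
      then show "\<omega> = \<omega>'" using edge_end_props[OF \<omega>(1) R(1)] edge_end_props[OF \<omega>(2) R'(1)] by simp
    qed
    show "?f ` ?\<Psi> = Inr ` graph_ends T"
    proof
      show "?f ` ?\<Psi> \<subseteq> Inr ` graph_ends T"
      proof (rule image_subsetI)
        fix \<omega> assume w: "\<omega> \<in> ?\<Psi>"
        then have \<omega>: "\<omega> \<in> edge_ends G" by simp
        obtain R where R: "R \<in> \<omega>" using edge_endE[OF mG \<omega>] by metis
        have "free_ray G R" using w undominated_iff[OF mG \<omega> R] by simp
        then show "?f \<omega> \<in> Inr ` graph_ends T" by (rule_tac position_cases[OF \<omega> R]) auto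
      qed
      show "Inr ` graph_ends T \<subseteq> ?f ` ?\<Psi>"
      proof (rule image_subsetI)
        fix \<epsilon> assume "\<epsilon> \<in> graph_ends T"
        then obtain Q where Q: "is_ray T Q" "\<epsilon> = end_rel `` {Q}" using graph_endE by metis
        obtain q m where q: "inj q" "verts Q = range q" "\<And>i::nat. i \<ge> m \<Longrightarrow> (q i, q (Suc i)) \<in> cr"
          using ray_ascends[OF Q(1)] by metis
        \<comment> \<open>Starting one step after the ray begins to ascend keeps the root out of the
          sequence, as \<open>C_props\<close> requires.\<close>
        define p where "p i = q (Suc m + i)" for i
        have p: "(p i, p (Suc i)) \<in> cr" for i using q(3)[of "Suc m + i"] by (simp add: p_def)
        have pN: "p i \<in> N - {r}" for i using asc_par[OF q(3)[of "m + i"]] by (simp add: p_def)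
        have "\<exists>R. is_ray G R \<and> (\<forall>n. ev R (C (p n)))"
        proof (rule ray_through[OF mG])
          show "C (p (Suc n)) \<subseteq> C (p n)" for n
            using C_sub[OF pN[of "Suc n"]] asc_par[OF p[of n]] by simp
          show "conn G (C (p n))" "C (p n) \<noteq> {}" for n using C_props[OF pN[of n]] by auto
          show "(\<Inter>n. C (p n)) = {}" using C_Inter_empty[where p = p, OF p] .
          show "C (p 0) \<subseteq> verts G" using C_verts pN by blast
        qed
        then obtain R where R: "is_ray G R" "\<And>n. ev R (C (p n))" by blast
        define \<omega> where "\<omega> = equiv_rays G `` {R}"
        have \<omega>: "\<omega> \<in> edge_ends G" "R \<in> \<omega>"
          unfolding edge_ends_alt \<omega>_def using R(1) equiv_class_self[OF equiv_equiv_rays[OF mG]]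
          by (auto intro: quotientI)
        have "ev R (C s) \<longleftrightarrow> ev Q (up s)" if "s \<in> N - {r}" for s
          using ascending_C_iff[where p = p and s = s, OF R(1) p R(2)] ascending_up_iff[where p = p and m = "Suc m" and s = s, OF q(1,2) p] that
          by (auto simp: p_def)
        then have "points_to_end T bag \<omega> \<epsilon>" unfolding Q(2) points_to_end_iff[OF \<omega> Q(1)] by blast
        then have "?f \<omega> = Inr \<epsilon>" by (intro end_position_eqI[OF \<omega>(1)]) (simp add: pos_def)
        moreover have "undominated G \<omega>"
          using undominated_iff[OF mG \<omega>] ascending_free[where p = p, OF R(1) p R(2)] by simp
        ultimately show "Inr \<epsilon> \<in> ?f ` ?\<Psi>" using \<omega>(1) by (intro image_eqI[of _ _ \<omega>]) auto
      qed
    qed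
  qed
qed

end

section \<open>Construction of the tree\<close>

lemma good_childrenD:
  assumes "good_children G C \<S>"
  shows "disjoint \<S>"
    "S \<in> \<S> \<Longrightarrow> S \<subseteq> C" "S \<in> \<S> \<Longrightarrow> conn G C \<Longrightarrow> S \<noteq> C" "S \<in> \<S> \<Longrightarrow> S \<noteq> {}"
    "S \<in> \<S> \<Longrightarrow> conn G S" "S \<in> \<S> \<Longrightarrow> finite (bd G S)"
    "free_ray G R \<Longrightarrow> ev R C \<Longrightarrow> \<exists>S\<in>\<S>. ev R S"
    "S \<in> \<S> \<Longrightarrow> \<exists>R. free_ray G R \<and> ev R S \<and> (\<forall>D\<subseteq>C. finite (bd G D) \<longrightarrow> ev R D \<longrightarrow>
       min (bdc G S) (bdc G C) \<le> bdc G D)"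
    "S \<in> \<S> \<Longrightarrow> free_ray G R \<Longrightarrow> ev R S \<Longrightarrow> D \<subseteq> C \<Longrightarrow> finite (bd G D) \<Longrightarrow> ev R D \<Longrightarrow>
       bdc G D < bdc G C \<Longrightarrow> \<exists>D'\<subseteq>S. finite (bd G D') \<and> ev R D' \<and> bdc G D' \<le> bdc G D"
    "S \<in> \<S> \<Longrightarrow> bdc G S < bdc G C \<or> (\<forall>u\<in>S. \<forall>e\<in>bd G C. u \<notin> endpts G e)"
  using assms unfolding good_children_def by - (elim conjE, simp)+

text \<open>The root is the one node whose set may be disconnected or empty. In that case its
  children are the components in which a free ray lives; the clauses on sizes hold because
  \<open>verts G\<close> has empty boundary.\<close>

lemma good_children_verts:
  assumes mG: "multigraph G"
  shows "\<exists>\<S>. good_children G (verts G) \<S>"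
proof (cases "conn G (verts G) \<and> verts G \<noteq> {}")
  case True
  have "bd G (verts G) = {}" using mG by (auto simp: bd_def multigraph_def)
  then show ?thesis using good_children_conn[OF _ _ _ _ mG] True by auto
next
  case False
  have b0: "bd G (verts G) = {}" using mG by (auto simp: bd_def multigraph_def)
  define \<S> where "\<S> = {K. \<exists>u\<in>verts G. K = cmp G (verts G) u \<and> (\<exists>R. free_ray G R \<and> ev R K)}"
  have sub: "K \<subseteq> verts G" "u \<in> K" "bd G K = {}" "conn G K" if "u \<in> verts G" "K = cmp G (verts G) u" for u K
    using cmp_subset[OF that(1), of G] cmp_self[of u G "verts G"] bd_cmp_sub[OF that(1), of G] cmp_conn[of G "verts G" u]
      b0 that(2) by auto
  have S: "K \<subseteq> verts G \<and> K \<noteq> {} \<and> bd G K = {} \<and> conn G K \<and> (\<exists>R. free_ray G R \<and> ev R K)" if "K \<in> \<S>" for K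
  proof -
    have "\<exists>u\<in>verts G. K = cmp G (verts G) u \<and> (\<exists>R. free_ray G R \<and> ev R K)"
      using that unfolding \<S>_def by (rule CollectD)
    then obtain u where u: "u \<in> verts G" "K = cmp G (verts G) u" "\<exists>R. free_ray G R \<and> ev R K"
      by (elim bexE conjE)
    show ?thesis using sub[OF u(1,2)] u(3) by blast
  qed
  have ne: "K \<noteq> verts G" if "K \<in> \<S>" "conn G (verts G)" for K using False S[OF that(1)] that(2) by auto
  have "good_children G (verts G) \<S>"
    unfolding good_children_def
  proof (intro conjI ballI allI impI)
    show "disjoint \<S>"
      unfolding disjoint_def
    proof (intro ballI impI)
      fix A B assume AB: "A \<in> \<S>" "B \<in> \<S>" "A \<noteq> B"
      then obtain u v where "A = cmp G (verts G) u" "B = cmp G (verts G) v" by (auto simp: \<S>_def)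
      then show "A \<inter> B = {}" using cmp_disjoint AB(3) by metis
    qed
    show "S \<subseteq> verts G" "S \<noteq> {}" "conn G S" "finite (bd G S)" if "S \<in> \<S>" for S
      using S[OF that] by auto
    show "S \<noteq> verts G" if "S \<in> \<S>" "conn G (verts G)" for S using ne that by blast
    show "\<exists>S\<in>\<S>. ev R S" if R: "free_ray G R" "ev R (verts G)" for R
    proof -
      obtain u where "u \<in> verts G" "ev R (cmp G (verts G) u)"
        using ev_cmp[OF _ R(2)] R(1) unfolding free_ray_def by blast
      then show ?thesis using R(1) unfolding \<S>_def by blast
    qed
    show "\<exists>R. free_ray G R \<and> ev R S \<and> (\<forall>D\<subseteq>verts G. finite (bd G D) \<longrightarrow> ev R D \<longrightarrow>
       min (bdc G S) (bdc G (verts G)) \<le> bdc G D)" if "S \<in> \<S>" for S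
      using S[OF that] b0 by auto
    show "\<exists>D'\<subseteq>S. finite (bd G D') \<and> ev R D' \<and> bdc G D' \<le> bdc G D"
      if "bdc G D < bdc G (verts G)" for S R D
      using that b0 by simp
    show "bdc G S < bdc G (verts G) \<or> (\<forall>u\<in>S. \<forall>e\<in>bd G (verts G). u \<notin> endpts G e)" for S
      using b0 by simp
  qed
  then show ?thesis by blast
qed

definition kids :: "('v, 'e) mgraph \<Rightarrow> 'v set \<Rightarrow> 'v set set" where
  "kids G C = (SOME \<S>. good_children G C \<S>)"

text \<open>The second component is the depth; it serves as the height function of
  \<open>ptree\<close>.\<close>

inductive_set nodes :: "('v, 'e) mgraph \<Rightarrow> ('v set \<times> nat) set" for G where
  root: "(verts G, 0) \<in> nodes G"
| child: "(C, n) \<in> nodes G \<Longrightarrow> S \<in> kids G C \<Longrightarrow> (S, Suc n) \<in> nodes G"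

text \<open>Off the root there is only one candidate: the sets of two candidates have equal depth
  and share the nonempty set \<open>fst x\<close>, so \<open>nodes_level_disjoint\<close> identifies
  them.\<close>

definition parent :: "('v, 'e) mgraph \<Rightarrow> 'v set \<times> nat \<Rightarrow> 'v set \<times> nat" where
  "parent G x = (SOME y. y \<in> nodes G \<and> fst x \<in> kids G (fst y) \<and> snd x = Suc (snd y))"

lemma nodes_props_pair:
  assumes mG: "multigraph G"
  shows "(C, n) \<in> nodes G \<Longrightarrow> good_children G C (kids G C) \<and> (n = 0 \<longrightarrow> C = verts G) \<and>
    (n \<noteq> 0 \<longrightarrow> conn G C \<and> C \<noteq> {} \<and> finite (bd G C)) \<and> C \<subseteq> verts G"
proof (induction rule: nodes.induct)
  case root
  then show ?case using someI_ex[OF good_children_verts[OF mG]] by (simp add: kids_def)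
next
  case (child C n S)
  then have g: "good_children G C (kids G C)" and C: "C \<subseteq> verts G" by simp_all
  have S: "S \<subseteq> C" "S \<noteq> {}" "conn G S" "finite (bd G S)"
    using good_childrenD(2,4-6)[OF g child.hyps(2)] by simp_all
  then have "\<exists>\<S>. good_children G S \<S>" using good_children_conn[OF S(3) _ S(2,4) mG] S(1) C by blast
  from someI_ex[OF this] show ?case using S C by (auto simp: kids_def)
qed

lemma nodes_props:
  assumes mG: "multigraph G" and x: "x \<in> nodes G"
  shows "good_children G (fst x) (kids G (fst x)) \<and> (snd x = 0 \<longrightarrow> fst x = verts G) \<and>
    (snd x \<noteq> 0 \<longrightarrow> conn G (fst x) \<and> fst x \<noteq> {} \<and> finite (bd G (fst x))) \<and> fst x \<subseteq> verts G"
  using nodes_props_pair[OF mG, of "fst x" "snd x"] x by simp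

text \<open>If two sets of equal depth meet, so do the sets they were chosen from; by induction
  these coincide, and members of the same \<open>kids\<close> are disjoint.\<close>

lemma nodes_level_disjoint:
  assumes mG: "multigraph G"
  shows "(A, n) \<in> nodes G \<Longrightarrow> (B, n) \<in> nodes G \<Longrightarrow> A \<inter> B \<noteq> {} \<Longrightarrow> A = B"
proof (induction n arbitrary: A B)
  case 0
  then show ?case using nodes_props[OF mG, of "(A, 0)"] nodes_props[OF mG, of "(B, 0)"] by simp
next
  case (Suc n)
  obtain A' where A': "(A', n) \<in> nodes G" "A \<in> kids G A'" using Suc.prems(1) by (cases rule: nodes.cases) auto
  obtain B' where B': "(B', n) \<in> nodes G" "B \<in> kids G B'" using Suc.prems(2) by (cases rule: nodes.cases) auto
  have g: "good_children G A' (kids G A')" "good_children G B' (kids G B')"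
    using nodes_props[OF mG A'(1)] nodes_props[OF mG B'(1)] by simp_all
  have "A \<subseteq> A'" "B \<subseteq> B'" using good_childrenD(2)[OF g(1) A'(2)] good_childrenD(2)[OF g(2) B'(2)] .
  then have "A' \<inter> B' \<noteq> {}" using Suc.prems(3) by blast
  then have "A' = B'" using Suc.IH A'(1) B'(1) by blast
  moreover have "disjoint (kids G A')" using good_childrenD(1)[OF g(1)] .
  ultimately show ?case using A'(2) B'(2) Suc.prems(3) unfolding disjoint_def by blast
qed

lemma parent_props:
  assumes mG: "multigraph G" and x: "x \<in> nodes G - {(verts G, 0)}"
  shows "parent G x \<in> nodes G \<and> fst x \<in> kids G (fst (parent G x)) \<and> snd x = Suc (snd (parent G x))"
proof -
  have "(fst x, snd x) \<in> nodes G" using x by simp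
  then have "\<exists>y. y \<in> nodes G \<and> fst x \<in> kids G (fst y) \<and> snd x = Suc (snd y)"
  proof (cases rule: nodes.cases)
    case root
    then show ?thesis using x by (metis DiffD2 prod.collapse singletonI)
  next
    case (child C n)
    then show ?thesis by (intro exI[of _ "(C, n)"]) simp
  qed
  from someI_ex[OF this] show ?thesis unfolding parent_def .
qed

lemma parent_child:
  assumes mG: "multigraph G" and y: "y \<in> nodes G" "S \<in> kids G (fst y)"
  shows "(S, Suc (snd y)) \<in> nodes G - {(verts G, 0)} \<and> parent G (S, Suc (snd y)) = y"
proof -
  let ?x = "(S, Suc (snd y))"
  have x: "?x \<in> nodes G - {(verts G, 0)}" using nodes.child[of "fst y" "snd y"] y by simp
  let ?p = "parent G ?x"
  have p: "?p \<in> nodes G" "S \<in> kids G (fst ?p)" "snd ?p = snd y" using parent_props[OF mG x] by auto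
  have g: "good_children G (fst y) (kids G (fst y))" "good_children G (fst ?p) (kids G (fst ?p))"
    using nodes_props[OF mG y(1)] nodes_props[OF mG p(1)] by simp_all
  have "S \<subseteq> fst y" "S \<subseteq> fst ?p" "S \<noteq> {}"
    using good_childrenD(2,4)[OF g(1) y(2)] good_childrenD(2)[OF g(2) p(2)] by simp_all
  then have "fst y \<inter> fst ?p \<noteq> {}" by blast
  then have "fst y = fst ?p"
    using nodes_level_disjoint[OF mG, of "fst y" "snd y" "fst ?p"] y(1) p(1,3) by (metis prod.collapse)
  then show ?thesis using x p(3) by (simp add: prod_eq_iff)
qed

lemma cut_tree_nodes:
  assumes mG: "multigraph G"
  shows "cut_tree (nodes G) (verts G, 0) (parent G) snd G fst"
proof -
  note pp = parent_props[OF mG]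
  have gp: "good_children G (fst (parent G x)) (kids G (fst (parent G x)))"
    if "x \<in> nodes G - {(verts G, 0)}" for x
    using nodes_props[OF mG] pp[OF that] by blast
  have nz: "snd x \<noteq> 0" if "x \<in> nodes G - {(verts G, 0)}" for x
    using pp[OF that] by simp
  show ?thesis
  proof
    show "(verts G, 0) \<in> nodes G" "snd (verts G, 0 :: nat) = 0" by (auto intro: nodes.root)
    show "parent G x \<in> nodes G \<and> snd x = Suc (snd (parent G x))" if "x \<in> nodes G" "x \<noteq> (verts G, 0)" for x
      using pp[of x] that by simp
    show "multigraph G" by (rule mG)
    show "fst (verts G, 0 :: nat) = verts G" by simp
    fix x assume x: "x \<in> nodes G - {(verts G, 0)}"
    note p = pp[OF x]
    have px: "fst x \<in> kids G (fst (parent G x))" using p by blast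
    note g = gp[OF x]
    show "fst x \<subseteq> fst (parent G x)" by (rule good_childrenD(2)[OF g px])
    show "fst x \<noteq> fst (parent G x)" if "parent G x \<noteq> (verts G, 0)"
    proof -
      have "conn G (fst (parent G x))"
        using nodes_props[OF mG, of "parent G x"] p nz[of "parent G x"] that by blast
      then show ?thesis by (rule good_childrenD(3)[OF g px])
    qed
    show "fst x \<noteq> {} \<and> conn G (fst x) \<and> finite (bd G (fst x))"
      using good_childrenD(4-6)[OF g px] by simp
    show "fst x \<inter> fst y = {}" if y: "y \<in> nodes G - {(verts G, 0)}" "parent G x = parent G y" "x \<noteq> y" for y
    proof -
      have "snd x = snd y" using p pp[OF y(1)] y(2) by simp
      then have "fst x \<noteq> fst y" using y(3) by (simp add: prod_eq_iff)
      moreover have "disjoint (kids G (fst (parent G x)))" by (rule good_childrenD(1)[OF g])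
      moreover have "fst y \<in> kids G (fst (parent G x))" using pp[OF y(1)] y(2) by simp
      ultimately show ?thesis using p unfolding disjoint_def by blast
    qed
    show "\<exists>R. free_ray G R \<and> ev R (fst x) \<and> (\<forall>D\<subseteq>fst (parent G x).
        finite (bd G D) \<longrightarrow> ev R D \<longrightarrow> min (bdc G (fst x)) (bdc G (fst (parent G x))) \<le> bdc G D)"
      by (rule good_childrenD(8)[OF g px])
    show "\<exists>D'\<subseteq>fst x. finite (bd G D') \<and> ev R D' \<and> bdc G D' \<le> bdc G D"
      if "free_ray G R" "ev R (fst x)" "D \<subseteq> fst (parent G x)" "finite (bd G D)" "ev R D"
        "bdc G D < bdc G (fst (parent G x))" for R D
      by (rule good_childrenD(9)[OF g px that])
    show "bdc G (fst x) < bdc G (fst (parent G x)) \<or>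
        (\<forall>u\<in>fst x. \<forall>e\<in>bd G (fst (parent G x)). u \<notin> endpts G e)"
      by (rule good_childrenD(10)[OF g px])
  next
    fix x R assume x: "x \<in> nodes G" and R: "free_ray G R" "ev R (fst x)"
    have g: "good_children G (fst x) (kids G (fst x))" using nodes_props[OF mG x] by blast
    obtain S where S: "S \<in> kids G (fst x)" "ev R S" using good_childrenD(7)[OF g R] by blast
    then show "\<exists>y\<in>nodes G - {(verts G, 0)}. parent G y = x \<and> ev R (fst y)"
      using parent_child[OF mG x S(1)] by (intro bexI[of _ "(S, Suc (snd x))"]) auto
  qed
qed

text \<open>At the root, \<open>part_above\<close> is the whole vertex set, so being componental
  there says exactly that \<open>G\<close> is nonempty and connected. Hence
  \<open>componental\<close> is asserted under this condition, and \<open>componental_at\<close> for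
  all other nodes in every case.\<close>

theorem theorem1p1:
  fixes G :: "('v, 'e) mgraph"
  assumes "multigraph G"
  shows "\<exists>(T :: ('v set \<times> nat, ('v set \<times> nat) set) mgraph) r V.
           tree_cut_decomposition G T r V \<and>
           finite_adhesion G T V \<and>
           linked G T r V \<and>
           (verts G \<noteq> {} \<and> connected_graph G \<longrightarrow> componental G T r V) \<and>
           (\<forall>t \<in> verts T - {r}. componental_at G T r V t) \<and>
           displays G T V {\<omega> \<in> edge_ends G. undominated G \<omega>}"
proof -
  interpret cut_tree "nodes G" "(verts G, 0)" "parent G" snd G fst
    by (rule cut_tree_nodes[OF assms])
  have rest: "\<forall>t \<in> verts T - {(verts G, 0)}. componental_at G T (verts G, 0) bag t"
    using componental_at_child by simp
  have "componental_at G T (verts G, 0) bag (verts G, 0)" if "verts G \<noteq> {}" "connected_graph G"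
  proof -
    have "induced G (verts G) = G"
      using assms by (auto simp: induced_def multigraph_def intro!: mgraph.equality)
    then show ?thesis using that componental_at_iff[OF nodes.root] by simp
  qed
  then have "verts G \<noteq> {} \<and> connected_graph G \<longrightarrow> componental G T (verts G, 0) bag"
    using rest unfolding componental_def by blast
  then show ?thesis using decomposition finite_adhesion linked displays rest by blast
qed

end
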